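(* Let $T_1$ and $T_2$ be Ehrenfeucht theories in disjoint predicate languages, and let $\Gamma_i=\langle \mathrm{RK}(T_i);\leq_{\rm RK}\rangle$ be (the graph of) the Rudin--Keisler preorder of $T_i$, $i=1,2$. Then: (i) The Rudin--Keisler preorder $\mathrm{RK}(T_1\sqcup T_2)$ of the disjoint union $T_1\sqcup T_2$ is represented by (is isomorphic, as a preordered set, to) the product $\Gamma_1\times\Gamma_2$. (ii) The following decomposition formula holds: $$I(T_1\sqcup T_2,\omega)=\sum_{\tilde{x},\tilde{y}}|\tilde{x}|\cdot|\tilde{y}|+\sum_{\tilde{x},\tilde{y}}\bigl(I_l(\tilde{x})\cdot|\tilde{y}|+|\tilde{x}|\cdot I_l(\tilde{y})+I_l(\tilde{x})\cdot I_l(\tilde{y})\bigr),$$ where in both sums $\tilde{x}$ ranges over all $\sim_{\rm RK}$-classes in $\mathrm{RK}(T_1)$ and $\tilde{y}$ ranges over all $\sim_{\rm RK}$-classes in $\mathrm{RK}(T_2)$. Here the first sum is the number of isomorphism types of countable models of $T_1\sqcup T_2$ that are prime over a tuple, and the summand of the second sum indexed by $(\tilde{x},\tilde{y})$ is $I_l(\tilde{z})$ for the $\sim_{\rm RK}$-class $\tilde{z}$ in $\mathrm{RK}(T_1\sqcup T_2)$ corresponding to $\tilde{x}\times\tilde{y}$. (iii) The structure $\Gamma_1\times\Gamma_2$ for $T_1\sqcup T_2$ forms a lattice if and only if both $\Gamma_1$ and $\Gamma_2$ form lattices; and $\Gamma_1\times\Gamma_2$ forms a Boolean lattice if and only if both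 $\Gamma_1$ and $\Gamma_2$ form Boolean lattices.
   Context: All theories are complete first-order theories in countable languages. $I(T,\omega)$ is the number of countable models of $T$ up to isomorphism. $T$ is Ehrenfeucht if $1<I(T,\omega)<\omega$. $S(T)$ is the set of complete types of $T$ over the empty set in finitely many variables. $T$ is small if $S(T)$ is countable (Ehrenfeucht theories are small). For small $T$ and $q\in S(T)$, $\mathcal{M}_q$ denotes the (unique up to isomorphism) model of $T$ that is prime over a realization of $q$; such models are said to be prime over a tuple. Rudin--Keisler preorder: for $p,q\in S(T)$, $\mathcal{M}_p\leq_{\rm RK}\mathcal{M}_q$ means $\mathcal{M}_q$ realizes $p$ (equivalently, $\mathcal{M}_p$ is elementarily embeddable in $\mathcal{M}_q$). $\mathrm{RK}(T)$ is the set of isomorphism types of the models $\mathcal{M}_p$, $p\in S(T)$, with the preorder induced by $\leq_{\rm RK}$. For isomorphism types, $\mathbf{M}_1\sim_{\rm RK}\mathbf{M}_2$ means $\mathbf{M}_1\leq_{\rm RK}\mathbf{M}_2$ and $\mathbf{M}_2\leq_{\rm RK}\mathbf{M}_1$. For a $\sim_{\rm RK}$-class $\tilde{x}$ in $\mathrm{RK}(T)$, $|\tilde{x}|$ is the number of isomorphism types in it. Limit models: a model $\mathcal{M}$ of $T$ is limit if it is not prime over any tuple and is the union of an elementary chain $(\mathcal{M}_n)_{n\in\omega}$ of models of $T$ each prime over a tuple; it is limit over a type $q$ if the chain can be chosen with every $\mathcal{M}_n$ isomorphic to $\mathcal{M}_q$. For a $\sim_{\rm RK}$-class $\tilde{x}$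 consisting of the isomorphism types of $\mathcal{M}_{p_1},\ldots,\mathcal{M}_{p_n}$, $I_l(\tilde{x})$ is the number of isomorphism types of models that are limit over some type $p_i$. Disjoint union: for structures $\mathcal{M}_1,\mathcal{M}_2$ with disjoint universes $M_1,M_2$ and disjoint predicate (relational) languages $\Sigma_1,\Sigma_2$, $\mathcal{M}_1\sqcup\mathcal{M}_2$ is the structure with universe $M_1\sqcup M_2$ in the language $\Sigma_1\cup\Sigma_2\cup\{P_1,P_2\}$, with $P_1,P_2$ new unary predicates interpreted by $P_i=M_i$, and symbols of $\Sigma_i$ interpreted as in $\mathcal{M}_i$. For theories $T_1,T_2$ in the languages $\Sigma_1,\Sigma_2$, $T_1\sqcup T_2=\mathrm{Th}(\mathcal{M}_1\sqcup\mathcal{M}_2)$ where $\mathcal{M}_i\models T_i$ (this does not depend on the choice of $\mathcal{M}_1,\mathcal{M}_2$). The product $\Gamma_1\times\Gamma_2$ of preordered sets carries the componentwise (Pareto) preorder: $(a_1,a_2)\leq(b_1,b_2)$ iff $a_1\leq b_1$ and $a_2\leq b_2$. A preordered set is said to form a (Boolean) lattice if its preorder is a partial order that is a (Boolean) lattice. *)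

theory Defs
  imports "HOL-Library.Extended_Nat" "HOL-Library.Countable_Set" "HOL-Algebra.Lattice"
begin

section \<open>Predicate languages, structures and satisfaction\<close>

text \<open>A predicate language is a partial map: its domain is the set of predicate symbols, and the
  value at a symbol is its arity.  Equality is a logical symbol.\<close>

type_synonym 'r lang = "'r \<Rightarrow> nat option"

datatype 'r fm =
    Equ nat nat
  | Rel 'r "nat list"
  | Neg "'r fm"
  | Conj "'r fm" "'r fm"
  | Exists nat "'r fm"

primrec fv :: "'r fm \<Rightarrow> nat set" where
  "fv (Equ i j) = {i, j}"
| "fv (Rel R is) = set is"
| "fv (Neg \<phi>) = fv \<phi>"
| "fv (Conj \<phi> \<psi>) = fv \<phi> \<union> fv \<psi>"
| "fv (Exists i \<phi>) = fv \<phi> - {i}"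

primrec in_lang :: "'r lang \<Rightarrow> 'r fm \<Rightarrow> bool" where
  "in_lang \<Sigma> (Equ i j) \<longleftrightarrow> True"
| "in_lang \<Sigma> (Rel R is) \<longleftrightarrow> \<Sigma> R = Some (length is)"
| "in_lang \<Sigma> (Neg \<phi>) \<longleftrightarrow> in_lang \<Sigma> \<phi>"
| "in_lang \<Sigma> (Conj \<phi> \<psi>) \<longleftrightarrow> in_lang \<Sigma> \<phi> \<and> in_lang \<Sigma> \<psi>"
| "in_lang \<Sigma> (Exists i \<phi>) \<longleftrightarrow> in_lang \<Sigma> \<phi>"

definition formulas :: "'r lang \<Rightarrow> nat \<Rightarrow> 'r fm set" where
  "formulas \<Sigma> n = {\<phi>. in_lang \<Sigma> \<phi> \<and> fv \<phi> \<subseteq> {..<n}}"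

definition sentences :: "'r lang \<Rightarrow> 'r fm set" where
  "sentences \<Sigma> = formulas \<Sigma> 0"

record ('r, 'a) struct =
  univ :: "'a set"
  interp :: "'r \<Rightarrow> 'a list set"

text \<open>The condition on \<open>interp\<close> makes symbols outside the language interpreted by the empty set,
  so a structure carries no information beyond its language.\<close>

definition is_struct :: "'r lang \<Rightarrow> ('r, 'a) struct \<Rightarrow> bool" where
  "is_struct \<Sigma> M \<longleftrightarrow> univ M \<noteq> {} \<and>
     (\<forall>R. \<forall>xs\<in>interp M R. \<Sigma> R = Some (length xs) \<and> set xs \<subseteq> univ M)"

primrec sat :: "('r, 'a) struct \<Rightarrow> (nat \<Rightarrow> 'a) \<Rightarrow> 'r fm \<Rightarrow> bool" where
  "sat M s (Equ i j) \<longleftrightarrow> s i = s j"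
| "sat M s (Rel R is) \<longleftrightarrow> map s is \<in> interp M R"
| "sat M s (Neg \<phi>) \<longleftrightarrow> \<not> sat M s \<phi>"
| "sat M s (Conj \<phi> \<psi>) \<longleftrightarrow> sat M s \<phi> \<and> sat M s \<psi>"
| "sat M s (Exists i \<phi>) \<longleftrightarrow> (\<exists>a\<in>univ M. sat M (s(i := a)) \<phi>)"

text \<open>For sentences the assignment is irrelevant, hence the quantification over all of them.\<close>

definition true_in :: "('r, 'a) struct \<Rightarrow> 'r fm \<Rightarrow> bool" where
  "true_in M \<phi> \<longleftrightarrow> (\<forall>s. sat M s \<phi>)"

definition model :: "'r lang \<Rightarrow> 'r fm set \<Rightarrow> ('r, 'a) struct \<Rightarrow> bool" where
  "model \<Sigma> T M \<longleftrightarrow> is_struct \<Sigma> M \<and> (\<forall>\<phi>\<in>T. true_in M \<phi>)"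

definition Th :: "'r lang \<Rightarrow> ('r, 'a) struct \<Rightarrow> 'r fm set" where
  "Th \<Sigma> M = {\<phi> \<in> sentences \<Sigma>. true_in M \<phi>}"

text \<open>HOL cannot quantify over the types of universes inside a definition.  Below, countable models
  are represented by models whose universe is a subset of \<open>nat\<close>; every countable model is
  isomorphic to such a one.  Where a notion refers to arbitrary models (consistency, semantic
  consequence, the models in which a prime model embeds), countable models suffice by the
  downward Loewenheim-Skolem theorem, since all languages are countable.\<close>

type_synonym 'r cstruct = "('r, nat) struct"

definition complete_theory :: "'r lang \<Rightarrow> 'r fm set \<Rightarrow> bool" where
  "complete_theory \<Sigma> T \<longleftrightarrow> T \<subseteq> sentences \<Sigma> \<and> (\<exists>M :: 'r cstruct. model \<Sigma> T M) \<and>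
     (\<forall>\<phi>\<in>sentences \<Sigma>. (\<forall>M :: 'r cstruct. model \<Sigma> T M \<longrightarrow> true_in M \<phi>) \<or>
                       (\<forall>M :: 'r cstruct. model \<Sigma> T M \<longrightarrow> true_in M (Neg \<phi>)))"


section \<open>Isomorphism types and the number of countable models\<close>

definition iso :: "('r, 'a) struct \<Rightarrow> ('r, 'b) struct \<Rightarrow> bool" where
  "iso M N \<longleftrightarrow> (\<exists>f. bij_betw f (univ M) (univ N) \<and>
     (\<forall>R xs. set xs \<subseteq> univ M \<longrightarrow> (xs \<in> interp M R \<longleftrightarrow> map f xs \<in> interp N R)))"

text \<open>The isomorphism type of a countable structure, as a class of structures on subsets of
  \<open>nat\<close>; the structure itself may live on any type.\<close>

definition iso_type :: "'r lang \<Rightarrow> ('r, 'a) struct \<Rightarrow> 'r cstruct set" where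
  "iso_type \<Sigma> M = {N. is_struct \<Sigma> N \<and> iso M N}"

definition ecard :: "'a set \<Rightarrow> enat" where
  "ecard A = (if finite A then enat (card A) else \<infinity>)"

definition num_models :: "'r lang \<Rightarrow> 'r fm set \<Rightarrow> enat" where
  "num_models \<Sigma> T = ecard {iso_type \<Sigma> M |M :: 'r cstruct. model \<Sigma> T M}"

definition Ehrenfeucht :: "'r lang \<Rightarrow> 'r fm set \<Rightarrow> bool" where
  "Ehrenfeucht \<Sigma> T \<longleftrightarrow> 1 < num_models \<Sigma> T \<and> num_models \<Sigma> T < \<infinity>"


section \<open>Complete types and models prime over a tuple\<close>

text \<open>Formulas of an \<open>n\<close>-type have their free variables among \<open>0, \<dots>, n - 1\<close>; the tuple \<open>as\<close>
  assigns \<open>as ! i\<close> to the variable \<open>i\<close>.\<close>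

definition tp :: "'r lang \<Rightarrow> ('r, 'a) struct \<Rightarrow> 'a list \<Rightarrow> 'r fm set" where
  "tp \<Sigma> M as = {\<phi> \<in> formulas \<Sigma> (length as). sat M (\<lambda>i. as ! i) \<phi>}"

definition complete_type :: "'r lang \<Rightarrow> 'r fm set \<Rightarrow> nat \<Rightarrow> 'r fm set \<Rightarrow> bool" where
  "complete_type \<Sigma> T n p \<longleftrightarrow> p \<subseteq> formulas \<Sigma> n \<and>
     (\<exists>(M :: 'r cstruct) as. model \<Sigma> T M \<and> as \<in> lists (univ M) \<and> length as = n \<and>
        (\<forall>\<phi>\<in>p. sat M (\<lambda>i. as ! i) \<phi>)) \<and>
     (\<forall>\<phi>\<in>formulas \<Sigma> n. \<phi> \<in> p \<or> Neg \<phi> \<in> p)"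

definition S :: "'r lang \<Rightarrow> 'r fm set \<Rightarrow> 'r fm set set" where
  "S \<Sigma> T = {p. \<exists>n. complete_type \<Sigma> T n p}"

definition realizes :: "'r lang \<Rightarrow> ('r, 'a) struct \<Rightarrow> 'r fm set \<Rightarrow> bool" where
  "realizes \<Sigma> M p \<longleftrightarrow> (\<exists>as\<in>lists (univ M). tp \<Sigma> M as = p)"

definition elementary_embedding ::
    "'r lang \<Rightarrow> ('a \<Rightarrow> 'b) \<Rightarrow> ('r, 'a) struct \<Rightarrow> ('r, 'b) struct \<Rightarrow> bool" where
  "elementary_embedding \<Sigma> f M N \<longleftrightarrow> f ` univ M \<subseteq> univ N \<and>
     (\<forall>\<phi> s. in_lang \<Sigma> \<phi> \<longrightarrow> range s \<subseteq> univ M \<longrightarrow> (sat M s \<phi> \<longleftrightarrow> sat N (f \<circ> s) \<phi>))"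

definition elementary_substruct :: "'r lang \<Rightarrow> ('r, 'a) struct \<Rightarrow> ('r, 'a) struct \<Rightarrow> bool" where
  "elementary_substruct \<Sigma> M N \<longleftrightarrow> elementary_embedding \<Sigma> id M N"

definition prime_over :: "'r lang \<Rightarrow> 'r fm set \<Rightarrow> 'r cstruct \<Rightarrow> nat list \<Rightarrow> bool" where
  "prime_over \<Sigma> T M as \<longleftrightarrow> model \<Sigma> T M \<and> as \<in> lists (univ M) \<and>
     (\<forall>(N :: 'r cstruct) bs. model \<Sigma> T N \<longrightarrow> bs \<in> lists (univ N) \<longrightarrow> tp \<Sigma> N bs = tp \<Sigma> M as \<longrightarrow>
        (\<exists>f. elementary_embedding \<Sigma> f M N \<and> map f as = bs))"

text \<open>\<open>prime_over_type \<Sigma> T q M\<close> says that \<open>M\<close> is (a copy of) the model \<open>M\<^sub>q\<close>.\<close>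

definition prime_over_type :: "'r lang \<Rightarrow> 'r fm set \<Rightarrow> 'r fm set \<Rightarrow> 'r cstruct \<Rightarrow> bool" where
  "prime_over_type \<Sigma> T q M \<longleftrightarrow> (\<exists>as. prime_over \<Sigma> T M as \<and> tp \<Sigma> M as = q)"

definition prime_over_tuple :: "'r lang \<Rightarrow> 'r fm set \<Rightarrow> 'r cstruct \<Rightarrow> bool" where
  "prime_over_tuple \<Sigma> T M \<longleftrightarrow> (\<exists>as. prime_over \<Sigma> T M as)"


section \<open>The Rudin-Keisler preorder\<close>

definition RK :: "'r lang \<Rightarrow> 'r fm set \<Rightarrow> 'r cstruct set set" where
  "RK \<Sigma> T = {iso_type \<Sigma> M |M. \<exists>q\<in>S \<Sigma> T. prime_over_type \<Sigma> T q M}"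

definition rk_le :: "'r lang \<Rightarrow> 'r fm set \<Rightarrow> 'r cstruct set \<Rightarrow> 'r cstruct set \<Rightarrow> bool" where
  "rk_le \<Sigma> T X Y \<longleftrightarrow> (\<exists>p\<in>S \<Sigma> T. \<exists>q\<in>S \<Sigma> T. \<exists>M\<in>X. \<exists>N\<in>Y.
     prime_over_type \<Sigma> T p M \<and> prime_over_type \<Sigma> T q N \<and> realizes \<Sigma> N p)"

text \<open>Preordered sets are records of type \<open>gorder\<close> whose equality is the actual one, so that the
  locales \<open>partial_order\<close>, \<open>lattice\<close>, \<open>bounded_lattice\<close> demand antisymmetry up to equality.\<close>

definition RK_graph :: "'r lang \<Rightarrow> 'r fm set \<Rightarrow> 'r cstruct set gorder" where
  "RK_graph \<Sigma> T = \<lparr>carrier = RK \<Sigma> T, eq = (=), le = rk_le \<Sigma> T\<rparr>"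

definition rk_equiv :: "'r lang \<Rightarrow> 'r fm set \<Rightarrow> ('r cstruct set \<times> 'r cstruct set) set" where
  "rk_equiv \<Sigma> T = {(X, Y). X \<in> RK \<Sigma> T \<and> Y \<in> RK \<Sigma> T \<and> rk_le \<Sigma> T X Y \<and> rk_le \<Sigma> T Y X}"

definition RK_classes :: "'r lang \<Rightarrow> 'r fm set \<Rightarrow> 'r cstruct set set set" where
  "RK_classes \<Sigma> T = RK \<Sigma> T // rk_equiv \<Sigma> T"


section \<open>Limit models\<close>

definition elementary_chain_union ::
    "'r lang \<Rightarrow> (nat \<Rightarrow> ('r, 'a) struct) \<Rightarrow> ('r, 'a) struct \<Rightarrow> bool" where
  "elementary_chain_union \<Sigma> C M \<longleftrightarrow> (\<forall>n. elementary_substruct \<Sigma> (C n) (C (Suc n))) \<and>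
     univ M = (\<Union>n. univ (C n)) \<and> (\<forall>R. interp M R = (\<Union>n. interp (C n) R))"

definition limit_over :: "'r lang \<Rightarrow> 'r fm set \<Rightarrow> 'r fm set \<Rightarrow> 'r cstruct \<Rightarrow> bool" where
  "limit_over \<Sigma> T q M \<longleftrightarrow> model \<Sigma> T M \<and> \<not> prime_over_tuple \<Sigma> T M \<and>
     (\<exists>C. (\<forall>n. prime_over_type \<Sigma> T q (C n)) \<and> elementary_chain_union \<Sigma> C M)"

text \<open>The number of isomorphism types of models that are limit over some type \<open>q\<close> for which the
  isomorphism type of \<open>M\<^sub>q\<close> belongs to the class \<open>x\<close>.\<close>

definition I_l :: "'r lang \<Rightarrow> 'r fm set \<Rightarrow> 'r cstruct set set \<Rightarrow> enat" where
  "I_l \<Sigma> T x = ecard {iso_type \<Sigma> M |M. \<exists>q\<in>S \<Sigma> T. \<exists>N.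
     prime_over_type \<Sigma> T q N \<and> iso_type \<Sigma> N \<in> x \<and> limit_over \<Sigma> T q M}"


section \<open>Disjoint unions\<close>

definition dunion_lang :: "'r \<Rightarrow> 'r \<Rightarrow> 'r lang \<Rightarrow> 'r lang \<Rightarrow> 'r lang" where
  "dunion_lang P\<^sub>1 P\<^sub>2 \<Sigma>\<^sub>1 \<Sigma>\<^sub>2 = (\<Sigma>\<^sub>1 ++ \<Sigma>\<^sub>2)(P\<^sub>1 \<mapsto> 1, P\<^sub>2 \<mapsto> 1)"

text \<open>The universes are made disjoint by the sum type.  A symbol of one language is interpreted by
  the empty set in structures of the other, disjoint language, so the union in the last line is
  just its interpretation in the structure it belongs to.\<close>

definition dunion :: "'r \<Rightarrow> 'r \<Rightarrow> ('r, 'a) struct \<Rightarrow> ('r, 'b) struct \<Rightarrow> ('r, 'a + 'b) struct" where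
  "dunion P\<^sub>1 P\<^sub>2 M\<^sub>1 M\<^sub>2 =
     \<lparr>univ = univ M\<^sub>1 <+> univ M\<^sub>2,
      interp = (\<lambda>R. if R = P\<^sub>1 then {[Inl a] |a. a \<in> univ M\<^sub>1}
                    else if R = P\<^sub>2 then {[Inr b] |b. b \<in> univ M\<^sub>2}
                    else map Inl ` interp M\<^sub>1 R \<union> map Inr ` interp M\<^sub>2 R)\<rparr>"

text \<open>The isomorphism type of the disjoint union of structures of isomorphism types \<open>X\<close> and
  \<open>Y\<close>; all members of the union are equal.\<close>

fun dunion_type ::
    "'r \<Rightarrow> 'r \<Rightarrow> 'r lang \<Rightarrow> 'r lang \<Rightarrow> 'r cstruct set \<times> 'r cstruct set \<Rightarrow> 'r cstruct set" where
  "dunion_type P\<^sub>1 P\<^sub>2 \<Sigma>\<^sub>1 \<Sigma>\<^sub>2 (X, Y) =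
     (\<Union>M\<^sub>1\<in>X. \<Union>M\<^sub>2\<in>Y. iso_type (dunion_lang P\<^sub>1 P\<^sub>2 \<Sigma>\<^sub>1 \<Sigma>\<^sub>2) (dunion P\<^sub>1 P\<^sub>2 M\<^sub>1 M\<^sub>2))"


section \<open>Preordered sets\<close>

definition preorder_prod :: "'a gorder \<Rightarrow> 'b gorder \<Rightarrow> ('a \<times> 'b) gorder" where
  "preorder_prod \<Gamma>\<^sub>1 \<Gamma>\<^sub>2 =
     \<lparr>carrier = carrier \<Gamma>\<^sub>1 \<times> carrier \<Gamma>\<^sub>2, eq = (=),
      le = (\<lambda>a b. fst a \<sqsubseteq>\<^bsub>\<Gamma>\<^sub>1\<^esub> fst b \<and> snd a \<sqsubseteq>\<^bsub>\<Gamma>\<^sub>2\<^esub> snd b)\<rparr>"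

definition preorder_iso :: "'a gorder \<Rightarrow> 'b gorder \<Rightarrow> ('a \<Rightarrow> 'b) \<Rightarrow> bool" where
  "preorder_iso \<Gamma> \<Delta> f \<longleftrightarrow> bij_betw f (carrier \<Gamma>) (carrier \<Delta>) \<and>
     (\<forall>x\<in>carrier \<Gamma>. \<forall>y\<in>carrier \<Gamma>. x \<sqsubseteq>\<^bsub>\<Gamma>\<^esub> y \<longleftrightarrow> f x \<sqsubseteq>\<^bsub>\<Delta>\<^esub> f y)"

definition boolean_lattice :: "'a gorder \<Rightarrow> bool" where
  "boolean_lattice L \<longleftrightarrow> bounded_lattice L \<and>
     (\<forall>x\<in>carrier L. \<forall>y\<in>carrier L. \<forall>z\<in>carrier L.
        x \<sqinter>\<^bsub>L\<^esub> (y \<squnion>\<^bsub>L\<^esub> z) = (x \<sqinter>\<^bsub>L\<^esub> y) \<squnion>\<^bsub>L\<^esub> (x \<sqinter>\<^bsub>L\<^esub> z)) \<and>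
     (\<forall>x\<in>carrier L. \<exists>y\<in>carrier L. x \<sqinter>\<^bsub>L\<^esub> y = \<bottom>\<^bsub>L\<^esub> \<and> x \<squnion>\<^bsub>L\<^esub> y = \<top>\<^bsub>L\<^esub>)"

end

theory Submission
  imports Defs
begin

text \<open>Every countable model \<open>N\<close> of \<open>T\<^sub>1 \<squnion> T\<^sub>2\<close> splits into its restrictions to \<open>P\<^sub>1\<close> and \<open>P\<^sub>2\<close>, and by
  the Feferman-Vaught theorem the type of a tuple of \<open>N\<close> is determined by the types of its two parts.
  Hence elementary embeddings, models prime over a tuple and elementary chains of such models split
  into components.  This gives the isomorphism of Rudin-Keisler preorders, since \<open>M\<^sub>p \<le> M\<^sub>q\<close> means that
  \<open>M\<^sub>p\<close> embeds elementarily in \<open>M\<^sub>q\<close>.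

  For a class \<open>x\<close> of the Rudin-Keisler equivalence consider the unions of chains of copies of some
  \<open>M\<^sub>q\<close> in \<open>x\<close>.  Those which are prime over a tuple are the members of \<open>x\<close>, by constant chains and by
  mutual embeddability; the others are the models counted by \<open>I\<^sub>l\<close>.  The chain unions of \<open>x \<times> y\<close> are
  the pairs of chain unions of \<open>x\<close> and of \<open>y\<close>, so inclusion-exclusion yields
  \<open>I\<^sub>l (x \<times> y) = (|x| + I\<^sub>l x) (|y| + I\<^sub>l y) - |x| |y|\<close>.

  The count of all countable models needs, in addition, that every countable model of a theory with
  finitely many countable models is such a chain union.  Finitely many countable models realize
  countably many types, so isolated types are dense over finite sets of parameters; a Henkin-style
  construction inside the model then writes it as the union of a chain of constructible, hence prime,
  submodels, and a subsequence of the chain consists of isomorphic models.\<close>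

section \<open>Basic model theory of countable languages\<close>

section \<open>Renaming of variables\<close>

text \<open>Countable models live on subsets of \<open>nat\<close>, so every construction that
  leaves this type has to return to it: ultrapowers come back through Loewenheim-Skolem, disjoint
  unions by coding one part with even and the other with odd numbers. No language with named
  parameters is formed; types over a finite set are handled by definable sets and by types of longer
  tuples.

  The obstacle in writing a model as a union of prime submodels is that the submodels must be
  nested: a witness chosen for one of them enters all larger ones as well and has to be isolated
  over what each of these contains so far. Therefore all submodels grow simultaneously. At each
  stage only finitely many elements are present, so only finitely many different parameter sets
  occur, and one point can be isolated over all of them by repeatedly passing to smaller atoms.

  Being a limit model does not behave well under pairing, since one limit entry suffices to make a
  pair of chain unions limit. This is why prime and limit chain unions are treated together and the
  prime ones are removed only at the end.\<close>

lemma finite_fv: "finite (fv \<phi>)"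
  by (induction \<phi>) auto

lemma sat_cong: "(\<And>i. i \<in> fv \<phi> \<Longrightarrow> s i = t i) \<Longrightarrow> sat M s \<phi> \<longleftrightarrow> sat M t \<phi>"
proof (induction \<phi> arbitrary: s t)
  case (Rel R "is")
  then have "map s is = map t is" by simp
  then show ?case by (simp only: sat.simps)
next
  case (Neg \<phi>)
  then show ?case by (metis fv.simps(3) sat.simps(3))
next
  case (Conj \<phi> \<psi>)
  then show ?case by (metis UnCI fv.simps(4) sat.simps(4))
next
  case (Exists i \<phi>)
  have "sat M (s(i := a)) \<phi> \<longleftrightarrow> sat M (t(i := a)) \<phi>" for a
    by (rule Exists.IH) (use Exists.prems in auto)
  then show ?case by simp
qed simp

text \<open>Renaming along an arbitrary \<open>h\<close>, possibly not injective. The new bound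
  variable exceeds the images of all other free variables, which excludes capture;
  \<open>insert 0\<close> guards \<open>Max\<close> against the empty set.\<close>

primrec ren :: "'r fm \<Rightarrow> (nat \<Rightarrow> nat) \<Rightarrow> 'r fm" where
  "ren (Equ i j) h = Equ (h i) (h j)"
| "ren (Rel R is) h = Rel R (map h is)"
| "ren (Neg \<phi>) h = Neg (ren \<phi> h)"
| "ren (Conj \<phi> \<psi>) h = Conj (ren \<phi> h) (ren \<psi> h)"
| "ren (Exists i \<phi>) h =
     (let j = Suc (Max (insert 0 (h ` (fv \<phi> - {i})))) in Exists j (ren \<phi> (h(i := j))))"

lemma fresh_not_in:
  "finite A \<Longrightarrow> Suc (Max (insert 0 A)) \<notin> A"
  by (metis Max_ge Suc_n_not_le_n finite_insert insertCI)

lemma fv_ren: "fv (ren \<phi> h) \<subseteq> h ` fv \<phi>"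
proof (induction \<phi> arbitrary: h)
  case (Exists i \<phi>)
  let ?j = "Suc (Max (insert 0 (h ` (fv \<phi> - {i}))))"
  have "fv (ren \<phi> (h(i := ?j))) \<subseteq> (h(i := ?j)) ` fv \<phi>" by (rule Exists.IH)
  then have "fv (ren \<phi> (h(i := ?j))) - {?j} \<subseteq> h ` (fv \<phi> - {i})" by fastforce
  then show ?case by (simp add: Let_def)
qed fastforce+

lemma in_lang_ren [simp]: "in_lang \<Sigma> (ren \<phi> h) \<longleftrightarrow> in_lang \<Sigma> \<phi>"
  by (induction \<phi> arbitrary: h) (auto simp: Let_def)

lemma sat_ren: "sat M s (ren \<phi> h) \<longleftrightarrow> sat M (s \<circ> h) \<phi>"
proof (induction \<phi> arbitrary: s h)
  case (Exists i \<phi>)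
  let ?j = "Suc (Max (insert 0 (h ` (fv \<phi> - {i}))))"
  have "?j \<notin> h ` (fv \<phi> - {i})" by (rule fresh_not_in) (simp add: finite_fv)
  then have eq: "sat M (s(?j := a) \<circ> h(i := ?j)) \<phi> \<longleftrightarrow> sat M ((s \<circ> h)(i := a)) \<phi>" for a
    by (intro sat_cong) force
  show ?case by (simp only: ren.simps Let_def sat.simps Exists.IH eq)
qed auto

instance fm :: (countable) countable by countable_datatype

text \<open>The type of symbols may be uncountable, so countability of the datatype does not apply
  directly. Numbering the symbols of the language presents each formula as the image of one over the
  symbol type \<open>nat\<close>, and there are only countably many of those.\<close>

lemma countable_in_lang:
  assumes "countable (dom \<Sigma>)"
  shows "countable {\<phi>. in_lang \<Sigma> \<phi>}"
proof -
  have set: "in_lang \<Sigma> \<phi> \<Longrightarrow> set_fm \<phi> \<subseteq> dom \<Sigma>" for \<phi> by (induction \<phi>) auto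
  have "\<phi> \<in> range (map_fm (from_nat_into (dom \<Sigma>)))" if "in_lang \<Sigma> \<phi>" for \<phi>
  proof -
    have "map_fm (from_nat_into (dom \<Sigma>)) (map_fm (to_nat_on (dom \<Sigma>)) \<phi>) = \<phi>"
      unfolding fm.map_comp
      by (rule fm.map_ident_strong)
        (use set[OF that] assms in \<open>auto intro!: from_nat_into_to_nat_on\<close>)
    then show ?thesis by (metis rangeI)
  qed
  then have "{\<phi>. in_lang \<Sigma> \<phi>} \<subseteq> range (map_fm (from_nat_into (dom \<Sigma>)))" by blast
  then show ?thesis by (rule countable_subset) simp
qed

section \<open>Types of tuples\<close>

lemma tp_length:
  assumes "tp \<Sigma> M as = tp \<Sigma> N bs"
  shows "length as = length bs"
proof -
  have "Equ i i \<in> tp \<Sigma> M as \<longleftrightarrow> i < length as" for i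
    by (auto simp: tp_def formulas_def)
  moreover have "Equ i i \<in> tp \<Sigma> N bs \<longleftrightarrow> i < length bs" for i
    by (auto simp: tp_def formulas_def)
  ultimately show ?thesis using assms by (metis linorder_neq_iff)
qed

text \<open>Types contain formulas in the variables \<open>0, ..., n - 1\<close> only. Renaming
  along \<open>h\<close> brings formulas in other variables, read at permuted or repeated
  coordinates, within their reach.\<close>

lemma tp_sat:
  assumes "tp \<Sigma> M as = tp \<Sigma> N bs" "in_lang \<Sigma> \<phi>" "h ` fv \<phi> \<subseteq> {..<length as}"
  shows "sat M (\<lambda>i. as ! h i) \<phi> \<longleftrightarrow> sat N (\<lambda>i. bs ! h i) \<phi>"
proof -
  have "ren \<phi> h \<in> formulas \<Sigma> (length as)"
    using assms(2,3) fv_ren[of \<phi> h] by (auto simp: formulas_def)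
  then have "sat M ((!) as) (ren \<phi> h) \<longleftrightarrow> sat N ((!) bs) (ren \<phi> h)"
    using assms(1) tp_length[OF assms(1)] by (auto simp: tp_def)
  then show ?thesis by (simp add: sat_ren comp_def)
qed

lemma tp_eqI:
  assumes "length as = length bs"
    and "\<And>\<phi>. \<phi> \<in> formulas \<Sigma> (length as) \<Longrightarrow> sat M ((!) as) \<phi> \<longleftrightarrow> sat N ((!) bs) \<phi>"
  shows "tp \<Sigma> M as = tp \<Sigma> N bs"
  using assms by (auto simp: tp_def)

lemma sat_sentence:
  assumes "\<phi> \<in> sentences \<Sigma>"
  shows "sat M s \<phi> \<longleftrightarrow> true_in M \<phi>"
proof -
  have "fv \<phi> = {}" using assms by (auto simp: sentences_def formulas_def)
  then have "sat M s \<phi> \<longleftrightarrow> sat M t \<phi>" for t by (intro sat_cong) simp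
  then show ?thesis by (auto simp: true_in_def)
qed

section \<open>Elementary embeddings and isomorphisms\<close>

text \<open>The definition of elementary embeddings speaks of assignments with all values in
  \<open>M\<close>. Resetting the irrelevant variables to a fixed \<open>d\<close> makes it
  applicable to assignments such as \<open>(!) as\<close>, which are unspecified beyond the
  tuple.\<close>

lemma emb_sat:
  assumes "elementary_embedding \<Sigma> f M N" "in_lang \<Sigma> \<phi>" "univ M \<noteq> {}"
    and "\<And>i. i \<in> fv \<phi> \<Longrightarrow> s i \<in> univ M"
  shows "sat M s \<phi> \<longleftrightarrow> sat N (f \<circ> s) \<phi>"
proof -
  obtain d where d: "d \<in> univ M" using assms(3) by blast
  let ?s = "\<lambda>i. if i \<in> fv \<phi> then s i else d"
  have "sat M s \<phi> \<longleftrightarrow> sat M ?s \<phi>" by (rule sat_cong) simp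
  also have "\<dots> \<longleftrightarrow> sat N (f \<circ> ?s) \<phi>"
    using assms d unfolding elementary_embedding_def by (auto simp: image_subset_iff)
  also have "\<dots> \<longleftrightarrow> sat N (f \<circ> s) \<phi>" by (rule sat_cong) simp
  finally show ?thesis .
qed

lemma emb_range: "elementary_embedding \<Sigma> f M N \<Longrightarrow> x \<in> univ M \<Longrightarrow> f x \<in> univ N"
  by (auto simp: elementary_embedding_def)

lemma emb_inj:
  assumes "elementary_embedding \<Sigma> f M N"
  shows "inj_on f (univ M)"
proof (rule inj_onI)
  fix x y assume "x \<in> univ M" "y \<in> univ M" "f x = f y"
  then have "sat M (\<lambda>i. if i = 0 then x else y) (Equ 0 1) \<longleftrightarrow>
      sat N (f \<circ> (\<lambda>i. if i = 0 then x else y)) (Equ 0 1)"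
    by (intro emb_sat[OF assms]) auto
  then show "x = y" using \<open>f x = f y\<close> by simp
qed

lemma emb_comp:
  assumes f: "elementary_embedding \<Sigma> f M N" and g: "elementary_embedding \<Sigma> g N K"
  shows "elementary_embedding \<Sigma> (g \<circ> f) M K"
proof -
  have "sat M s \<phi> \<longleftrightarrow> sat K (g \<circ> f \<circ> s) \<phi>" if "in_lang \<Sigma> \<phi>" "range s \<subseteq> univ M" for \<phi> s
  proof -
    have "range (f \<circ> s) \<subseteq> univ N" using f that by (auto simp: elementary_embedding_def)
    then show ?thesis using f g that unfolding elementary_embedding_def by (metis comp_assoc)
  qed
  moreover have "(g \<circ> f) ` univ M \<subseteq> univ K"
    using f g unfolding elementary_embedding_def by (metis image_comp image_mono order_trans)
  ultimately show ?thesis by (simp add: elementary_embedding_def)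
qed

lemma emb_id: "elementary_embedding \<Sigma> id M M"
  by (simp add: elementary_embedding_def)

lemma emb_cong:
  fixes M :: "('r, 'a) struct"
  assumes "elementary_embedding \<Sigma> f M N" "\<And>x. x \<in> univ M \<Longrightarrow> f x = g x"
  shows "elementary_embedding \<Sigma> g M N"
proof -
  have "g \<circ> s = f \<circ> s" if "range s \<subseteq> univ M" for s :: "nat \<Rightarrow> 'a"
    using that assms(2) by (simp add: fun_eq_iff image_subset_iff)
  then show ?thesis using assms unfolding elementary_embedding_def
    by (metis (no_types, lifting) image_cong)
qed

lemma emb_tp:
  assumes "elementary_embedding \<Sigma> f M N" "as \<in> lists (univ M)" "univ M \<noteq> {}"
  shows "tp \<Sigma> N (map f as) = tp \<Sigma> M as"
proof (rule tp_eqI)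
  fix \<phi> assume "\<phi> \<in> formulas \<Sigma> (length (map f as))"
  then have l: "in_lang \<Sigma> \<phi>" "fv \<phi> \<subseteq> {..<length as}" by (auto simp: formulas_def)
  then have "as ! i \<in> univ M" if "i \<in> fv \<phi>" for i
    using assms(2) nth_mem that by blast
  then have "sat M ((!) as) \<phi> \<longleftrightarrow> sat N (f \<circ> (!) as) \<phi>" by (intro emb_sat[OF assms(1)] assms l)
  also have "\<dots> \<longleftrightarrow> sat N ((!) (map f as)) \<phi>" by (rule sat_cong) (use l in auto)
  finally show "sat N ((!) (map f as)) \<phi> \<longleftrightarrow> sat M ((!) as) \<phi>" by simp
qed simp

lemma emb_true_in:
  assumes "elementary_embedding \<Sigma> f M N" "\<phi> \<in> sentences \<Sigma>" "univ M \<noteq> {}"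
  shows "true_in M \<phi> \<longleftrightarrow> true_in N \<phi>"
proof -
  obtain d where "d \<in> univ M" using assms by blast
  have "sat M (\<lambda>_. d) \<phi> \<longleftrightarrow> sat N (f \<circ> (\<lambda>_. d)) \<phi>"
    using assms \<open>d \<in> univ M\<close> by (intro emb_sat[OF assms(1)]) (auto simp: sentences_def formulas_def)
  then show ?thesis using sat_sentence[OF assms(2)] by metis
qed

lemma emb_model:
  assumes "elementary_embedding \<Sigma> f M N" "T \<subseteq> sentences \<Sigma>" "is_struct \<Sigma> M" "is_struct \<Sigma> N"
  shows "model \<Sigma> T M \<longleftrightarrow> model \<Sigma> T N"
proof -
  have "true_in M \<phi> \<longleftrightarrow> true_in N \<phi>" if "\<phi> \<in> T" for \<phi>
    using emb_true_in[OF assms(1)] assms(2,3) that by (auto simp: is_struct_def)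
  then show ?thesis using assms(3,4) by (simp add: model_def)
qed

definition iso_via :: "('a \<Rightarrow> 'b) \<Rightarrow> ('r, 'a) struct \<Rightarrow> ('r, 'b) struct \<Rightarrow> bool" where
  "iso_via f M N \<longleftrightarrow> bij_betw f (univ M) (univ N) \<and>
     (\<forall>R xs. set xs \<subseteq> univ M \<longrightarrow> (xs \<in> interp M R \<longleftrightarrow> map f xs \<in> interp N R))"

lemma iso_iff: "iso M N \<longleftrightarrow> (\<exists>f. iso_via f M N)"
  by (simp add: iso_def iso_via_def)

lemma iso_via_emb:
  assumes "iso_via f M N"
  shows "elementary_embedding \<Sigma> f M N"
proof -
  have bij: "f ` univ M = univ N" "inj_on f (univ M)"
    using assms by (auto simp: iso_via_def bij_betw_def)
  have "range s \<subseteq> univ M \<Longrightarrow> sat M s \<phi> \<longleftrightarrow> sat N (f \<circ> s) \<phi>" for s \<phi>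
  proof (induction \<phi> arbitrary: s)
    case (Equ i j)
    then show ?case using bij(2) by (auto simp: inj_on_def image_subset_iff)
  next
    case (Rel R "is")
    then have "set (map s is) \<subseteq> univ M" by auto
    then show ?case using assms unfolding iso_via_def by (metis map_map sat.simps(2))
  next
    case (Exists i \<phi>)
    have "sat M (s(i := a)) \<phi> \<longleftrightarrow> sat N ((f \<circ> s)(i := f a)) \<phi>" if "a \<in> univ M" for a
    proof -
      have "range (s(i := a)) \<subseteq> univ M" using Exists.prems that by auto
      then show ?thesis using Exists.IH by (metis fun_upd_comp)
    qed
    then show ?case by (simp add: comp_def flip: bij(1))
  qed auto
  then show ?thesis using bij by (auto simp: elementary_embedding_def)
qed

lemma iso_via_inv:
  assumes "iso_via f M N"
  shows "iso_via (inv_into (univ M) f) N M"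
proof -
  have b: "bij_betw f (univ M) (univ N)" using assms by (simp add: iso_via_def)
  have "ys \<in> interp N R \<longleftrightarrow> map (inv_into (univ M) f) ys \<in> interp M R" if "set ys \<subseteq> univ N" for ys R
  proof -
    let ?xs = "map (inv_into (univ M) f) ys"
    have "f (inv_into (univ M) f y) = y" if "y \<in> univ N" for y
      using b that by (simp add: bij_betw_inv_into_right)
    then have "map f ?xs = ys" using that by (auto simp: comp_def intro!: map_idI)
    moreover have "set ?xs \<subseteq> univ M" using that b by (auto simp: bij_betw_def inv_into_into)
    ultimately show ?thesis using assms unfolding iso_via_def by metis
  qed
  then show ?thesis using bij_betw_inv_into[OF b] by (simp add: iso_via_def)
qed

lemma iso_via_comp:
  assumes "iso_via f M N" "iso_via g N K"
  shows "iso_via (g \<circ> f) M K"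
proof -
  have "xs \<in> interp M R \<longleftrightarrow> map (g \<circ> f) xs \<in> interp K R" if "set xs \<subseteq> univ M" for xs R
  proof -
    have "set (map f xs) \<subseteq> univ N" using that assms(1) by (auto simp: iso_via_def bij_betw_def)
    then show ?thesis using assms that unfolding iso_via_def by (metis map_map)
  qed
  then show ?thesis using assms bij_betw_trans by (auto simp: iso_via_def)
qed

lemma iso_refl [simp]: "iso M M"
  by (force simp: iso_iff iso_via_def intro: exI[of _ id])

lemma iso_sym: "iso M N \<Longrightarrow> iso N M"
  unfolding iso_iff using iso_via_inv by blast

lemma iso_trans: "iso M N \<Longrightarrow> iso N K \<Longrightarrow> iso M K"
  unfolding iso_iff by (elim exE) (rule exI, rule iso_via_comp)

lemma iso_type_cong: "iso M N \<Longrightarrow> iso_type \<Sigma> M = iso_type \<Sigma> N"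
  unfolding iso_type_def by (intro Collect_cong conj_cong refl iffI) (erule iso_trans[OF iso_sym], assumption, erule iso_trans, assumption)

lemma in_iso_type: "is_struct \<Sigma> N \<Longrightarrow> N \<in> iso_type \<Sigma> M \<longleftrightarrow> iso M N"
  by (simp add: iso_type_def)

lemma iso_type_eq_iff:
  fixes N :: "'r cstruct"
  assumes "is_struct \<Sigma> N"
  shows "iso_type \<Sigma> M = iso_type \<Sigma> N \<longleftrightarrow> iso M N"
proof
  assume eq: "iso_type \<Sigma> M = iso_type \<Sigma> N"
  have "N \<in> iso_type \<Sigma> N" using assms by (simp add: in_iso_type)
  then have "N \<in> iso_type \<Sigma> M" by (simp only: eq)
  then show "iso M N" by (simp add: iso_type_def)
qed (rule iso_type_cong)

definition copy :: "('a \<Rightarrow> 'b) \<Rightarrow> ('r, 'a) struct \<Rightarrow> ('r, 'b) struct" where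
  "copy f M = \<lparr>univ = f ` univ M, interp = (\<lambda>R. map f ` interp M R)\<rparr>"

lemma is_struct_copy: "is_struct \<Sigma> M \<Longrightarrow> is_struct \<Sigma> (copy f M)"
  by (fastforce simp: is_struct_def copy_def)

lemma iso_via_copy:
  assumes "inj_on f (univ M)" "is_struct \<Sigma> M"
  shows "iso_via f M (copy f M)"
proof -
  have "xs \<in> interp M R" if xs: "set xs \<subseteq> univ M" "map f xs \<in> map f ` interp M R" for R and xs :: "'a list"
  proof -
    obtain ys where ys: "ys \<in> interp M R" "map f xs = map f ys" using xs(2) by (auto elim!: imageE)
    then have "set ys \<subseteq> univ M" using assms(2) by (auto simp: is_struct_def)
    then have "inj_on f (set xs \<union> set ys)" using assms(1) xs(1) by (simp add: inj_on_subset)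
    then show ?thesis using ys inj_on_map_eq_map by metis
  qed
  then show "iso_via f M (copy f M)"
    using assms(1) by (auto simp: iso_via_def copy_def bij_betw_def)
qed

definition sub :: "('r, 'a) struct \<Rightarrow> 'a set \<Rightarrow> ('r, 'a) struct" where
  "sub M B = \<lparr>univ = B, interp = (\<lambda>R. interp M R \<inter> lists B)\<rparr>"

lemma univ_sub [simp]: "univ (sub M B) = B" by (simp add: sub_def)

lemma is_struct_sub: "is_struct \<Sigma> M \<Longrightarrow> B \<noteq> {} \<Longrightarrow> is_struct \<Sigma> (sub M B)"
  by (auto simp: is_struct_def sub_def)

lemma Tarski_Vaught:
  assumes "B \<subseteq> univ M"
    and "\<And>\<phi> i s. in_lang \<Sigma> \<phi> \<Longrightarrow> range s \<subseteq> B \<Longrightarrow> \<exists>a\<in>univ M. sat M (s(i := a)) \<phi> \<Longrightarrow>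
           \<exists>b\<in>B. sat M (s(i := b)) \<phi>"
  shows "elementary_embedding \<Sigma> id (sub M B) M"
proof -
  have "in_lang \<Sigma> \<phi> \<Longrightarrow> range s \<subseteq> B \<Longrightarrow> sat (sub M B) s \<phi> \<longleftrightarrow> sat M s \<phi>" for s \<phi>
  proof (induction \<phi> arbitrary: s)
    case (Rel R "is")
    then have "map s is \<in> lists B" by (auto simp: image_subset_iff)
    then show ?case by (simp add: sub_def)
  next
    case (Exists i \<phi>)
    have "sat (sub M B) (s(i := a)) \<phi> \<longleftrightarrow> sat M (s(i := a)) \<phi>" if "a \<in> B" for a
      by (rule Exists.IH) (use Exists.prems that in auto)
    then show ?case using assms(1) assms(2)[of \<phi> s i] Exists.prems by auto
  qed auto
  then show ?thesis using assms(1) by (simp add: elementary_embedding_def)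
qed

section \<open>The downward Loewenheim-Skolem theorem\<close>

text \<open>A Skolem hull: \<open>A\<close> is closed under one chosen witness for each existential
  statement with parameters in the set already obtained.\<close>

lemma Loewenheim_Skolem_sub:
  fixes M :: "('r, 'a) struct"
  assumes cnt: "countable (dom \<Sigma>)" and ne: "univ M \<noteq> {}" and A: "A \<subseteq> univ M" "countable A"
  shows "\<exists>B. A \<subseteq> B \<and> B \<subseteq> univ M \<and> countable B \<and> B \<noteq> {} \<and>
    elementary_embedding \<Sigma> id (sub M B) M"
proof -
  obtain d where d: "d \<in> univ M" using ne by blast
  \<comment> \<open>Finite lists replace assignments, which would be uncountably many in general;
    \<open>d\<close> is read beyond the end of the list.\<close>
  define asg :: "'a list \<Rightarrow> nat \<Rightarrow> 'a" where "asg l i = (if i < length l then l ! i else d)" for l i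
  define W where "W = (\<lambda>(\<phi>, i, l). SOME a. a \<in> univ M \<and>
    ((\<exists>a\<in>univ M. sat M ((asg l)(i := a)) \<phi>) \<longrightarrow> sat M ((asg l)(i := a)) \<phi>))"
  have W: "W (\<phi>, i, l) \<in> univ M \<and>
    ((\<exists>a\<in>univ M. sat M ((asg l)(i := a)) \<phi>) \<longrightarrow> sat M ((asg l)(i := W (\<phi>, i, l))) \<phi>)" for \<phi> i l
    unfolding W_def prod.case by (rule someI_ex) (use d in blast)
  define step where "step X = X \<union> W ` ({\<phi>. in_lang \<Sigma> \<phi>} \<times> UNIV \<times> lists X)" for X
  define Bn where "Bn n = (step ^^ n) (insert d A)" for n
  have Bn_Suc: "Bn (Suc n) = step (Bn n)" for n by (simp add: Bn_def)
  have "mono Bn" unfolding mono_iff_le_Suc Bn_Suc step_def by blast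
  have sub: "Bn n \<subseteq> univ M" for n
  proof (induction n)
    case 0 then show ?case using d A by (simp add: Bn_def)
  next
    case (Suc n) then show ?case using W unfolding Bn_Suc step_def by auto
  qed
  have count: "countable (Bn n)" for n
  proof (induction n)
    case 0 then show ?case using A by (simp add: Bn_def)
  next
    case (Suc n)
    then show ?case unfolding Bn_Suc step_def
      by (intro countable_Un countable_image countable_SIGMA countable_in_lang cnt) auto
  qed
  define B where "B = (\<Union>n. Bn n)"
  have lists: "\<exists>n. l \<in> lists (Bn n)" if "l \<in> lists B" for l
    using that
  proof (induction l)
    case (Cons x l)
    then obtain n m where "l \<in> lists (Bn n)" "x \<in> Bn m" by (auto simp: B_def)
    then have "x # l \<in> lists (Bn (max n m))"
      using monoD[OF \<open>mono Bn\<close>, of n "max n m"] monoD[OF \<open>mono Bn\<close>, of m "max n m"]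
      by (auto simp: subset_iff)
    then show ?case by blast
  qed simp
  have "elementary_embedding \<Sigma> id (sub M B) M"
  proof (rule Tarski_Vaught)
    show "B \<subseteq> univ M" using sub by (auto simp: B_def)
    fix \<phi> i and s :: "nat \<Rightarrow> 'a"
    assume \<phi>: "in_lang \<Sigma> \<phi>" and s: "range s \<subseteq> B" and ex: "\<exists>a\<in>univ M. sat M (s(i := a)) \<phi>"
    obtain m where m: "fv \<phi> \<subseteq> {..<m}"
      using finite_fv[of \<phi>] by (meson finite_nat_bounded)
    \<comment> \<open>Only an initial segment of \<open>s\<close> matters for \<open>\<phi>\<close>,
      and a finite list of elements of the union lies in a single stage.\<close>
    define l where "l = map s [0..<m]"
    have "l \<in> lists B" using s by (auto simp: l_def image_subset_iff)
    then obtain n where n: "l \<in> lists (Bn n)" using lists by blast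
    have eq: "sat M ((asg l)(i := a)) \<phi> \<longleftrightarrow> sat M (s(i := a)) \<phi>" for a
      by (rule sat_cong) (use m in \<open>auto simp: asg_def l_def\<close>)
    have "W (\<phi>, i, l) \<in> Bn (Suc n)" unfolding Bn_Suc step_def using \<phi> n by blast
    moreover have "sat M (s(i := W (\<phi>, i, l))) \<phi>" using W[where i = i and l = l and \<phi> = \<phi>] ex unfolding eq by blast
    ultimately show "\<exists>b\<in>B. sat M (s(i := b)) \<phi>" by (auto simp: B_def)
  qed
  moreover have "insert d A \<subseteq> B" unfolding B_def using Bn_def[of 0] by auto
  moreover have "countable B" using count by (simp add: B_def)
  moreover have "B \<subseteq> univ M" using sub by (auto simp: B_def)
  ultimately show ?thesis by blast
qed

text \<open>The hull is numbered by natural numbers, because the definitions of theories and types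
  only see structures on \<open>nat\<close>. The embedding runs from the numbered copy into
  \<open>M\<close>.\<close>

lemma Loewenheim_Skolem:
  fixes M :: "('r, 'a) struct"
  assumes "countable (dom \<Sigma>)" "is_struct \<Sigma> M" "A \<subseteq> univ M" "countable A"
  shows "\<exists>(N :: 'r cstruct) f. is_struct \<Sigma> N \<and> elementary_embedding \<Sigma> f N M \<and> A \<subseteq> f ` univ N"
proof -
  have "univ M \<noteq> {}" using assms(2) by (simp add: is_struct_def)
  then obtain B where B: "A \<subseteq> B" "B \<subseteq> univ M" "countable B" "B \<noteq> {}"
    "elementary_embedding \<Sigma> id (sub M B) M"
    using Loewenheim_Skolem_sub[OF assms(1) _ assms(3,4)] by blast
  define g where "g = to_nat_on B"
  define N where "N = copy g (sub M B)"
  have inj: "inj_on g B" using B(3) unfolding g_def by (rule inj_on_to_nat_on)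
  have st: "is_struct \<Sigma> (sub M B)" using assms(2) B(4) by (rule is_struct_sub)
  have iso: "iso_via g (sub M B) N" unfolding N_def using inj st by (intro iso_via_copy) auto
  define f where "f = id \<circ> inv_into B g"
  have "iso_via (inv_into B g) N (sub M B)" using iso_via_inv[OF iso] by simp
  then have "elementary_embedding \<Sigma> f N M"
    unfolding f_def using B(5) by (intro emb_comp[OF iso_via_emb])
  moreover have "A \<subseteq> f ` univ N"
  proof
    fix x assume "x \<in> A"
    then have "x = f (g x)" "g x \<in> univ N" using B(1) inj by (auto simp: f_def N_def copy_def)
    then show "x \<in> f ` univ N" by blast
  qed
  moreover have "is_struct \<Sigma> N" unfolding N_def using st by (rule is_struct_copy)
  ultimately show ?thesis by blast
qed

section \<open>Realizing types by ultrapowers\<close>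

section \<open>Ultrapowers\<close>

text \<open>Lying below \<open>sequentially\<close> means containing all cofinite sets, so the
  ultrafilter is nonprincipal and inherits every property that holds for all large
  \<open>n\<close>.\<close>

definition ultrafilter :: "nat filter \<Rightarrow> bool" where
  "ultrafilter U \<longleftrightarrow> U \<noteq> bot \<and> U \<le> sequentially \<and>
     (\<forall>P. eventually P U \<or> eventually (\<lambda>n. \<not> P n) U)"

lemma ex_ultrafilter: "\<exists>U. ultrafilter U"
proof -
  define A where "A = {F :: nat filter. F \<noteq> bot \<and> F \<le> sequentially}"
  \<comment> \<open>Finer filters are smaller in the order on filters, so Zorn's lemma is used for
    \<open>(\<ge>)\<close> and yields a minimal proper filter.\<close>
  have "\<exists>U\<in>A. \<forall>F\<in>A. U \<ge> F \<longrightarrow> F = U"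
  proof (rule predicate_Zorn)
    show "partial_order_on A (relation_of (\<ge>) A)"
      by (rule partial_order_on_relation_ofI) auto
    fix C assume C: "C \<in> Chains (relation_of (\<ge>) A)"
    show "\<exists>u\<in>A. \<forall>a\<in>C. a \<ge> u"
    proof (cases "C = {}")
      case True
      have "sequentially \<in> A" by (simp add: A_def)
      then show ?thesis using True by blast
    next
      case False
      have CA: "C \<subseteq> A" and ch: "\<And>F G. F \<in> C \<Longrightarrow> G \<in> C \<Longrightarrow> F \<le> G \<or> G \<le> F"
        using C by (auto simp: Chains_def relation_of_def)
      \<comment> \<open>A chain is directed downwards, so its infimum is generated by its members
        and is proper because they are.\<close>
      have "eventually P (Inf C) \<longleftrightarrow> (\<exists>F\<in>C. eventually P F)" for P
      proof (rule eventually_Inf_base)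
        fix F G assume "F \<in> C" "G \<in> C"
        then show "\<exists>x\<in>C. x \<le> inf F G" using ch by (metis inf.absorb1 inf.absorb2 order_refl)
      qed fact
      then have "Inf C \<noteq> bot"
        using CA by (auto simp: A_def trivial_limit_def)
      moreover have "Inf C \<le> sequentially" using False CA by (auto simp: A_def intro: Inf_lower2)
      ultimately have "Inf C \<in> A" by (simp add: A_def)
      then show ?thesis using Inf_lower by blast
    qed
  qed
  then obtain U where U: "U \<in> A" "\<And>F. F \<in> A \<Longrightarrow> F \<le> U \<Longrightarrow> F = U" by blast
  have "eventually P U \<or> eventually (\<lambda>n. \<not> P n) U" for P
  proof (rule disjCI)
    assume neg: "\<not> eventually (\<lambda>n. \<not> P n) U"
    \<comment> \<open>When the complement of \<open>P\<close> is not in \<open>U\<close>, adjoining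
      \<open>P\<close> keeps the filter proper, and minimality forces \<open>P\<close> into
      \<open>U\<close>.\<close>
    define F where "F = inf U (principal {n. P n})"
    have "F \<noteq> bot" using neg by (simp add: F_def trivial_limit_def eventually_inf_principal)
    then have "F \<in> A" using U(1) by (auto simp: F_def A_def intro: le_infI1)
    then have "F = U" using U(2) by (simp add: F_def)
    moreover have "eventually P F" by (simp add: F_def eventually_inf_principal)
    ultimately show "eventually P U" by simp
  qed
  then show ?thesis using U(1) by (auto simp: ultrafilter_def A_def)
qed

lemma ultrafilter_not:
  assumes "ultrafilter U"
  shows "eventually (\<lambda>n. \<not> P n) U \<longleftrightarrow> \<not> eventually P U"
proof -
  have "\<not> (eventually (\<lambda>n. \<not> P n) U \<and> eventually P U)"
  proof
    assume "eventually (\<lambda>n. \<not> P n) U \<and> eventually P U"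
    then have "eventually (\<lambda>n. False) U" by (auto elim: eventually_elim2)
    then show False using assms by (simp add: ultrafilter_def trivial_limit_def)
  qed
  then show ?thesis using assms by (auto simp: ultrafilter_def)
qed

text \<open>Equality in structures is equality of HOL, so a class of sequences modulo
  \<open>U\<close> has to be a single object. Choosing a canonical member of each class keeps the
  elements of the ultrapower in the type of sequences.\<close>

definition rep :: "nat filter \<Rightarrow> (nat \<Rightarrow> 'a) \<Rightarrow> nat \<Rightarrow> 'a" where
  "rep U f = (SOME g. eventually (\<lambda>n. f n = g n) U)"

lemma eventually_rep: "eventually (\<lambda>n. f n = rep U f n) U"
  unfolding rep_def by (rule someI[of _ f]) simp

lemma rep_eq:
  assumes "eventually (\<lambda>n. f n = g n) U"
  shows "rep U f = rep U g"
proof -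
  have "eventually (\<lambda>n. f n = h n) U \<longleftrightarrow> eventually (\<lambda>n. g n = h n) U" for h
    by (rule iffI; (erule eventually_elim2[OF assms]; simp))
  then show ?thesis by (simp add: rep_def)
qed

definition ultrapower :: "nat filter \<Rightarrow> ('r, 'a) struct \<Rightarrow> ('r, nat \<Rightarrow> 'a) struct" where
  "ultrapower U M =
     \<lparr>univ = rep U ` {f. range f \<subseteq> univ M},
      interp = (\<lambda>R. {xs \<in> lists (rep U ` {f. range f \<subseteq> univ M}).
                      eventually (\<lambda>n. map (\<lambda>f. f n) xs \<in> interp M R) U})\<rparr>"

lemma ultrapower_ext:
  assumes "x \<in> univ (ultrapower U M)" "y \<in> univ (ultrapower U M)" "eventually (\<lambda>n. x n = y n) U"
  shows "x = y"
proof -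
  obtain f g where fg: "x = rep U f" "y = rep U g" using assms by (auto simp: ultrapower_def)
  have "eventually (\<lambda>n. f n = g n) U"
    using eventually_rep[of f U] eventually_rep[of g U] assms(3) unfolding fg
    by eventually_elim simp
  then show ?thesis unfolding fg by (rule rep_eq)
qed

text \<open>The choice in \<open>rep\<close> disregards \<open>M\<close>, so a representative may
  leave the universe on a set of indices that is negligible for \<open>U\<close>; more than
  membership at almost all indices cannot be expected.\<close>

lemma ultrapower_eventually_in:
  assumes "x \<in> univ (ultrapower U M)"
  shows "eventually (\<lambda>n. x n \<in> univ M) U"
proof -
  obtain f where f: "x = rep U f" "range f \<subseteq> univ M" using assms by (auto simp: ultrapower_def)
  show ?thesis using eventually_rep[of f U]
  proof eventually_elim
    case (elim n)
    have "f n \<in> univ M" using f(2) by blast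
    then show ?case using elim f(1) by simp
  qed
qed

lemma is_struct_ultrapower:
  assumes "is_struct \<Sigma> M" "ultrafilter U"
  shows "is_struct \<Sigma> (ultrapower U M)"
proof -
  have "\<Sigma> R = Some (length xs) \<and> set xs \<subseteq> univ (ultrapower U M)"
    if xs: "xs \<in> interp (ultrapower U M) R" for R xs
  proof -
    have "eventually (\<lambda>n. map (\<lambda>f. f n) xs \<in> interp M R) U" using xs by (simp add: ultrapower_def)
    then have "\<exists>n. map (\<lambda>f. f n) xs \<in> interp M R"
      using assms(2) eventually_happens unfolding ultrafilter_def by blast
    then show ?thesis using assms(1) xs by (auto simp: is_struct_def ultrapower_def)
  qed
  moreover obtain d where "d \<in> univ M" using assms(1) by (auto simp: is_struct_def)
  then have "rep U (\<lambda>_. d) \<in> univ (ultrapower U M)" by (auto simp: ultrapower_def)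
  ultimately show ?thesis unfolding is_struct_def by blast
qed

lemma Los:
  assumes U: "ultrafilter U" and "univ M \<noteq> {}"
  shows "range s \<subseteq> univ (ultrapower U M) \<Longrightarrow>
    sat (ultrapower U M) s \<phi> \<longleftrightarrow> eventually (\<lambda>n. sat M (\<lambda>i. s i n) \<phi>) U"
proof (induction \<phi> arbitrary: s)
  case (Equ i j)
  then show ?case by (auto intro!: ultrapower_ext)
next
  case (Rel R "is")
  then have "map s is \<in> lists (univ (ultrapower U M))" by (auto simp: image_subset_iff)
  then show ?case by (simp add: ultrapower_def comp_def)
next
  case (Neg \<phi>)
  then show ?case by (simp add: ultrafilter_not[OF U])
next
  case (Conj \<phi> \<psi>)
  then show ?case by (simp add: eventually_conj_iff)
next
  case (Exists i \<phi>)
  have eq: "(\<lambda>j. (s(i := a)) j n) = (\<lambda>j. s j n)(i := a n)" for a n by auto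
  have IH: "sat (ultrapower U M) (s(i := a)) \<phi> \<longleftrightarrow>
      eventually (\<lambda>n. sat M ((\<lambda>j. s j n)(i := a n)) \<phi>) U"
    if a: "a \<in> univ (ultrapower U M)" for a
  proof -
    have "range (s(i := a)) \<subseteq> univ (ultrapower U M)" using Exists.prems a by auto
    then show ?thesis using Exists.IH[of "s(i := a)"] unfolding eq by blast
  qed
  show ?case
  proof
    assume "sat (ultrapower U M) s (Exists i \<phi>)"
    then obtain a where a: "a \<in> univ (ultrapower U M)"
      "eventually (\<lambda>n. sat M ((\<lambda>j. s j n)(i := a n)) \<phi>) U" using IH by auto
    show "eventually (\<lambda>n. sat M (\<lambda>j. s j n) (Exists i \<phi>)) U"
      using a(2) ultrapower_eventually_in[OF a(1)] by eventually_elim auto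
  next
    assume ev: "eventually (\<lambda>n. sat M (\<lambda>j. s j n) (Exists i \<phi>)) U"
    \<comment> \<open>Witnesses are chosen index by index, with an arbitrary element of
      \<open>M\<close> where there is none; the representative of this sequence is the witness in
      the ultrapower.\<close>
    have "\<exists>f. \<forall>n. f n \<in> univ M \<and> (sat M (\<lambda>j. s j n) (Exists i \<phi>) \<longrightarrow> sat M ((\<lambda>j. s j n)(i := f n)) \<phi>)"
    proof (rule choice, rule allI)
      fix n
      show "\<exists>y. y \<in> univ M \<and> (sat M (\<lambda>j. s j n) (Exists i \<phi>) \<longrightarrow> sat M ((\<lambda>j. s j n)(i := y)) \<phi>)"
        using assms(2) by (cases "sat M (\<lambda>j. s j n) (Exists i \<phi>)") (auto simp del: fun_upd_apply)
    qed
    then obtain f where f: "\<And>n. f n \<in> univ M"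
      "\<And>n. sat M (\<lambda>j. s j n) (Exists i \<phi>) \<Longrightarrow> sat M ((\<lambda>j. s j n)(i := f n)) \<phi>" by blast
    have r: "rep U f \<in> univ (ultrapower U M)" using f(1) by (auto simp: ultrapower_def)
    have "eventually (\<lambda>n. sat M ((\<lambda>j. s j n)(i := rep U f n)) \<phi>) U"
      using ev eventually_rep[of f U] by eventually_elim (use f(2) in metis)
    then show "sat (ultrapower U M) s (Exists i \<phi>)" using IH[OF r] r by auto
  qed
qed

lemma Los_tuple:
  assumes U: "ultrafilter U" and ne: "univ M \<noteq> {}" and xs: "set xs \<subseteq> univ (ultrapower U M)"
    and \<phi>: "fv \<phi> \<subseteq> {..<length xs}"
  shows "sat (ultrapower U M) ((!) xs) \<phi> \<longleftrightarrow> eventually (\<lambda>n. sat M (\<lambda>i. (xs ! i) n) \<phi>) U"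
proof -
  obtain d where "d \<in> univ M" using ne by blast
  then have d: "rep U (\<lambda>_. d) \<in> univ (ultrapower U M)" by (auto simp: ultrapower_def)
  define s where "s i = (if i < length xs then xs ! i else rep U (\<lambda>_. d))" for i
  have s: "i \<in> fv \<phi> \<Longrightarrow> s i = xs ! i" for i using \<phi> by (auto simp: s_def)
  have "range s \<subseteq> univ (ultrapower U M)" using xs d by (auto simp: s_def)
  then have "sat (ultrapower U M) s \<phi> \<longleftrightarrow> eventually (\<lambda>n. sat M (\<lambda>i. s i n) \<phi>) U"
    by (rule Los[OF U ne])
  moreover have "sat (ultrapower U M) s \<phi> \<longleftrightarrow> sat (ultrapower U M) ((!) xs) \<phi>"
    using s by (rule sat_cong)
  moreover have "sat M (\<lambda>i. s i n) \<phi> \<longleftrightarrow> sat M (\<lambda>i. (xs ! i) n) \<phi>" for n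
    by (rule sat_cong) (simp add: s)
  ultimately show ?thesis by simp
qed

text \<open>This plays the role of compactness. In the ultrapower, the class of \<open>c\<close>
  together with the constant sequences of \<open>a\<close> satisfies everything that holds of
  \<open>c n\<close> for all large \<open>n\<close>; a countable elementary submodel through these
  finitely many elements is then moved to \<open>nat\<close>.\<close>

lemma realize_eventual_type:
  fixes M :: "'r cstruct"
  assumes cnt: "countable (dom \<Sigma>)" and M: "model \<Sigma> T M" "T \<subseteq> sentences \<Sigma>"
    and a: "a \<in> lists (univ M)" and c: "range c \<subseteq> univ M"
  shows "\<exists>(N :: 'r cstruct) b d. model \<Sigma> T N \<and> b @ [d] \<in> lists (univ N) \<and> length b = length a \<and>
    (\<forall>\<phi>\<in>formulas \<Sigma> (Suc (length a)).
       eventually (\<lambda>n. sat M ((!) (a @ [c n])) \<phi>) sequentially \<longrightarrow> sat N ((!) (b @ [d])) \<phi>)"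
proof -
  obtain U where U: "ultrafilter U" using ex_ultrafilter by blast
  have st: "is_struct \<Sigma> M" and ne: "univ M \<noteq> {}" using M by (auto simp: model_def is_struct_def)
  let ?K = "ultrapower U M"
  have stK: "is_struct \<Sigma> ?K" using st U by (rule is_struct_ultrapower)
  have neK: "univ ?K \<noteq> {}" using stK by (simp add: is_struct_def)
  have mK: "model \<Sigma> T ?K"
  proof -
    have "true_in ?K \<phi>" if "\<phi> \<in> T" for \<phi>
    proof -
      have s: "\<phi> \<in> sentences \<Sigma>" using that M by blast
      then have "fv \<phi> \<subseteq> {..<length []}" by (auto simp: sentences_def formulas_def)
      then have "sat ?K ((!) []) \<phi> \<longleftrightarrow> eventually (\<lambda>n. sat M (\<lambda>i. ([] ! i) n) \<phi>) U"
        by (intro Los_tuple[OF U ne]) auto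
      then show ?thesis using M(1) that by (simp add: sat_sentence[OF s] model_def)
    qed
    then show ?thesis using stK by (simp add: model_def)
  qed
  define xs where "xs = map (\<lambda>x. rep U (\<lambda>_. x)) a @ [rep U c]"
  have xs: "set xs \<subseteq> univ ?K" using a c by (auto simp: xs_def ultrapower_def)
  obtain N :: "'r cstruct" and f where N: "is_struct \<Sigma> N" "elementary_embedding \<Sigma> f N ?K"
    "set xs \<subseteq> f ` univ N"
    using Loewenheim_Skolem[OF cnt stK xs] countable_finite[OF finite_set] by blast
  have "\<forall>i<length xs. \<exists>y. y \<in> univ N \<and> f y = xs ! i"
    using N(3) by (metis (no_types, lifting) imageE nth_mem subsetD)
  then obtain g where g: "\<And>i. i < length xs \<Longrightarrow> g i \<in> univ N \<and> f (g i) = xs ! i" by metis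
  define b where "b = map g [0..<length a]"
  define d where "d = g (length a)"
  have bd: "b @ [d] = map g [0..<length xs]" by (simp add: b_def d_def xs_def)
  have in_N: "b @ [d] \<in> lists (univ N)" unfolding bd using g by auto
  have "sat N ((!) (b @ [d])) \<phi>"
    if \<phi>: "\<phi> \<in> formulas \<Sigma> (Suc (length a))"
      and ev: "eventually (\<lambda>n. sat M ((!) (a @ [c n])) \<phi>) sequentially" for \<phi>
  proof -
    have fv: "fv \<phi> \<subseteq> {..<length xs}" and l: "in_lang \<Sigma> \<phi>"
      using \<phi> by (auto simp: formulas_def xs_def)
    have "eventually (\<lambda>n. (a @ [c n]) ! i = (xs ! i) n) U" if "i < length xs" for i
    proof (cases "i < length a")
      case True
      then show ?thesis using eventually_rep[of "\<lambda>_. a ! i" U] by (simp add: xs_def nth_append)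
    next
      case False
      then have "i = length a" using that by (simp add: xs_def)
      then show ?thesis using eventually_rep[of c U] by (simp add: xs_def nth_append)
    qed
    then have "eventually (\<lambda>n. \<forall>i\<in>fv \<phi>. (a @ [c n]) ! i = (xs ! i) n) U"
      by (intro eventually_ball_finite finite_fv) (use fv in auto)
    moreover have "eventually (\<lambda>n. sat M ((!) (a @ [c n])) \<phi>) U"
      using ev U by (auto simp: ultrafilter_def intro: filter_leD)
    ultimately have "eventually (\<lambda>n. sat M (\<lambda>i. (xs ! i) n) \<phi>) U"
    proof eventually_elim
      case (elim n)
      then show ?case by (subst sat_cong[where t = "(!) (a @ [c n])"]) auto
    qed
    then have "sat ?K ((!) xs) \<phi>" using Los_tuple[OF U ne xs fv] by blast
    moreover have "sat N ((!) (b @ [d])) \<phi> \<longleftrightarrow> sat ?K (f \<circ> (!) (b @ [d])) \<phi>"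
      using g fv l N(1) unfolding bd
      by (intro emb_sat[OF N(2)]) (auto simp: is_struct_def)
    moreover have "sat ?K (f \<circ> (!) (b @ [d])) \<phi> \<longleftrightarrow> sat ?K ((!) xs) \<phi>"
      by (rule sat_cong) (use fv g in \<open>auto simp: bd\<close>)
    ultimately show ?thesis by blast
  qed
  moreover have "model \<Sigma> T N" using emb_model[OF N(2) M(2) N(1) stK] mK by blast
  moreover have "length b = length a" by (simp add: b_def)
  ultimately show ?thesis using in_N by blast
qed

section \<open>Isolated types and chains of prime submodels\<close>

section \<open>Definable sets and isolated elements\<close>

definition defset :: "('r, 'a) struct \<Rightarrow> 'a list \<Rightarrow> 'r fm \<Rightarrow> 'a set" where
  "defset M a \<phi> = {c \<in> univ M. sat M ((!) (a @ [c])) \<phi>}"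

definition Def :: "'r lang \<Rightarrow> ('r, 'a) struct \<Rightarrow> 'a set \<Rightarrow> 'a set set" where
  "Def \<Sigma> M A = {defset M a \<phi> |a \<phi>. set a \<subseteq> A \<and> \<phi> \<in> formulas \<Sigma> (Suc (length a))}"

text \<open>Atoms of the Boolean algebra of \<open>A\<close>-definable sets, that is, the solution
  sets in \<open>M\<close> of formulas isolating a type of one element over \<open>A\<close>. So
  \<open>isolated\<close> says that the type of \<open>c\<close> over \<open>A\<close> is isolated,
  without forming types over parameters.\<close>

definition atom :: "'r lang \<Rightarrow> ('r, 'a) struct \<Rightarrow> 'a set \<Rightarrow> 'a set \<Rightarrow> bool" where
  "atom \<Sigma> M A X \<longleftrightarrow> X \<in> Def \<Sigma> M A \<and> X \<noteq> {} \<and> (\<forall>Y\<in>Def \<Sigma> M A. X \<subseteq> Y \<or> X \<inter> Y = {})"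

definition isolated :: "'r lang \<Rightarrow> ('r, 'a) struct \<Rightarrow> 'a set \<Rightarrow> 'a \<Rightarrow> bool" where
  "isolated \<Sigma> M A c \<longleftrightarrow> (\<exists>X. atom \<Sigma> M A X \<and> c \<in> X)"

lemma Def_mono: "A \<subseteq> B \<Longrightarrow> Def \<Sigma> M A \<subseteq> Def \<Sigma> M B"
  unfolding Def_def by blast

lemma Def_subset: "X \<in> Def \<Sigma> M A \<Longrightarrow> X \<subseteq> univ M"
  unfolding Def_def defset_def by auto

lemma sat_append:
  assumes "\<phi> \<in> formulas \<Sigma> (Suc (length a))"
  shows "sat M ((!) (a @ [c])) \<phi> \<longleftrightarrow> sat M (((!) a)(length a := c)) \<phi>"
proof (rule sat_cong)
  fix i assume "i \<in> fv \<phi>"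
  then have "i < Suc (length a)" using assms by (auto simp: formulas_def)
  then show "(a @ [c]) ! i = (((!) a)(length a := c)) i" by (auto simp: nth_append)
qed

text \<open>The values of \<open>s\<close> at the remaining variables are looked up as positions in
  \<open>a\<close>. Renaming along these positions turns the assignment into a parameter tuple and
  moves the variable \<open>i\<close> to the last place.\<close>

lemma defset_assignment:
  assumes \<phi>: "in_lang \<Sigma> \<phi>" and s: "s ` (fv \<phi> - {i}) \<subseteq> set a"
  shows "\<exists>\<psi>\<in>formulas \<Sigma> (Suc (length a)). {c \<in> univ M. sat M (s(i := c)) \<phi>} = defset M a \<psi>"
proof -
  have "\<forall>j\<in>fv \<phi> - {i}. \<exists>k<length a. a ! k = s j"
    using s by (metis image_subset_iff in_set_conv_nth)
  then obtain g where g: "\<And>j. j \<in> fv \<phi> - {i} \<Longrightarrow> g j < length a \<and> a ! g j = s j" by metis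
  define h where "h j = (if j = i then length a else g j)" for j
  have "fv (ren \<phi> h) \<subseteq> h ` fv \<phi>" by (rule fv_ren)
  also have "\<dots> \<subseteq> {..<Suc (length a)}"
    using g by (auto simp: h_def image_subset_iff less_SucI)
  finally have "ren \<phi> h \<in> formulas \<Sigma> (Suc (length a))" using \<phi> by (simp add: formulas_def)
  moreover have "sat M (s(i := c)) \<phi> \<longleftrightarrow> sat M ((!) (a @ [c])) (ren \<phi> h)" for c
    unfolding sat_ren by (rule sat_cong) (use g in \<open>auto simp: h_def nth_append\<close>)
  ultimately show ?thesis unfolding defset_def by blast
qed

lemma Def_assignment:
  assumes "in_lang \<Sigma> \<phi>" "s ` (fv \<phi> - {i}) \<subseteq> A"
  shows "{c \<in> univ M. sat M (s(i := c)) \<phi>} \<in> Def \<Sigma> M A"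
proof -
  obtain a where a: "set a = s ` (fv \<phi> - {i})"
    using finite_list[of "s ` (fv \<phi> - {i})"] finite_fv by blast
  then obtain \<psi> where "\<psi> \<in> formulas \<Sigma> (Suc (length a))"
    "{c \<in> univ M. sat M (s(i := c)) \<phi>} = defset M a \<psi>"
    using defset_assignment[OF assms(1), of s i a M] by auto
  then show ?thesis using a assms(2) unfolding Def_def by blast
qed

text \<open>Over a finite set one enumeration serves all formulas, since the entries of any other
  parameter tuple can be traced back to positions in \<open>a\<close>. Boolean operations on
  definable sets then become connectives on formulas.\<close>

lemma Def_tuple:
  "Def \<Sigma> M (set a) = defset M a ` formulas \<Sigma> (Suc (length a))"
proof
  show "Def \<Sigma> M (set a) \<subseteq> defset M a ` formulas \<Sigma> (Suc (length a))"
  proof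
    fix X assume "X \<in> Def \<Sigma> M (set a)"
    then obtain b \<phi> where b: "X = defset M b \<phi>" "set b \<subseteq> set a" "\<phi> \<in> formulas \<Sigma> (Suc (length b))"
      by (auto simp: Def_def)
    have "((!) b) ` (fv \<phi> - {length b}) \<subseteq> set a"
    proof
      fix x assume "x \<in> ((!) b) ` (fv \<phi> - {length b})"
      then obtain j where j: "j \<in> fv \<phi>" "j \<noteq> length b" "x = b ! j" by blast
      then have "j < length b" using b(3) by (force simp: formulas_def)
      then show "x \<in> set a" using j b(2) nth_mem by blast
    qed
    moreover have "X = {c \<in> univ M. sat M (((!) b)(length b := c)) \<phi>}"
      unfolding b(1) defset_def sat_append[OF b(3)] ..
    moreover have "in_lang \<Sigma> \<phi>" using b(3) by (simp add: formulas_def)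
    ultimately show "X \<in> defset M a ` formulas \<Sigma> (Suc (length a))"
      using defset_assignment[of \<Sigma> \<phi> "(!) b" "length b" a M] by auto
  qed
qed (auto simp: Def_def)

lemma Def_Int:
  assumes "X \<in> Def \<Sigma> M (set a)" "Y \<in> Def \<Sigma> M (set a)"
  shows "X \<inter> Y \<in> Def \<Sigma> M (set a)"
proof -
  obtain \<phi> \<psi> where f: "\<phi> \<in> formulas \<Sigma> (Suc (length a))" "\<psi> \<in> formulas \<Sigma> (Suc (length a))"
    and "X = defset M a \<phi>" "Y = defset M a \<psi>"
    using assms by (auto simp: Def_tuple)
  then have "X \<inter> Y = defset M a (Conj \<phi> \<psi>)" by (auto simp: defset_def)
  moreover have "Conj \<phi> \<psi> \<in> formulas \<Sigma> (Suc (length a))" using f by (simp add: formulas_def)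
  ultimately show ?thesis by (auto simp: Def_tuple)
qed

lemma Def_Diff:
  assumes "X \<in> Def \<Sigma> M (set a)" "Y \<in> Def \<Sigma> M (set a)"
  shows "X - Y \<in> Def \<Sigma> M (set a)"
proof -
  obtain \<phi> \<psi> where f: "\<phi> \<in> formulas \<Sigma> (Suc (length a))" "\<psi> \<in> formulas \<Sigma> (Suc (length a))"
    and "X = defset M a \<phi>" "Y = defset M a \<psi>"
    using assms by (auto simp: Def_tuple)
  then have "X - Y = defset M a (Conj \<phi> (Neg \<psi>))" by (auto simp: defset_def)
  moreover have "Conj \<phi> (Neg \<psi>) \<in> formulas \<Sigma> (Suc (length a))" using f by (simp add: formulas_def)
  ultimately show ?thesis by (auto simp: Def_tuple)
qed

lemma univ_in_Def: "univ M \<in> Def \<Sigma> M A"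
  using Def_assignment[of \<Sigma> "Equ 0 0" _ 0 A M] by simp

lemma singleton_in_Def:
  assumes "x \<in> A" "x \<in> univ M"
  shows "{x} \<in> Def \<Sigma> M A"
proof -
  have "{c \<in> univ M. sat M ((\<lambda>_. x)(0 := c)) (Equ 0 1)} \<in> Def \<Sigma> M A"
    using assms by (intro Def_assignment) auto
  moreover have "{c \<in> univ M. sat M ((\<lambda>_. x)(0 := c)) (Equ 0 1)} = {x}" using assms by auto
  ultimately show ?thesis by simp
qed

text \<open>The singleton of a parameter is definable and cannot be divided further. This lets
  enumerations with repetitions count as constructions.\<close>

lemma isolated_member: "x \<in> A \<Longrightarrow> x \<in> univ M \<Longrightarrow> isolated \<Sigma> M A x"
  unfolding isolated_def atom_def using singleton_in_Def by fastforce

lemma countable_Def: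
  fixes M :: "'r cstruct"
  assumes "countable (dom \<Sigma>)"
  shows "countable (Def \<Sigma> M A)"
proof -
  have "Def \<Sigma> M A \<subseteq> (\<lambda>(a, \<phi>). defset M a \<phi>) ` (UNIV \<times> {\<phi>. in_lang \<Sigma> \<phi>})"
    unfolding Def_def formulas_def by force
  then show ?thesis
    by (rule countable_subset)
      (intro countable_image countable_SIGMA countable_in_lang assms, simp)
qed

text \<open>This is \<open>S \<Sigma> T\<close> presented through realizations, so its countability
  is smallness of the theory.\<close>

definition realized_types :: "'r lang \<Rightarrow> 'r fm set \<Rightarrow> 'r fm set set" where
  "realized_types \<Sigma> T = {tp \<Sigma> M as |(M :: 'r cstruct) as. model \<Sigma> T M \<and> as \<in> lists (univ M)}"

lemma iso_realized_types:
  assumes "iso M N" "is_struct \<Sigma> M"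
  shows "tp \<Sigma> M ` lists (univ M) \<subseteq> tp \<Sigma> N ` lists (univ N)"
proof -
  obtain f where f: "iso_via f M N" using assms by (auto simp: iso_iff)
  then have emb: "elementary_embedding \<Sigma> f M N" by (rule iso_via_emb)
  have "tp \<Sigma> M as \<in> tp \<Sigma> N ` lists (univ N)" if "as \<in> lists (univ M)" for as
  proof -
    have "tp \<Sigma> N (map f as) = tp \<Sigma> M as"
      using assms(2) that by (intro emb_tp[OF emb]) (auto simp: is_struct_def)
    moreover have "map f as \<in> lists (univ N)" using that emb_range[OF emb] by auto
    ultimately show ?thesis by (metis imageI)
  qed
  then show ?thesis by blast
qed

text \<open>An isomorphism type fixes the set of types that its members realize, and a structure on
  \<open>nat\<close> has only countably many finite tuples.\<close>

lemma countable_realized_types: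
  fixes T :: "'r fm set"
  assumes "num_models \<Sigma> T < \<infinity>"
  shows "countable (realized_types \<Sigma> T)"
proof -
  let ?I = "{iso_type \<Sigma> M |M :: 'r cstruct. model \<Sigma> T M}"
  define t where "t X = tp \<Sigma> (SOME M. M \<in> X) ` lists (univ (SOME M. M \<in> X))" for X :: "'r cstruct set"
  have "finite ?I" using assms by (auto simp: num_models_def ecard_def split: if_splits)
  moreover have "countable (t X)" for X unfolding t_def by simp
  ultimately have "countable (\<Union>X\<in>?I. t X)" by (simp add: countable_finite)
  moreover have "realized_types \<Sigma> T \<subseteq> (\<Union>X\<in>?I. t X)"
  proof
    fix p assume "p \<in> realized_types \<Sigma> T"
    then obtain M :: "'r cstruct" and as
      where M: "model \<Sigma> T M" "as \<in> lists (univ M)" "p = tp \<Sigma> M as"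
      by (auto simp: realized_types_def)
    have st: "is_struct \<Sigma> M" using M by (simp add: model_def)
    then have "M \<in> iso_type \<Sigma> M" by (simp add: in_iso_type)
    then have "(SOME N. N \<in> iso_type \<Sigma> M) \<in> iso_type \<Sigma> M" by (rule someI)
    then have "iso M (SOME N. N \<in> iso_type \<Sigma> M)" by (simp add: iso_type_def)
    then have "p \<in> t (iso_type \<Sigma> M)"
      using iso_realized_types[OF _ st] M unfolding t_def by blast
    then show "p \<in> (\<Union>X\<in>?I. t X)" using M(1) by blast
  qed
  ultimately show ?thesis by (rule countable_subset[rotated])
qed

text \<open>Cantor's diagonal: an enumeration misses the sequence that differs from its
  \<open>n\<close>-th member at \<open>n\<close>.\<close>

lemma uncountable_binary_sequences: "\<not> countable (UNIV :: (nat \<Rightarrow> bool) set)"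
proof
  assume "countable (UNIV :: (nat \<Rightarrow> bool) set)"
  then have "range (from_nat_into (UNIV :: (nat \<Rightarrow> bool) set)) = UNIV"
    by (intro range_from_nat_into) auto
  then obtain m where "from_nat_into (UNIV :: (nat \<Rightarrow> bool) set) m =
      (\<lambda>n. \<not> from_nat_into (UNIV :: (nat \<Rightarrow> bool) set) n n)"
    by (metis UNIV_I imageE)
  then have "from_nat_into (UNIV :: (nat \<Rightarrow> bool) set) m m =
      (\<not> from_nat_into (UNIV :: (nat \<Rightarrow> bool) set) m m)" by (rule fun_cong)
  then show False by simp
qed

text \<open>Otherwise a binary tree of definable sets grows below \<open>X\<close>, and its branches are realized as
  pairwise distinct types.\<close>

lemma atoms_dense:
  fixes M :: "'r cstruct"
  assumes cnt: "countable (dom \<Sigma>)" and T: "T \<subseteq> sentences \<Sigma>"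
    and small: "countable (realized_types \<Sigma> T)"
    and M: "model \<Sigma> T M" and a: "set a \<subseteq> univ M"
    and X: "X \<in> Def \<Sigma> M (set a)" "X \<noteq> {}"
  shows "\<exists>Y\<subseteq>X. atom \<Sigma> M (set a) Y"
proof (rule ccontr)
  assume no: "\<not> (\<exists>Y\<subseteq>X. atom \<Sigma> M (set a) Y)"
  let ?D = "Def \<Sigma> M (set a)"
  have "\<exists>Z. Z \<in> ?D \<and> Y \<inter> Z \<noteq> {} \<and> Y - Z \<noteq> {}" if Y: "Y \<in> ?D" "Y \<noteq> {}" "Y \<subseteq> X" for Y
  proof -
    have "\<not> atom \<Sigma> M (set a) Y" using no Y(3) by blast
    then show ?thesis using Y(1,2) by (auto simp: atom_def)
  qed
  then obtain Z where Z: "\<And>Y. Y \<in> ?D \<Longrightarrow> Y \<noteq> {} \<Longrightarrow> Y \<subseteq> X \<Longrightarrow>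
      Z Y \<in> ?D \<and> Y \<inter> Z Y \<noteq> {} \<and> Y - Z Y \<noteq> {}" by metis
  \<comment> \<open>\<open>G \<beta> k\<close> is the node at level \<open>k\<close> on the branch
    \<open>\<beta>\<close>; each bit selects one of the two nonempty parts into which
    \<open>Z\<close> divides the current node.\<close>
  define G where "G \<beta> = rec_nat X (\<lambda>k Y. if \<beta> k then Y \<inter> Z Y else Y - Z Y)" for \<beta> :: "nat \<Rightarrow> bool"
  have G_0: "G \<beta> 0 = X" and G_Suc: "G \<beta> (Suc k) = (if \<beta> k then G \<beta> k \<inter> Z (G \<beta> k) else G \<beta> k - Z (G \<beta> k))"
    for \<beta> k by (auto simp: G_def)
  have G: "G \<beta> k \<in> ?D \<and> G \<beta> k \<noteq> {} \<and> G \<beta> k \<subseteq> X" for \<beta> k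
  proof (induction k)
    case 0 then show ?case using X by (simp add: G_0)
  next
    case (Suc k)
    then show ?case using Z[of "G \<beta> k"] Def_Int[of "G \<beta> k" \<Sigma> M a] Def_Diff[of "G \<beta> k" \<Sigma> M a]
      unfolding G_Suc by auto
  qed
  have anti: "G \<beta> n \<subseteq> G \<beta> k" if "k \<le> n" for \<beta> k n
    using that by (rule lift_Suc_antimono_le[rotated]) (auto simp: G_Suc)
  \<comment> \<open>A sequence running down the branch has a limit in the ultrapower that lies in
    every node. The parameters \<open>a\<close> become part of the realized tuple, so the branch
    yields a type over the empty set, to which smallness applies.\<close>
  have "\<exists>p. p \<in> realized_types \<Sigma> T \<and> (\<forall>\<phi>\<in>formulas \<Sigma> (Suc (length a)).
      (\<forall>k. G \<beta> k \<subseteq> defset M a \<phi> \<longrightarrow> \<phi> \<in> p) \<and> (\<forall>k. G \<beta> k \<inter> defset M a \<phi> = {} \<longrightarrow> \<phi> \<notin> p))" for \<beta>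
  proof -
    have "\<forall>n. \<exists>c. c \<in> G \<beta> n" using G by blast
    then obtain c where c: "\<And>n. c n \<in> G \<beta> n" by metis
    have cM: "range c \<subseteq> univ M" using c G Def_subset by blast
    have al: "a \<in> lists (univ M)" using a by auto
    obtain N :: "'r cstruct" and b d where N: "model \<Sigma> T N" "b @ [d] \<in> lists (univ N)" "length b = length a"
      "\<And>\<phi>. \<phi> \<in> formulas \<Sigma> (Suc (length a)) \<Longrightarrow>
         eventually (\<lambda>n. sat M ((!) (a @ [c n])) \<phi>) sequentially \<Longrightarrow> sat N ((!) (b @ [d])) \<phi>"
      using realize_eventual_type[OF cnt M T al cM] by blast
    have ev: "eventually (\<lambda>n. c n \<in> G \<beta> k) sequentially" for k
      unfolding eventually_sequentially using c anti by blast
    let ?p = "tp \<Sigma> N (b @ [d])"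
    have pos: "\<phi> \<in> ?p" if \<phi>: "\<phi> \<in> formulas \<Sigma> (Suc (length a))" and k: "G \<beta> k \<subseteq> defset M a \<phi>" for \<phi> k
    proof -
      have "eventually (\<lambda>n. sat M ((!) (a @ [c n])) \<phi>) sequentially"
        using ev[of k] by eventually_elim (use k in \<open>auto simp: defset_def\<close>)
      then show ?thesis using N(3,4) \<phi> by (simp add: tp_def)
    qed
    have "\<phi> \<notin> ?p" if \<phi>: "\<phi> \<in> formulas \<Sigma> (Suc (length a))" and k: "G \<beta> k \<inter> defset M a \<phi> = {}" for \<phi> k
    proof -
      have "G \<beta> k \<subseteq> defset M a (Neg \<phi>)"
      proof -
        have "G \<beta> k \<subseteq> univ M" using G[of \<beta> k] by (blast dest: Def_subset)
        then show ?thesis using k by (auto simp: defset_def)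
      qed
      moreover have "Neg \<phi> \<in> formulas \<Sigma> (Suc (length a))" using \<phi> by (simp add: formulas_def)
      ultimately have "Neg \<phi> \<in> ?p" using pos by blast
      then show ?thesis by (simp add: tp_def)
    qed
    moreover have "?p \<in> realized_types \<Sigma> T" using N unfolding realized_types_def by blast
    ultimately show ?thesis using pos by blast
  qed
  then obtain p where p: "\<And>\<beta>. p \<beta> \<in> realized_types \<Sigma> T"
    "\<And>\<beta> \<phi> k. \<phi> \<in> formulas \<Sigma> (Suc (length a)) \<Longrightarrow> G \<beta> k \<subseteq> defset M a \<phi> \<Longrightarrow> \<phi> \<in> p \<beta>"
    "\<And>\<beta> \<phi> k. \<phi> \<in> formulas \<Sigma> (Suc (length a)) \<Longrightarrow> G \<beta> k \<inter> defset M a \<phi> = {} \<Longrightarrow> \<phi> \<notin> p \<beta>"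
    by metis
  have "inj p"
  proof (rule injI, rule ccontr)
    fix \<beta> \<gamma> assume eq: "p \<beta> = p \<gamma>" and "\<beta> \<noteq> \<gamma>"
    then have "\<exists>k. \<beta> k \<noteq> \<gamma> k" by auto
    \<comment> \<open>The two branches share the node at the first level where their bits differ;
      the formula defining \<open>Z\<close> at this node separates their types.\<close>
    define k where "k = (LEAST k. \<beta> k \<noteq> \<gamma> k)"
    have k: "\<beta> k \<noteq> \<gamma> k" unfolding k_def using \<open>\<exists>k. \<beta> k \<noteq> \<gamma> k\<close> by (rule LeastI_ex)
    have less: "\<beta> j = \<gamma> j" if "j < k" for j using that not_less_Least unfolding k_def by blast
    have "j \<le> k \<Longrightarrow> G \<beta> j = G \<gamma> j" for j
      by (induction j) (auto simp: G_0 G_Suc less)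
    then have same: "G \<beta> k = G \<gamma> k" by simp
    obtain \<phi> where \<phi>: "\<phi> \<in> formulas \<Sigma> (Suc (length a))" "Z (G \<beta> k) = defset M a \<phi>"
      using Z[of "G \<beta> k"] G[of \<beta> k] by (auto simp: Def_tuple)
    have "(\<phi> \<in> p \<delta>) = \<delta> k" if "G \<delta> k = G \<beta> k" for \<delta>
    proof (cases "\<delta> k")
      case True
      then have "G \<delta> (Suc k) \<subseteq> defset M a \<phi>" using that \<phi>(2) by (auto simp: G_Suc)
      then show ?thesis using p(2)[OF \<phi>(1)] True by blast
    next
      case False
      then have "G \<delta> (Suc k) \<inter> defset M a \<phi> = {}" using that \<phi>(2) by (auto simp: G_Suc)
      then show ?thesis using p(3)[OF \<phi>(1)] False by blast
    qed
    then show False using k same eq by metis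
  qed
  moreover have "countable (range p)" using p(1) small by (meson countable_subset image_subsetI)
  ultimately show False using uncountable_binary_sequences countable_image_inj_on by blast
qed

section \<open>Constructible models are prime\<close>

text \<open>The existential closure of the isolating formula belongs to the type of
  \<open>x\<close>, so \<open>N\<close> has a solution over \<open>y\<close>. Any solution serves: a
  formula true of \<open>c\<close> holds on the whole atom, and this inclusion is again recorded in
  the type of \<open>x\<close>.\<close>

lemma extend_isolated:
  assumes tp: "tp \<Sigma> N y = tp \<Sigma> M x" and x: "set x \<subseteq> univ M"
    and c: "isolated \<Sigma> M (set x) c"
  shows "\<exists>d\<in>univ N. tp \<Sigma> N (y @ [d]) = tp \<Sigma> M (x @ [c])"
proof -
  let ?n = "length x"
  have len: "length y = ?n" using tp by (rule tp_length)
  obtain X where X: "atom \<Sigma> M (set x) X" "c \<in> X" using c by (auto simp: isolated_def)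
  then obtain \<psi> where \<psi>: "\<psi> \<in> formulas \<Sigma> (Suc ?n)" "X = defset M x \<psi>"
    by (auto simp: atom_def Def_tuple)
  have ex: "sat N ((!) y) (Exists ?n \<phi>) \<longleftrightarrow> sat M ((!) x) (Exists ?n \<phi>)"
    if "\<phi> \<in> formulas \<Sigma> (Suc ?n)" for \<phi>
  proof -
    have "Exists ?n \<phi> \<in> formulas \<Sigma> ?n"
      using that by (auto simp: formulas_def lessThan_Suc)
    moreover have "Exists ?n \<phi> \<in> tp \<Sigma> N y \<longleftrightarrow> Exists ?n \<phi> \<in> tp \<Sigma> M x" using tp by simp
    ultimately show ?thesis using len by (simp only: tp_def mem_Collect_eq) simp
  qed
  have ex': "(\<exists>d\<in>univ N. sat N ((!) (y @ [d])) \<phi>) \<longleftrightarrow> defset M x \<phi> \<noteq> {}"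
    if "\<phi> \<in> formulas \<Sigma> (Suc ?n)" for \<phi>
    using ex[OF that] that unfolding defset_def
    by (simp add: sat_append[where \<Sigma> = \<Sigma>] len) (auto simp: len)
  obtain d where d: "d \<in> univ N" "sat N ((!) (y @ [d])) \<psi>"
    using ex'[OF \<psi>(1)] X(2) \<psi>(2) by blast
  have cM: "c \<in> univ M" using X(2) \<psi>(2) by (simp add: defset_def)
  have half: "sat N ((!) (y @ [d])) \<phi>"
    if \<phi>: "\<phi> \<in> formulas \<Sigma> (Suc ?n)" and c: "sat M ((!) (x @ [c])) \<phi>" for \<phi>
  proof (rule ccontr)
    assume neg: "\<not> sat N ((!) (y @ [d])) \<phi>"
    have "Conj \<psi> (Neg \<phi>) \<in> formulas \<Sigma> (Suc ?n)" using \<phi> \<psi>(1) by (simp add: formulas_def)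
    then have "defset M x (Conj \<psi> (Neg \<phi>)) \<noteq> {}" using ex' d neg by fastforce
    then have "\<not> X \<subseteq> defset M x \<phi>" unfolding \<psi>(2) by (auto simp: defset_def)
    moreover have "c \<in> defset M x \<phi>" using c cM by (simp add: defset_def)
    moreover have "defset M x \<phi> \<in> Def \<Sigma> M (set x)" using \<phi> by (simp add: Def_tuple)
    ultimately show False using X unfolding atom_def by blast
  qed
  have "tp \<Sigma> N (y @ [d]) = tp \<Sigma> M (x @ [c])"
  proof (rule tp_eqI)
    fix \<phi> assume "\<phi> \<in> formulas \<Sigma> (length (y @ [d]))"
    then have \<phi>: "\<phi> \<in> formulas \<Sigma> (Suc ?n)" by (simp add: len)
    then have "Neg \<phi> \<in> formulas \<Sigma> (Suc ?n)" by (simp add: formulas_def)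
    then show "sat N ((!) (y @ [d])) \<phi> \<longleftrightarrow> sat M ((!) (x @ [c])) \<phi>"
      using half \<phi> by fastforce
  qed (simp add: len)
  then show ?thesis using d(1) by blast
qed

text \<open>The forth half of a back-and-forth argument: images are found one at a time by
  \<open>extend_isolated\<close>, starting from the given tuple \<open>bs\<close>.\<close>

lemma constructible_extension:
  assumes tp: "tp \<Sigma> N bs = tp \<Sigma> M (map u [0..<n])" and bs: "bs \<in> lists (univ N)"
    and u: "range u \<subseteq> univ M" and iso: "\<And>i. n \<le> i \<Longrightarrow> isolated \<Sigma> M (u ` {..<i}) (u i)"
  shows "\<exists>v. range v \<subseteq> univ N \<and> map v [0..<n] = bs \<and>
    (\<forall>k\<ge>n. tp \<Sigma> N (map v [0..<k]) = tp \<Sigma> M (map u [0..<k]))"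
proof -
  have len: "length bs = n" using tp_length[OF tp] by simp
  have "\<exists>L. \<forall>t. (L t \<in> lists (univ N) \<and> tp \<Sigma> N (L t) = tp \<Sigma> M (map u [0..<n + t]) \<and> (t = 0 \<longrightarrow> L t = bs)) \<and>
      (\<exists>d. L (Suc t) = L t @ [d])"
  proof (rule dependent_nat_choice)
    show "\<exists>l. l \<in> lists (univ N) \<and> tp \<Sigma> N l = tp \<Sigma> M (map u [0..<n + 0]) \<and> (0 = (0::nat) \<longrightarrow> l = bs)"
      using tp bs by auto
  next
    fix l t
    assume l: "l \<in> lists (univ N) \<and> tp \<Sigma> N l = tp \<Sigma> M (map u [0..<n + t]) \<and> (t = 0 \<longrightarrow> l = bs)"
    have "isolated \<Sigma> M (set (map u [0..<n + t])) (u (n + t))"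
      using iso[of "n + t"] by (simp add: lessThan_atLeast0)
    then obtain d where d: "d \<in> univ N" "tp \<Sigma> N (l @ [d]) = tp \<Sigma> M (map u [0..<n + t] @ [u (n + t)])"
      using extend_isolated[of \<Sigma> N l M "map u [0..<n + t]" "u (n + t)"] l u by auto
    show "\<exists>l'. (l' \<in> lists (univ N) \<and> tp \<Sigma> N l' = tp \<Sigma> M (map u [0..<n + Suc t]) \<and>
        (Suc t = 0 \<longrightarrow> l' = bs)) \<and> (\<exists>d. l' = l @ [d])"
      using d l by (intro exI[of _ "l @ [d]"]) auto
  qed
  then obtain L where L: "\<And>t. L t \<in> lists (univ N)" "\<And>t. tp \<Sigma> N (L t) = tp \<Sigma> M (map u [0..<n + t])"
    "L 0 = bs" "\<And>t. \<exists>d. L (Suc t) = L t @ [d]" by metis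
  have lenL: "length (L t) = n + t" for t using tp_length[OF L(2)[of t]] by simp
  have mono: "L t ! i = L t' ! i" if "t \<le> t'" "i < n + t" for t t' i
    using that
  proof (induction t' rule: dec_induct)
    case (step t')
    then show ?case using L(4)[of t'] lenL[of t'] by (auto simp: nth_append)
  qed simp
  \<comment> \<open>Stage \<open>Suc i\<close> is long enough to have a position \<open>i\<close>,
    whatever \<open>n\<close> is, and later stages do not change that entry.\<close>
  define v where "v i = L (Suc i) ! i" for i
  have Lv: "L t = map v [0..<n + t]" for t
  proof (rule nth_equalityI)
    fix i assume "i < length (L t)"
    then have i: "i < n + t" by (simp add: lenL)
    have "L t ! i = L (Suc i) ! i"
    proof (cases "t \<le> Suc i")
      case True
      then show ?thesis using i by (rule mono)
    next
      case False
      then show ?thesis by (intro mono[symmetric]) auto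
    qed
    then show "L t ! i = map v [0..<n + t] ! i" using i by (simp only: v_def nth_map_upt) simp
  qed (simp add: lenL)
  have "range v \<subseteq> univ N"
  proof
    fix y assume "y \<in> range v"
    then obtain i where "y = L (Suc i) ! i" by (auto simp: v_def)
    then show "y \<in> univ N" using L(1)[of "Suc i"] lenL[of "Suc i"] nth_mem[of i "L (Suc i)"] by auto
  qed
  moreover have "map v [0..<n] = bs" using Lv[of 0] L(3) by simp
  moreover have "tp \<Sigma> N (map v [0..<k]) = tp \<Sigma> M (map u [0..<k])" if "n \<le> k" for k
    using L(2)[of "k - n"] Lv[of "k - n"] that by simp
  ultimately show ?thesis by blast
qed

text \<open>The construction of \<open>B\<close> over its first \<open>n\<close> entries can be
  repeated inside any model that realizes their type. Isolation is measured in \<open>M\<close>;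
  elementarity of the submodel makes the types in it the same.\<close>

lemma constructible_prime:
  fixes M :: "'r cstruct"
  assumes M: "model \<Sigma> T M" and T: "T \<subseteq> sentences \<Sigma>"
    and B: "elementary_embedding \<Sigma> id (sub M B) M" and u: "range u = B"
    and iso: "\<And>i. n \<le> i \<Longrightarrow> isolated \<Sigma> M (u ` {..<i}) (u i)"
  shows "prime_over \<Sigma> T (sub M B) (map u [0..<n])"
proof -
  have BM: "B \<subseteq> univ M" and ne: "B \<noteq> {}" using B u by (auto simp: elementary_embedding_def)
  have st: "is_struct \<Sigma> M" "is_struct \<Sigma> (sub M B)"
    using M ne is_struct_sub by (auto simp: model_def)
  have mod: "model \<Sigma> T (sub M B)" using emb_model[OF B T st(2,1)] M by blast
  have a: "map u [0..<n] \<in> lists (univ (sub M B))" using u by auto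
  have tpM: "tp \<Sigma> (sub M B) (map u [0..<n]) = tp \<Sigma> M (map u [0..<n])"
    using emb_tp[OF B a] ne by simp
  have "\<exists>f. elementary_embedding \<Sigma> f (sub M B) N \<and> map f (map u [0..<n]) = bs"
    if N: "model \<Sigma> T N" "bs \<in> lists (univ N)" "tp \<Sigma> N bs = tp \<Sigma> (sub M B) (map u [0..<n])"
    for N :: "'r cstruct" and bs
  proof -
    obtain v where v: "range v \<subseteq> univ N" "map v [0..<n] = bs"
      "\<And>k. n \<le> k \<Longrightarrow> tp \<Sigma> N (map v [0..<k]) = tp \<Sigma> M (map u [0..<k])"
      using constructible_extension[of \<Sigma> N bs M u n] N(2,3) u BM iso unfolding tpM by blast
    have sat: "sat M (u \<circ> h) \<phi> \<longleftrightarrow> sat N (v \<circ> h) \<phi>" if \<phi>: "in_lang \<Sigma> \<phi>" for \<phi> h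
    proof -
      obtain k where k: "h ` fv \<phi> \<subseteq> {..<k}"
        using finite_nat_bounded finite_fv finite_imageI by metis
      let ?k = "max n k"
      have lt: "i \<in> fv \<phi> \<Longrightarrow> h i < ?k" for i using k by fastforce
      have "sat M (u \<circ> h) \<phi> \<longleftrightarrow> sat M (\<lambda>i. map u [0..<?k] ! h i) \<phi>"
        by (rule sat_cong) (use lt in auto)
      also have "\<dots> \<longleftrightarrow> sat N (\<lambda>i. map v [0..<?k] ! h i) \<phi>"
        by (rule tp_sat[OF v(3)[symmetric] \<phi>]) (use lt in auto)
      also have "\<dots> \<longleftrightarrow> sat N (v \<circ> h) \<phi>"
        by (rule sat_cong) (use lt in auto)
      finally show ?thesis .
    qed
    define pos where "pos x = (SOME i. u i = x)" for x
    have pos: "u (pos x) = x" if "x \<in> B" for x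
      unfolding pos_def using that u by (metis (mono_tags, lifting) imageE someI_ex)
    \<comment> \<open>The enumeration \<open>u\<close> may repeat values. Equality of two entries is
      part of the type, so \<open>v\<close> repeats accordingly and \<open>u i \<mapsto> v i\<close>
      is well defined.\<close>
    have uv: "v i = v j" if "u i = u j" for i j
      using sat[of "Equ 0 1" "\<lambda>k. if k = 0 then i else j"] that by simp
    define f where "f x = v (pos x)" for x
    have fu: "f (u i) = v i" for i unfolding f_def using u by (intro uv pos) auto
    have "sat (sub M B) s \<phi> \<longleftrightarrow> sat N (f \<circ> s) \<phi>" if \<phi>: "in_lang \<Sigma> \<phi>" and s: "range s \<subseteq> B" for \<phi> s
    proof -
      have "sat (sub M B) s \<phi> \<longleftrightarrow> sat M s \<phi>"
        using B \<phi> s by (simp add: elementary_embedding_def)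
      also have "\<dots> \<longleftrightarrow> sat M (u \<circ> (pos \<circ> s)) \<phi>"
        by (rule sat_cong) (use s pos in \<open>auto simp: image_subset_iff\<close>)
      also have "\<dots> \<longleftrightarrow> sat N (v \<circ> (pos \<circ> s)) \<phi>" using \<phi> by (rule sat)
      also have "v \<circ> (pos \<circ> s) = f \<circ> s" by (auto simp: f_def)
      finally show ?thesis .
    qed
    then have "elementary_embedding \<Sigma> f (sub M B) N"
      using v(1) by (auto simp: elementary_embedding_def f_def)
    moreover have "map f (map u [0..<n]) = bs" unfolding v(2)[symmetric] by (simp add: fu)
    ultimately show ?thesis by blast
  qed
  then show ?thesis using mod a by (simp add: prime_over_def)
qed

section \<open>Models as unions of chains of prime models\<close>

text \<open>A set definable over \<open>A n\<close> remains definable over the larger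
  \<open>A (Suc n)\<close>, so an atom over the former contains an atom over the latter. Descending
  in this way below \<open>X\<close> leads to a point in atoms of all levels; finitely many steps
  suffice because the sets are constant from \<open>K\<close> on.\<close>

lemma nested_isolated:
  fixes M :: "'r cstruct" and A :: "nat \<Rightarrow> nat set"
  assumes cnt: "countable (dom \<Sigma>)" and T: "T \<subseteq> sentences \<Sigma>"
    and small: "countable (realized_types \<Sigma> T)" and M: "model \<Sigma> T M"
    and A: "mono A" "\<And>n. finite (A n)" "\<And>n. A n \<subseteq> univ M" "\<And>n. n \<ge> K \<Longrightarrow> A n = A K"
    and X: "X \<in> Def \<Sigma> M (A n0)" "X \<noteq> {}"
  shows "\<exists>c\<in>X. \<forall>n\<ge>n0. isolated \<Sigma> M (A n) c"
proof -
  have dense: "\<exists>Z\<subseteq>Y. atom \<Sigma> M (A n) Z" if "Y \<in> Def \<Sigma> M (A n)" "Y \<noteq> {}" for Y n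
  proof -
    obtain a where "set a = A n" using A(2) finite_list by blast
    then show ?thesis using atoms_dense[OF cnt T small M, of a Y] that A(3) by simp
  qed
  have "\<exists>Y\<subseteq>X. atom \<Sigma> M (A k) Y \<and> (\<forall>n. n0 \<le> n \<and> n \<le> k \<longrightarrow> (\<exists>Z. atom \<Sigma> M (A n) Z \<and> Y \<subseteq> Z))"
    if "n0 \<le> k" for k
    using that
  proof (induction k rule: dec_induct)
    case base
    obtain Y where "Y \<subseteq> X" "atom \<Sigma> M (A n0) Y" using dense[OF X] by blast
    then show ?case using le_antisym by blast
  next
    case (step k)
    then obtain Y where Y: "Y \<subseteq> X" "atom \<Sigma> M (A k) Y"
      "\<And>n. n0 \<le> n \<Longrightarrow> n \<le> k \<Longrightarrow> \<exists>Z. atom \<Sigma> M (A n) Z \<and> Y \<subseteq> Z" by blast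
    have "Y \<in> Def \<Sigma> M (A (Suc k))" "Y \<noteq> {}"
      using Y(2) Def_mono[of "A k" "A (Suc k)" \<Sigma> M] monoD[OF A(1), of k "Suc k"]
      by (auto simp: atom_def)
    then obtain Z where Z: "Z \<subseteq> Y" "atom \<Sigma> M (A (Suc k)) Z" using dense by blast
    have "\<exists>Z'. atom \<Sigma> M (A n) Z' \<and> Z \<subseteq> Z'" if "n0 \<le> n" "n \<le> Suc k" for n
    proof (cases "n = Suc k")
      case False
      then show ?thesis using Y(3)[of n] Z(1) that by fastforce
    qed (use Z in blast)
    then show ?case using Y(1) Z by (intro exI[of _ Z]) blast
  qed
  \<comment> \<open>The starting level \<open>n0\<close> may already lie beyond
    \<open>K\<close>.\<close>
  from this[of "max n0 K"] obtain Y where Y: "Y \<subseteq> X" "atom \<Sigma> M (A (max n0 K)) Y"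
    "\<And>n. n0 \<le> n \<Longrightarrow> n \<le> max n0 K \<Longrightarrow> \<exists>Z. atom \<Sigma> M (A n) Z \<and> Y \<subseteq> Z" by auto
  then obtain c where c: "c \<in> Y" by (auto simp: atom_def)
  have "isolated \<Sigma> M (A n) c" if "n0 \<le> n" for n
  proof (cases "n \<le> max n0 K")
    case True
    then show ?thesis using Y(3)[of n] that c by (auto simp: isolated_def)
  next
    case False
    then have "A n = A (max n0 K)" using A(4)[of n] A(4)[of "max n0 K"] by simp
    then show ?thesis using Y(2) c by (auto simp: isolated_def)
  qed
  then show ?thesis using c Y(1) by blast
qed

text \<open>The first component of the decoded pair names the task; the second is a counter that
  makes every task recur beyond any bound.\<close>

lemma ex_schedule:
  fixes D :: "'a set"
  assumes "countable D" "D \<noteq> {}"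
  shows "\<exists>task :: nat \<Rightarrow> nat \<times> 'a. \<forall>n. \<forall>X\<in>D. \<forall>t. \<exists>k\<ge>t. task k = (n, X)"
proof -
  let ?P = "(UNIV :: nat set) \<times> D"
  have cP: "countable ?P" using assms by simp
  define task where "task k = from_nat_into ?P (fst (prod_decode k))" for k
  have "\<exists>k\<ge>t. task k = (n, X)" if "X \<in> D" for n X t
  proof (intro exI conjI)
    let ?k = "prod_encode (to_nat_on ?P (n, X), t)"
    show "t \<le> ?k" by (rule le_prod_encode_2)
    show "task ?k = (n, X)" unfolding task_def using that cP by simp
  qed
  then show ?thesis by blast
qed

text \<open>All members of the chain are built at once.  Stage \<open>t\<close> adds the element \<open>e t\<close> with a label
  \<open>l t\<close>, meaning that \<open>e t\<close> belongs to the \<open>n\<close>-th member of the chain for all \<open>n \<ge> l t\<close>.  Even stages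
  exhaust \<open>M\<close>, giving the \<open>k\<close>-th element the label \<open>k\<close>; odd stages add Tarski-Vaught witnesses which
  are isolated over the elements found so far of every member of the chain that they enter.\<close>

lemma labelled_construction:
  fixes M :: "'r cstruct"
  assumes cnt: "countable (dom \<Sigma>)" and T: "T \<subseteq> sentences \<Sigma>"
    and small: "countable (realized_types \<Sigma> T)" and M: "model \<Sigma> T M"
    and m: "range (m :: nat \<Rightarrow> nat) = univ M"
  defines "A \<equiv> \<lambda>(e :: nat \<Rightarrow> nat) (l :: nat \<Rightarrow> nat) n t. e ` {j. j < t \<and> l j \<le> n}"
  shows "\<exists>e l. range e \<subseteq> univ M \<and> (\<forall>k. e (2 * k) = m k \<and> l (2 * k) = k) \<and>
    (\<forall>t n. odd t \<longrightarrow> l t \<le> n \<longrightarrow> isolated \<Sigma> M (A e l n t) (e t)) \<and>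
    (\<forall>n t X. X \<in> Def \<Sigma> M (A e l n t) \<longrightarrow> X \<noteq> {} \<longrightarrow> (\<exists>t'. l t' = n \<and> e t' \<in> X))"
proof -
  have ne: "univ M \<noteq> {}" using M by (simp add: model_def is_struct_def)
  let ?D = "Def \<Sigma> M (univ M)"
  have "?D \<noteq> {}" using univ_in_Def by blast
  then obtain task :: "nat \<Rightarrow> nat \<times> nat set" where
    task: "\<And>n X t. X \<in> ?D \<Longrightarrow> \<exists>k\<ge>t. task k = (n, X)"
    using ex_schedule[OF countable_Def[OF cnt]] by metis
  \<comment> \<open>\<open>P f t r\<close> says that \<open>r\<close>, an element with its label, is
    admissible at stage \<open>t\<close>. It depends only on the values of \<open>f\<close> before
    \<open>t\<close>, which is what the well-founded choice requires.\<close>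
  define P where "P f t r \<longleftrightarrow> fst r \<in> univ M \<and>
    (even t \<longrightarrow> r = (m (t div 2), t div 2)) \<and>
    (odd t \<longrightarrow> (\<forall>n\<ge>snd r. isolated \<Sigma> M (A (fst \<circ> f) (snd \<circ> f) n t) (fst r)) \<and>
      (\<forall>n X. task (t div 2) = (n, X) \<longrightarrow> X \<in> Def \<Sigma> M (A (fst \<circ> f) (snd \<circ> f) n t) \<longrightarrow> X \<noteq> {} \<longrightarrow>
         snd r = n \<and> fst r \<in> X))" for f :: "nat \<Rightarrow> nat \<times> nat" and t r
  have "\<exists>f. \<forall>t. P f t (f t)"
  proof (rule dependent_wf_choice[OF wf_less])
    fix f g :: "nat \<Rightarrow> nat \<times> nat" and t r
    assume "\<And>z. (z, t) \<in> {(x, y). x < y} \<Longrightarrow> f z = g z"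
    then have "A (fst \<circ> f) (snd \<circ> f) n t = A (fst \<circ> g) (snd \<circ> g) n t" for n
      unfolding A_def by (intro image_cong) auto
    then show "P f t r = P g t r" by (simp add: P_def)
  next
    fix t and f :: "nat \<Rightarrow> nat \<times> nat"
    assume "\<And>y. (y, t) \<in> {(x, y). x < y} \<Longrightarrow> P f y (f y)"
    then have f: "fst (f j) \<in> univ M" if "j < t" for j using that by (auto simp: P_def)
    show "\<exists>r. P f t r"
    proof (cases "even t")
      case True
      then show ?thesis using m by (auto simp: P_def)
    next
      case False
      let ?A = "\<lambda>n. A (fst \<circ> f) (snd \<circ> f) n t"
      have fin: "finite (?A n)" for n by (simp add: A_def)
      have mono: "mono ?A" by (auto simp: A_def mono_def)
      have sub: "?A n \<subseteq> univ M" for n using f by (auto simp: A_def)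
      \<comment> \<open>\<open>K\<close> bounds the labels given so far, so the members of the chain
        with larger index do not yet differ.\<close>
      define K where "K = Max (insert 0 ((snd \<circ> f) ` {..<t}))"
      have "(snd \<circ> f) j \<le> K" if "j < t" for j unfolding K_def using that by (intro Max_ge) auto
      then have K: "?A n = ?A K" if "n \<ge> K" for n
        using that unfolding A_def by (intro image_cong) (auto intro: order_trans)
      obtain n0 X0 where task0: "task (t div 2) = (n0, X0)" by fastforce
      \<comment> \<open>A task is skipped when its set is empty or not definable from the elements
        present so far. The stage then adds an isolated element of \<open>univ M\<close> with label
        \<open>0\<close> as a default.\<close>
      define use where "use \<longleftrightarrow> X0 \<in> Def \<Sigma> M (?A n0) \<and> X0 \<noteq> {}"
      define n where "n = (if use then n0 else 0)"
      define X where "X = (if use then X0 else univ M)"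
      have X: "X \<in> Def \<Sigma> M (?A n)" "X \<noteq> {}"
        using univ_in_Def ne by (auto simp: n_def X_def use_def)
      then obtain c where c: "c \<in> X" "\<And>n'. n' \<ge> n \<Longrightarrow> isolated \<Sigma> M (?A n') c"
        using nested_isolated[OF cnt T small M mono fin sub K] by blast
      have "c \<in> univ M" using c(1) X(1) Def_subset by blast
      then have "P f t (c, n)"
        using False c task0 by (cases use) (auto simp: P_def n_def X_def use_def[symmetric], auto simp: use_def)
      then show ?thesis by blast
    qed
  qed
  then obtain f where f: "\<And>t. P f t (f t)" by blast
  define e where "e = fst \<circ> f"
  define l where "l = snd \<circ> f"
  have P: "e t \<in> univ M" "even t \<Longrightarrow> e t = m (t div 2) \<and> l t = t div 2"
    "odd t \<Longrightarrow> l t \<le> n \<Longrightarrow> isolated \<Sigma> M (A e l n t) (e t)"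
    "odd t \<Longrightarrow> task (t div 2) = (n, X) \<Longrightarrow> X \<in> Def \<Sigma> M (A e l n t) \<Longrightarrow> X \<noteq> {} \<Longrightarrow> l t = n \<and> e t \<in> X"
    for t n X
    using f[of t] unfolding P_def e_def l_def by (auto simp: prod_eq_iff)
  \<comment> \<open>The task for \<open>X\<close> recurs after stage \<open>t\<close>. By then the
    parameter set can only have grown, so \<open>X\<close> is still definable and the task is
    carried out.\<close>
  have "\<exists>t'. l t' = n \<and> e t' \<in> X" if X: "X \<in> Def \<Sigma> M (A e l n t)" "X \<noteq> {}" for n t X
  proof -
    have "A e l n t \<subseteq> univ M" using P(1) by (auto simp: A_def)
    then have "X \<in> ?D" using X Def_mono by blast
    then obtain k where k: "k \<ge> t" "task k = (n, X)" using task by blast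
    have "A e l n t \<subseteq> A e l n (2 * k + 1)" using k(1) by (auto simp: A_def)
    then have "X \<in> Def \<Sigma> M (A e l n (2 * k + 1))" using X Def_mono by blast
    then show ?thesis using P(4)[of "2 * k + 1" n X] k X(2) by auto
  qed
  moreover have "e (2 * k) = m k \<and> l (2 * k) = k" for k using P(2)[of "2 * k"] by simp
  ultimately show ?thesis using P(1,3) by (intro exI[of _ e] exI[of _ l]) auto
qed

text \<open>Member \<open>n\<close> consists of the elements with label at most \<open>n\<close>. It
  is constructible over the entries of its first \<open>2 * n + 1\<close> stages: an even stage
  after \<open>2 * n\<close> has a label above \<open>n\<close>, so all later new elements of this
  member come from odd stages and are isolated.\<close>

lemma prime_chain:
  fixes M :: "'r cstruct"
  assumes cnt: "countable (dom \<Sigma>)" and T: "T \<subseteq> sentences \<Sigma>"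
    and small: "countable (realized_types \<Sigma> T)" and M: "model \<Sigma> T M"
  shows "\<exists>C :: nat \<Rightarrow> nat set. mono C \<and> (\<Union>n. C n) = univ M \<and>
    (\<forall>n. elementary_embedding \<Sigma> id (sub M (C n)) M \<and> prime_over_tuple \<Sigma> T (sub M (C n)))"
proof -
  have ne: "univ M \<noteq> {}" using M by (simp add: model_def is_struct_def)
  obtain m :: "nat \<Rightarrow> nat" where m: "range m = univ M"
    using range_from_nat_into[OF ne countableI_type] by blast
  define A where "A = (\<lambda>(e :: nat \<Rightarrow> nat) (l :: nat \<Rightarrow> nat) n t. e ` {j. j < t \<and> l j \<le> n})"
  from labelled_construction[OF cnt T small M m] obtain e l
    where el: "range e \<subseteq> univ M" "\<forall>k. e (2 * k) = m k \<and> l (2 * k) = k"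
      "\<forall>t n. odd t \<longrightarrow> l t \<le> n \<longrightarrow> isolated \<Sigma> M (A e l n t) (e t)"
      "\<forall>n t X. X \<in> Def \<Sigma> M (A e l n t) \<longrightarrow> X \<noteq> {} \<longrightarrow> (\<exists>t'. l t' = n \<and> e t' \<in> X)"
    unfolding A_def by (elim exE conjE)
  then have e: "range e \<subseteq> univ M" "\<And>k. e (2 * k) = m k" "\<And>k. l (2 * k) = k"
    "\<And>t n. odd t \<Longrightarrow> l t \<le> n \<Longrightarrow> isolated \<Sigma> M (A e l n t) (e t)"
    "\<And>n t X. X \<in> Def \<Sigma> M (A e l n t) \<Longrightarrow> X \<noteq> {} \<Longrightarrow> \<exists>t'. l t' = n \<and> e t' \<in> X"
    by simp_all
  define C where "C n = e ` {t. l t \<le> n}" for n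
  have CM: "C n \<subseteq> univ M" for n using e(1) by (auto simp: C_def)
  have "mono C" by (auto simp: mono_def C_def)
  moreover have "(\<Union>n. C n) = univ M"
  proof
    show "univ M \<subseteq> (\<Union>n. C n)"
    proof
      fix x assume "x \<in> univ M"
      then obtain k where "x = m k" using m by blast
      then have "x \<in> C k" using e(2,3)[of k] by (auto simp: C_def intro!: image_eqI[of _ _ "2 * k"])
      then show "x \<in> (\<Union>n. C n)" by blast
    qed
  qed (use CM in blast)
  moreover have emb: "elementary_embedding \<Sigma> id (sub M (C n)) M" for n
  proof (rule Tarski_Vaught[OF CM])
    fix \<phi> i and s :: "nat \<Rightarrow> nat"
    assume \<phi>: "in_lang \<Sigma> \<phi>" and s: "range s \<subseteq> C n" and ex: "\<exists>a\<in>univ M. sat M (s(i := a)) \<phi>"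
    have "\<exists>t. s ` F \<subseteq> A e l n t" if "finite F" for F
      using that
    proof (induction F)
      case (insert x F)
      then obtain t t' where "s ` F \<subseteq> A e l n t" "s x = e t'" "l t' \<le> n"
        using s by (fastforce simp: C_def image_subset_iff)
      then have "s ` insert x F \<subseteq> A e l n (max t (Suc t'))" by (fastforce simp: A_def)
      then show ?case by blast
    qed simp
    from this[of "fv \<phi> - {i}"] obtain t where t: "s ` (fv \<phi> - {i}) \<subseteq> A e l n t"
      using finite_fv[of \<phi>] by (elim exE meta_impE) auto
    let ?X = "{c \<in> univ M. sat M (s(i := c)) \<phi>}"
    have "?X \<in> Def \<Sigma> M (A e l n t)" using \<phi> t by (rule Def_assignment)
    moreover have "?X \<noteq> {}" using ex by blast
    ultimately obtain t' where "l t' = n" "e t' \<in> ?X" using e(5) by blast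
    then show "\<exists>b\<in>C n. sat M (s(i := b)) \<phi>" by (auto simp: C_def)
  qed
  moreover have "prime_over_tuple \<Sigma> T (sub M (C n))" for n
  proof -
    \<comment> \<open>Elements outside member \<open>n\<close> are replaced by
      \<open>e (2 * n)\<close>, which has label \<open>n\<close> and occurs within the base tuple;
      the later repetitions are isolated as parameters.\<close>
    define u where "u t = (if l t \<le> n then e t else e (2 * n))" for t
    have range: "range u = C n"
    proof
      show "range u \<subseteq> C n" using e(3)[of n] by (auto simp: u_def C_def)
      show "C n \<subseteq> range u" by (auto simp: u_def C_def image_iff intro!: exI)
    qed
    have prefix: "u ` {..<t} = A e l n t" if "2 * n + 1 \<le> t" for t
    proof
      show "u ` {..<t} \<subseteq> A e l n t" using e(3)[of n] that by (auto simp: u_def A_def)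
      show "A e l n t \<subseteq> u ` {..<t}" by (auto simp: u_def A_def image_iff)
    qed
    have "isolated \<Sigma> M (u ` {..<t}) (u t)" if t: "2 * n + 1 \<le> t" for t
    proof (cases "l t \<le> n")
      case True
      have "odd t"
      proof
        assume "even t"
        then obtain k where "t = 2 * k" by blast
        then show False using True t e(3)[of k] by simp
      qed
      moreover have "u t = e t" using True by (simp add: u_def)
      ultimately show ?thesis unfolding prefix[OF t] using e(4)[OF _ True] by simp
    next
      case False
      then have "u t = u (2 * n)" using e(3)[of n] by (simp add: u_def)
      then show ?thesis using t range CM by (intro isolated_member) auto
    qed
    then show ?thesis
      using constructible_prime[OF M T emb range, of "2 * n + 1"]
      by (auto simp: prime_over_tuple_def)
  qed
  ultimately show ?thesis by blast
qed

lemma iso_prime_over: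
  fixes M N :: "'r cstruct"
  assumes "iso_via g M N" "is_struct \<Sigma> N" "T \<subseteq> sentences \<Sigma>" "prime_over \<Sigma> T M as"
  shows "prime_over \<Sigma> T N (map g as)" and "tp \<Sigma> N (map g as) = tp \<Sigma> M as"
proof -
  have M: "model \<Sigma> T M" "as \<in> lists (univ M)" using assms(4) by (auto simp: prime_over_def)
  then have st: "is_struct \<Sigma> M" by (simp add: model_def)
  have emb: "elementary_embedding \<Sigma> g M N" using assms(1) by (rule iso_via_emb)
  let ?h = "inv_into (univ M) g"
  have emb': "elementary_embedding \<Sigma> ?h N M" using assms(1) by (intro iso_via_emb iso_via_inv)
  show tp: "tp \<Sigma> N (map g as) = tp \<Sigma> M as"
    using st by (intro emb_tp[OF emb M(2)]) (simp add: is_struct_def)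
  have "map ?h (map g as) = as"
    using M(2) emb_inj[OF emb] by (auto simp: comp_def intro!: map_idI)
  moreover have "model \<Sigma> T N" using emb_model[OF emb assms(3) st assms(2)] M(1) by blast
  moreover have "map g as \<in> lists (univ N)" using M(2) emb_range[OF emb] by auto
  moreover have "\<exists>f. elementary_embedding \<Sigma> f N K \<and> map f (map g as) = bs"
    if K: "model \<Sigma> T K" "bs \<in> lists (univ K)" "tp \<Sigma> K bs = tp \<Sigma> N (map g as)"
    for K :: "'r cstruct" and bs
  proof -
    obtain f where f: "elementary_embedding \<Sigma> f M K" "map f as = bs"
      using assms(4) K tp unfolding prime_over_def by metis
    have "elementary_embedding \<Sigma> (f \<circ> ?h) N K" using emb' f(1) by (rule emb_comp)
    moreover have "map (f \<circ> ?h) (map g as) = bs"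
      using f(2) \<open>map ?h (map g as) = as\<close> by (metis map_map)
    ultimately show ?thesis by blast
  qed
  ultimately show "prime_over \<Sigma> T N (map g as)" by (simp add: prime_over_def)
qed

lemma iso_prime_over_type:
  "iso M N \<Longrightarrow> is_struct \<Sigma> N \<Longrightarrow> T \<subseteq> sentences \<Sigma> \<Longrightarrow> prime_over_type \<Sigma> T q M \<Longrightarrow>
    prime_over_type \<Sigma> T q N"
  unfolding prime_over_type_def iso_iff
  by (elim exE conjE) (intro exI conjI, erule (3) iso_prime_over(1), simp add: iso_prime_over(2))

lemma iso_prime_over_tuple:
  "iso M N \<Longrightarrow> is_struct \<Sigma> N \<Longrightarrow> T \<subseteq> sentences \<Sigma> \<Longrightarrow> prime_over_tuple \<Sigma> T M \<Longrightarrow>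
    prime_over_tuple \<Sigma> T N"
  unfolding prime_over_tuple_def iso_iff
  by (elim exE) (intro exI, erule (3) iso_prime_over(1))

lemma tp_in_S:
  fixes M :: "'r cstruct"
  assumes "model \<Sigma> T M" "as \<in> lists (univ M)"
  shows "tp \<Sigma> M as \<in> S \<Sigma> T"
proof -
  have "complete_type \<Sigma> T (length as) (tp \<Sigma> M as)"
    unfolding complete_type_def
  proof (intro conjI ballI)
    show "\<exists>(M' :: 'r cstruct) bs. model \<Sigma> T M' \<and> bs \<in> lists (univ M') \<and> length bs = length as \<and>
        (\<forall>\<phi>\<in>tp \<Sigma> M as. sat M' ((!) bs) \<phi>)"
      using assms by (intro exI[of _ M] exI[of _ as]) (auto simp: tp_def)
  qed (auto simp: tp_def formulas_def)
  then show ?thesis by (auto simp: S_def)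
qed

lemma prime_over_type_in_S: "prime_over_type \<Sigma> T q M \<Longrightarrow> q \<in> S \<Sigma> T"
  unfolding prime_over_type_def prime_over_def using tp_in_S by blast

lemma prime_over_type_model: "prime_over_type \<Sigma> T q M \<Longrightarrow> model \<Sigma> T M"
  unfolding prime_over_type_def prime_over_def by blast

lemma prime_over_tuple_iff: "prime_over_tuple \<Sigma> T M \<longleftrightarrow> (\<exists>q. prime_over_type \<Sigma> T q M)"
  unfolding prime_over_tuple_def prime_over_type_def by blast

definition chain_over :: "'r lang \<Rightarrow> 'r fm set \<Rightarrow> 'r fm set \<Rightarrow> 'r cstruct \<Rightarrow> bool" where
  "chain_over \<Sigma> T q M \<longleftrightarrow> model \<Sigma> T M \<and>
     (\<exists>C. (\<forall>n. prime_over_type \<Sigma> T q (C n)) \<and> elementary_chain_union \<Sigma> C M)"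

lemma limit_over_iff:
  "limit_over \<Sigma> T q M \<longleftrightarrow> chain_over \<Sigma> T q M \<and> \<not> prime_over_tuple \<Sigma> T M"
  unfolding limit_over_def chain_over_def by blast

lemma chain_over_prime: "prime_over_type \<Sigma> T q M \<Longrightarrow> chain_over \<Sigma> T q M"
  unfolding chain_over_def elementary_chain_union_def elementary_substruct_def
  using prime_over_type_model emb_id by (intro conjI exI[of _ "\<lambda>_. M"]) auto

text \<open>Elementarity of two consecutive members in \<open>M\<close> gives it between them. A
  tuple in a relation is finite and hence lies in one member.\<close>

lemma chain_union_sub:
  fixes C :: "nat \<Rightarrow> 'a set"
  assumes C: "mono C" "(\<Union>n. C n) = univ M" "\<And>n. elementary_embedding \<Sigma> id (sub M (C n)) M"
    and M: "is_struct \<Sigma> M"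
  shows "elementary_chain_union \<Sigma> (\<lambda>n. sub M (C n)) M"
  unfolding elementary_chain_union_def elementary_substruct_def
proof (intro conjI allI)
  fix n
  have le: "C n \<subseteq> C (Suc n)" using C(1) by (simp add: mono_iff_le_Suc)
  have "sat (sub M (C n)) s \<phi> \<longleftrightarrow> sat (sub M (C (Suc n))) s \<phi>"
    if "in_lang \<Sigma> \<phi>" "range s \<subseteq> C n" for s \<phi>
    using C(3)[of n] C(3)[of "Suc n"] that le by (simp add: elementary_embedding_def)
  then show "elementary_embedding \<Sigma> id (sub M (C n)) (sub M (C (Suc n)))"
    using le by (simp add: elementary_embedding_def)
next
  fix R
  have "\<exists>n. xs \<in> lists (C n)" if "set xs \<subseteq> univ M" for xs
    using that
  proof (induction xs)
    case (Cons x xs)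
    have "x \<in> (\<Union>n. C n)" using Cons.prems C(2) by simp
    moreover have "\<exists>n. xs \<in> lists (C n)" using Cons by simp
    ultimately obtain n k where "xs \<in> lists (C n)" "x \<in> C k" by blast
    then have "x # xs \<in> lists (C (max n k))"
      using monoD[OF C(1), of n "max n k"] monoD[OF C(1), of k "max n k"] by (auto simp: subset_iff)
    then show ?case by blast
  qed simp
  moreover have "set xs \<subseteq> univ M" if "xs \<in> interp M R" for xs
    using that M by (auto simp: is_struct_def)
  ultimately show "interp M R = (\<Union>n. interp (sub M (C n)) R)" unfolding sub_def by fastforce
qed (simp add: C(2))

text \<open>By the pigeonhole principle the chain of prime models can be thinned out to one whose members
  are isomorphic, hence prime over realizations of one and the same type.\<close>

lemma model_chain_over:
  fixes M :: "'r cstruct"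
  assumes cnt: "countable (dom \<Sigma>)" and T: "T \<subseteq> sentences \<Sigma>"
    and fin: "num_models \<Sigma> T < \<infinity>" and M: "model \<Sigma> T M"
  shows "\<exists>q. chain_over \<Sigma> T q M"
proof -
  obtain C :: "nat \<Rightarrow> nat set" where C: "mono C" "(\<Union>n. C n) = univ M"
    "\<And>n. elementary_embedding \<Sigma> id (sub M (C n)) M" "\<And>n. prime_over_tuple \<Sigma> T (sub M (C n))"
    using prime_chain[OF cnt T countable_realized_types[OF fin] M] by blast
  let ?f = "\<lambda>n. iso_type \<Sigma> (sub M (C n))"
  have mod: "model \<Sigma> T (sub M (C n))" for n
    using C(4)[of n] prime_over_tuple_iff prime_over_type_model by blast
  have "finite {iso_type \<Sigma> N |N :: 'r cstruct. model \<Sigma> T N}"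
    using fin by (auto simp: num_models_def ecard_def split: if_splits)
  moreover have "range ?f \<subseteq> {iso_type \<Sigma> N |N :: 'r cstruct. model \<Sigma> T N}" using mod by blast
  ultimately have "finite (range ?f)" by (rule finite_subset[rotated])
  from pigeonhole_infinite[OF infinite_UNIV_nat this]
  obtain n0 where inf: "infinite {n \<in> UNIV. ?f n = ?f n0}" by blast
  define I where "I = {n. ?f n = ?f n0}"
  have I: "infinite I" using inf by (simp add: I_def)
  \<comment> \<open>The indices of one recurring isomorphism type, taken in increasing order. The
    \<open>n\<close>-th of them is at least \<open>n\<close>, so the thinned chain has the same
    union.\<close>
  define D where "D k = C (enumerate I k)" for k
  have "mono D"
    unfolding D_def mono_iff_le_Suc using monoD[OF C(1)] enumerate_step[OF I] less_imp_le by blast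
  moreover have "(\<Union>k. D k) = univ M"
  proof -
    have "C n \<subseteq> D n" for n unfolding D_def by (rule monoD[OF C(1)]) (rule le_enumerate[OF I])
    then have "(\<Union>n. C n) \<subseteq> (\<Union>k. D k)" by (intro UN_mono) auto
    moreover have "(\<Union>k. D k) \<subseteq> (\<Union>n. C n)" unfolding D_def by (intro UN_least UN_upper) simp
    ultimately show ?thesis using C(2) by simp
  qed
  ultimately have "elementary_chain_union \<Sigma> (\<lambda>k. sub M (D k)) M"
  proof (intro chain_union_sub)
    show "elementary_embedding \<Sigma> id (sub M (D k)) M" for k unfolding D_def by (rule C(3))
  qed (use M in \<open>simp_all add: model_def\<close>)
  moreover obtain q where q: "prime_over_type \<Sigma> T q (sub M (C n0))"
    using C(4)[of n0] by (auto simp: prime_over_tuple_iff)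
  have "prime_over_type \<Sigma> T q (sub M (D k))" for k
  proof -
    have st: "is_struct \<Sigma> (sub M (D k))" using mod by (simp add: D_def model_def)
    have "enumerate I k \<in> I" by (rule enumerate_in_set[OF I])
    then have "iso_type \<Sigma> (sub M (C n0)) = iso_type \<Sigma> (sub M (D k))"
      by (simp add: I_def D_def)
    then have "iso (sub M (C n0)) (sub M (D k))" using iso_type_eq_iff[OF st] by blast
    then show ?thesis using st T q by (rule iso_prime_over_type)
  qed
  ultimately show ?thesis unfolding chain_over_def using M by (intro exI[of _ q] conjI exI) auto
qed

lemma ex_prime_over_tuple:
  fixes M :: "'r cstruct"
  assumes "countable (dom \<Sigma>)" "T \<subseteq> sentences \<Sigma>" "num_models \<Sigma> T < \<infinity>" "model \<Sigma> T M"
  shows "\<exists>N. prime_over_tuple \<Sigma> T N"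
  using model_chain_over[OF assms] unfolding chain_over_def prime_over_tuple_iff by blast

section \<open>Chain unions and the Rudin-Keisler preorder of one theory\<close>

section \<open>The Rudin-Keisler preorder and limit models\<close>

definition embeds :: "'r lang \<Rightarrow> ('r, 'a) struct \<Rightarrow> ('r, 'b) struct \<Rightarrow> bool" where
  "embeds \<Sigma> M N \<longleftrightarrow> (\<exists>f. elementary_embedding \<Sigma> f M N)"

lemma embeds_refl: "embeds \<Sigma> M M"
  unfolding embeds_def using emb_id by blast

lemma embeds_trans: "embeds \<Sigma> M N \<Longrightarrow> embeds \<Sigma> N K \<Longrightarrow> embeds \<Sigma> M K"
  unfolding embeds_def by (elim exE) (rule exI, rule emb_comp)

lemma iso_embeds: "iso M N \<Longrightarrow> embeds \<Sigma> M N"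
  unfolding embeds_def iso_iff by (elim exE) (rule exI, rule iso_via_emb)

lemma RK_eq: "RK \<Sigma> T = {iso_type \<Sigma> M |M. prime_over_tuple \<Sigma> T M}"
  unfolding RK_def prime_over_tuple_iff using prime_over_type_in_S by blast

lemma prime_over_tuple_struct: "prime_over_tuple \<Sigma> T M \<Longrightarrow> is_struct \<Sigma> M"
  unfolding prime_over_tuple_def prime_over_def model_def by blast

lemma prime_over_tuple_model: "prime_over_tuple \<Sigma> T M \<Longrightarrow> model \<Sigma> T M"
  unfolding prime_over_tuple_def prime_over_def by blast

lemma iso_type_in_RK:
  fixes M :: "'r cstruct"
  assumes "T \<subseteq> sentences \<Sigma>" "is_struct \<Sigma> M"
  shows "iso_type \<Sigma> M \<in> RK \<Sigma> T \<longleftrightarrow> prime_over_tuple \<Sigma> T M"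
proof
  assume "iso_type \<Sigma> M \<in> RK \<Sigma> T"
  then obtain N where N: "iso_type \<Sigma> N = iso_type \<Sigma> M" "prime_over_tuple \<Sigma> T N"
    by (auto simp: RK_eq)
  then have "iso N M" using iso_type_eq_iff[OF assms(2)] by blast
  then show "prime_over_tuple \<Sigma> T M" using assms(2,1) N(2) by (rule iso_prime_over_tuple)
qed (auto simp: RK_eq)

lemma prime_over_type_embeds:
  fixes N :: "'r cstruct"
  shows "prime_over_type \<Sigma> T q M \<Longrightarrow> model \<Sigma> T N \<Longrightarrow> realizes \<Sigma> N q \<Longrightarrow> embeds \<Sigma> M N"
  unfolding prime_over_type_def prime_over_def realizes_def embeds_def by blast

lemma prime_over_type_realizes: "prime_over_type \<Sigma> T q M \<Longrightarrow> realizes \<Sigma> M q"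
  unfolding prime_over_type_def prime_over_def realizes_def by blast

lemma prime_over_type_embeds_each_other:
  "prime_over_type \<Sigma> T q M \<Longrightarrow> prime_over_type \<Sigma> T q N \<Longrightarrow> embeds \<Sigma> M N"
  by (rule prime_over_type_embeds) (auto intro: prime_over_type_model prime_over_type_realizes)

lemma realizes_embedding:
  assumes "elementary_embedding \<Sigma> f M N" "is_struct \<Sigma> M" "realizes \<Sigma> M q"
  shows "realizes \<Sigma> N q"
proof -
  obtain as where as: "as \<in> lists (univ M)" "tp \<Sigma> M as = q" using assms(3) by (auto simp: realizes_def)
  have "tp \<Sigma> N (map f as) = q"
    using emb_tp[OF assms(1) as(1)] as(2) assms(2) by (simp add: is_struct_def)
  moreover have "map f as \<in> lists (univ N)" using as(1) emb_range[OF assms(1)] by auto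
  ultimately show ?thesis unfolding realizes_def by blast
qed

lemma embeds_realizes: "embeds \<Sigma> M N \<Longrightarrow> is_struct \<Sigma> M \<Longrightarrow> realizes \<Sigma> M q \<Longrightarrow> realizes \<Sigma> N q"
  unfolding embeds_def by (elim exE) (rule realizes_embedding)

text \<open>A realization of \<open>p\<close> in a model gives an embedding by primeness, and
  embeddings preserve realized types. This frees the preorder from the choice of types and
  representatives in \<open>rk_le\<close>.\<close>

lemma rk_le_iff:
  fixes M N :: "'r cstruct"
  assumes M: "prime_over_tuple \<Sigma> T M" and N: "prime_over_tuple \<Sigma> T N"
  shows "rk_le \<Sigma> T (iso_type \<Sigma> M) (iso_type \<Sigma> N) \<longleftrightarrow> embeds \<Sigma> M N"
proof
  assume "rk_le \<Sigma> T (iso_type \<Sigma> M) (iso_type \<Sigma> N)"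
  then obtain p q M' N' where "M' \<in> iso_type \<Sigma> M" "N' \<in> iso_type \<Sigma> N"
    "prime_over_type \<Sigma> T p M'" "prime_over_type \<Sigma> T q N'" "realizes \<Sigma> N' p"
    unfolding rk_le_def by blast
  then have "iso M M'" "iso N N'" "embeds \<Sigma> M' N'"
    using prime_over_type_embeds[OF _ prime_over_type_model] unfolding iso_type_def by blast+
  then show "embeds \<Sigma> M N" using iso_embeds iso_sym embeds_trans by metis
next
  assume emb: "embeds \<Sigma> M N"
  obtain p q where pq: "prime_over_type \<Sigma> T p M" "prime_over_type \<Sigma> T q N"
    using M N prime_over_tuple_iff by blast
  have st: "is_struct \<Sigma> M" "is_struct \<Sigma> N" using M N prime_over_tuple_struct by auto
  have "realizes \<Sigma> N p"
    by (rule embeds_realizes[OF emb st(1) prime_over_type_realizes[OF pq(1)]])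
  moreover have "M \<in> iso_type \<Sigma> M" "N \<in> iso_type \<Sigma> N" using st by (auto simp: iso_type_def)
  ultimately show "rk_le \<Sigma> T (iso_type \<Sigma> M) (iso_type \<Sigma> N)"
    unfolding rk_le_def using pq prime_over_type_in_S by blast
qed

lemma equiv_rk_equiv: "equiv (RK \<Sigma> T) (rk_equiv \<Sigma> T)"
proof (rule equivI)
  show "rk_equiv \<Sigma> T \<subseteq> RK \<Sigma> T \<times> RK \<Sigma> T" by (auto simp: rk_equiv_def)
  show "refl_on (RK \<Sigma> T) (rk_equiv \<Sigma> T)"
    unfolding refl_on_def by (auto simp: rk_equiv_def RK_eq rk_le_iff embeds_refl)
  show "sym (rk_equiv \<Sigma> T)" by (auto simp: sym_def rk_equiv_def)
  show "trans (rk_equiv \<Sigma> T)"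
    unfolding trans_def
    by (auto simp: rk_equiv_def RK_eq rk_le_iff intro: embeds_trans)
qed

lemma RK_class_subset: "x \<in> RK_classes \<Sigma> T \<Longrightarrow> x \<subseteq> RK \<Sigma> T"
  unfolding RK_classes_def using equiv_rk_equiv in_quotient_imp_subset by blast

lemma RK_class_nonempty: "x \<in> RK_classes \<Sigma> T \<Longrightarrow> x \<noteq> {}"
  unfolding RK_classes_def using equiv_rk_equiv in_quotient_imp_non_empty by blast

lemma in_RK_class:
  assumes x: "x \<in> RK_classes \<Sigma> T" and M: "prime_over_tuple \<Sigma> T M" "iso_type \<Sigma> M \<in> x"
    and N: "prime_over_tuple \<Sigma> T N"
  shows "iso_type \<Sigma> N \<in> x \<longleftrightarrow> embeds \<Sigma> M N \<and> embeds \<Sigma> N M"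
proof -
  have "(iso_type \<Sigma> M, iso_type \<Sigma> N) \<in> rk_equiv \<Sigma> T \<longleftrightarrow> embeds \<Sigma> M N \<and> embeds \<Sigma> N M"
    using M(1) N by (auto simp: rk_equiv_def rk_le_iff RK_eq)
  moreover have "iso_type \<Sigma> N \<in> x \<longleftrightarrow> (iso_type \<Sigma> M, iso_type \<Sigma> N) \<in> rk_equiv \<Sigma> T"
    using x M(2) unfolding RK_classes_def
    by (metis bot.extremum empty_subsetI equiv_rk_equiv in_quotient_imp_closed
        in_quotient_imp_in_rel insert_subset)
  ultimately show ?thesis by simp
qed

lemma ex_RK_class:
  "X \<in> RK \<Sigma> T \<Longrightarrow> \<exists>x\<in>RK_classes \<Sigma> T. X \<in> x"
  unfolding RK_classes_def using equiv_rk_equiv by (metis equiv_class_self quotientI)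

lemma RK_classes_disjoint:
  "x \<in> RK_classes \<Sigma> T \<Longrightarrow> y \<in> RK_classes \<Sigma> T \<Longrightarrow> X \<in> x \<Longrightarrow> X \<in> y \<Longrightarrow> x = y"
  unfolding RK_classes_def using quotient_disj[OF equiv_rk_equiv] by blast

subsection \<open>Chains\<close>

text \<open>Tarski's elementary chain theorem. The induction treats all members at once, since a
  witness in the union may appear only in a later member; elementarity between members brings the
  existential statement back.\<close>

lemma elementary_chain:
  assumes C: "elementary_chain_union \<Sigma> C M" and st: "\<And>n. is_struct \<Sigma> (C n)"
  shows chain_tuple: "as \<in> lists (univ M) \<Longrightarrow> \<exists>n. as \<in> lists (univ (C n))"
    and chain_emb: "elementary_embedding \<Sigma> id (C n) M"
proof -
  have le: "elementary_embedding \<Sigma> id (C n) (C m)" if "n \<le> m" for n m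
    using that
  proof (induction m rule: dec_induct)
    case base
    then show ?case by (rule emb_id)
  next
    case (step m)
    have "elementary_embedding \<Sigma> id (C m) (C (Suc m))"
      using C by (simp add: elementary_chain_union_def elementary_substruct_def)
    from emb_comp[OF step.IH this] show ?case by simp
  qed
  have mono: "univ (C n) \<subseteq> univ (C m)" if "n \<le> m" for n m
    using le[OF that] by (simp add: elementary_embedding_def)
  have U: "univ M = (\<Union>n. univ (C n))" "interp M R = (\<Union>n. interp (C n) R)" for R
    using C by (auto simp: elementary_chain_union_def)
  show "\<exists>n. as \<in> lists (univ (C n))" if "as \<in> lists (univ M)"
    using that
  proof (induction as)
    case (Cons x as)
    then obtain n k where "as \<in> lists (univ (C n))" "x \<in> univ (C k)" using U(1) by auto
    then have "x # as \<in> lists (univ (C (max n k)))"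
      using mono[of n "max n k"] mono[of k "max n k"] by (auto simp: subset_iff)
    then show ?case by blast
  qed simp
  have "in_lang \<Sigma> \<phi> \<Longrightarrow> range s \<subseteq> univ (C n) \<Longrightarrow> sat (C n) s \<phi> \<longleftrightarrow> sat M s \<phi>" for \<phi> s n
  proof (induction \<phi> arbitrary: s n)
    case (Rel R "is")
    have "map s is \<in> interp (C n) R" if k: "map s is \<in> interp (C k) R" for k
    proof -
      have "sat (C n) s (Rel R is) \<longleftrightarrow> sat (C (max n k)) (id \<circ> s) (Rel R is)"
        using st[of n] Rel.prems by (intro emb_sat[OF le]) (auto simp: is_struct_def)
      moreover have "sat (C k) s (Rel R is) \<longleftrightarrow> sat (C (max n k)) (id \<circ> s) (Rel R is)"
      proof (rule emb_sat[OF le])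
        have "set (map s is) \<subseteq> univ (C k)" using st[of k] k unfolding is_struct_def by blast
        then show "s i \<in> univ (C k)" if "i \<in> fv (Rel R is)" for i using that by auto
      qed (use st[of k] Rel.prems in \<open>auto simp: is_struct_def\<close>)
      ultimately show ?thesis using k by simp
    qed
    then show ?case using U(2) by auto
  next
    case (Exists i \<phi>)
    have l: "in_lang \<Sigma> \<phi>" using Exists.prems by simp
    show ?case
    proof
      assume "sat M s (Exists i \<phi>)"
      then obtain a where a: "a \<in> univ M" "sat M (s(i := a)) \<phi>" by auto
      then obtain k where k: "a \<in> univ (C k)" using U(1) by auto
      let ?m = "max n k"
      have "range (s(i := a)) \<subseteq> univ (C ?m)"
        using Exists.prems(2) k mono[of n ?m] mono[of k ?m] by auto
      then have "sat (C ?m) (s(i := a)) \<phi>" using Exists.IH[OF l] a(2) by blast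
      moreover have "a \<in> univ (C ?m)" using k mono[of k ?m] by auto
      ultimately have "sat (C ?m) s (Exists i \<phi>)" by auto
      moreover have "sat (C n) s (Exists i \<phi>) \<longleftrightarrow> sat (C ?m) (id \<circ> s) (Exists i \<phi>)"
        using st[of n] Exists.prems by (intro emb_sat[OF le]) (auto simp: is_struct_def)
      ultimately show "sat (C n) s (Exists i \<phi>)" by simp
    next
      assume "sat (C n) s (Exists i \<phi>)"
      then obtain a where a: "a \<in> univ (C n)" "sat (C n) (s(i := a)) \<phi>" by auto
      have "range (s(i := a)) \<subseteq> univ (C n)" using Exists.prems(2) a(1) by auto
      then have "sat M (s(i := a)) \<phi>" using Exists.IH[OF l] a(2) by blast
      then show "sat M s (Exists i \<phi>)" using a(1) U(1) by auto
    qed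
  qed auto
  then show "elementary_embedding \<Sigma> id (C n) M"
    using U(1) by (auto simp: elementary_embedding_def)
qed

text \<open>The finite tuple over which \<open>M\<close> is prime lies in some member of the chain
  and has the same type there, so primeness embeds \<open>M\<close> into that member.\<close>

lemma chain_over_prime_embeds:
  assumes M: "chain_over \<Sigma> T q M" "prime_over_tuple \<Sigma> T M" and N: "prime_over_type \<Sigma> T q N"
  shows "embeds \<Sigma> M N \<and> embeds \<Sigma> N M"
proof -
  obtain C where C: "\<And>n. prime_over_type \<Sigma> T q (C n)" "elementary_chain_union \<Sigma> C M" "\<And>n. is_struct \<Sigma> (C n)"
    using M(1) prime_over_type_model unfolding chain_over_def model_def by blast
  obtain as where as: "prime_over \<Sigma> T M as" using M(2) by (auto simp: prime_over_tuple_def)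
  then obtain n where n: "as \<in> lists (univ (C n))"
    using chain_tuple[OF C(2,3)] unfolding prime_over_def by blast
  have mod: "model \<Sigma> T (C n)" using C(1) prime_over_type_model by blast
  have emb: "elementary_embedding \<Sigma> id (C n) M" by (rule chain_emb[OF C(2,3)])
  have "tp \<Sigma> M as = tp \<Sigma> (C n) as"
    using emb_tp[OF emb n] mod by (simp add: model_def is_struct_def)
  then have "embeds \<Sigma> M (C n)"
    using as n mod unfolding prime_over_def embeds_def by (metis (no_types))
  moreover have "embeds \<Sigma> (C n) M" using emb by (auto simp: embeds_def)
  ultimately show ?thesis
    using prime_over_type_embeds_each_other[OF C(1)[of n] N]
      prime_over_type_embeds_each_other[OF N C(1)[of n]] embeds_trans by blast
qed

text \<open>\<open>M'\<close> realizes \<open>q\<close> through the embedding of \<open>M\<close>.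
  The realization is a finite tuple and already lies in a member of the chain of \<open>M'\<close>,
  where primeness of \<open>N\<close> applies.\<close>

lemma chain_over_embeds:
  assumes M: "chain_over \<Sigma> T q M" and M': "chain_over \<Sigma> T q' M'" and "embeds \<Sigma> M M'"
    and N: "prime_over_type \<Sigma> T q N" and N': "prime_over_type \<Sigma> T q' N'"
  shows "embeds \<Sigma> N N'"
proof -
  obtain C where C: "\<And>n. prime_over_type \<Sigma> T q (C n)" "elementary_chain_union \<Sigma> C M" "\<And>n. is_struct \<Sigma> (C n)"
    using M prime_over_type_model unfolding chain_over_def model_def by blast
  obtain C' where C': "\<And>n. prime_over_type \<Sigma> T q' (C' n)" "elementary_chain_union \<Sigma> C' M'" "\<And>n. is_struct \<Sigma> (C' n)"
    using M' prime_over_type_model unfolding chain_over_def model_def by blast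
  have "embeds \<Sigma> (C 0) M" using chain_emb[OF C(2,3)] by (auto simp: embeds_def)
  then have "embeds \<Sigma> (C 0) M'" using assms(3) by (rule embeds_trans)
  then have "realizes \<Sigma> M' q"
    by (rule embeds_realizes[OF _ C(3) prime_over_type_realizes[OF C(1)]])
  then obtain as where as: "as \<in> lists (univ M')" "tp \<Sigma> M' as = q" by (auto simp: realizes_def)
  then obtain n where n: "as \<in> lists (univ (C' n))" using chain_tuple[OF C'(2,3)] by blast
  have mod: "model \<Sigma> T (C' n)" using C'(1) prime_over_type_model by blast
  have "tp \<Sigma> (C' n) as = q"
    using emb_tp[OF chain_emb[OF C'(2,3)] n] mod as(2) by (simp add: model_def is_struct_def)
  then have "embeds \<Sigma> N (C' n)"
    using n by (intro prime_over_type_embeds[OF N mod]) (auto simp: realizes_def)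
  then show ?thesis using prime_over_type_embeds_each_other[OF C'(1) N'] by (rule embeds_trans)
qed

definition chain_types :: "'r lang \<Rightarrow> 'r fm set \<Rightarrow> 'r cstruct set set \<Rightarrow> 'r cstruct set set" where
  "chain_types \<Sigma> T x = {iso_type \<Sigma> M |M. \<exists>q N.
     prime_over_type \<Sigma> T q N \<and> iso_type \<Sigma> N \<in> x \<and> chain_over \<Sigma> T q M}"

lemma I_l_eq:
  assumes "T \<subseteq> sentences \<Sigma>"
  shows "I_l \<Sigma> T x = ecard (chain_types \<Sigma> T x - RK \<Sigma> T)"
proof -
  have "{iso_type \<Sigma> M |M. \<exists>q\<in>S \<Sigma> T. \<exists>N. prime_over_type \<Sigma> T q N \<and> iso_type \<Sigma> N \<in> x \<and> limit_over \<Sigma> T q M}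
      = {iso_type \<Sigma> M |M. \<exists>q N. prime_over_type \<Sigma> T q N \<and> iso_type \<Sigma> N \<in> x \<and>
          chain_over \<Sigma> T q M \<and> \<not> prime_over_tuple \<Sigma> T M}"
    unfolding limit_over_iff using prime_over_type_in_S by blast
  also have "\<dots> = chain_types \<Sigma> T x - RK \<Sigma> T"
  proof -
    have "iso_type \<Sigma> M \<in> RK \<Sigma> T \<longleftrightarrow> prime_over_tuple \<Sigma> T M" if "chain_over \<Sigma> T q M" for M q
      using that by (intro iso_type_in_RK[OF assms]) (simp add: chain_over_def model_def)
    then show ?thesis unfolding chain_types_def by fastforce
  qed
  finally show ?thesis by (simp add: I_l_def)
qed

lemma chain_types_Int_RK:
  assumes T: "T \<subseteq> sentences \<Sigma>" and x: "x \<in> RK_classes \<Sigma> T"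
  shows "chain_types \<Sigma> T x \<inter> RK \<Sigma> T = x"
proof
  show "chain_types \<Sigma> T x \<inter> RK \<Sigma> T \<subseteq> x"
  proof
    fix X assume "X \<in> chain_types \<Sigma> T x \<inter> RK \<Sigma> T"
    then obtain M q N where X: "X = iso_type \<Sigma> M" "iso_type \<Sigma> M \<in> RK \<Sigma> T"
      and M: "prime_over_type \<Sigma> T q N" "iso_type \<Sigma> N \<in> x" "chain_over \<Sigma> T q M"
      by (auto simp: chain_types_def)
    have "is_struct \<Sigma> M" using M(3) by (simp add: chain_over_def model_def)
    then have pM: "prime_over_tuple \<Sigma> T M" using iso_type_in_RK[OF T] X(2) by blast
    have pN: "prime_over_tuple \<Sigma> T N" using M(1) by (auto simp: prime_over_tuple_iff)
    show "X \<in> x"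
      using in_RK_class[OF x pN M(2) pM] chain_over_prime_embeds[OF M(3) pM M(1)] X(1) by blast
  qed
  show "x \<subseteq> chain_types \<Sigma> T x \<inter> RK \<Sigma> T"
  proof
    fix X assume X: "X \<in> x"
    then have R: "X \<in> RK \<Sigma> T" using RK_class_subset[OF x] by blast
    then obtain M q where "X = iso_type \<Sigma> M" "prime_over_type \<Sigma> T q M"
      by (auto simp: RK_eq prime_over_tuple_iff)
    then have "X \<in> chain_types \<Sigma> T x"
      unfolding chain_types_def using X chain_over_prime by blast
    then show "X \<in> chain_types \<Sigma> T x \<inter> RK \<Sigma> T" using R by blast
  qed
qed

text \<open>Isomorphic chain unions embed into each other, which makes the models they are built
  from equivalent. Hence no limit model is counted in two classes.\<close>

lemma chain_types_disjoint:
  assumes x: "x \<in> RK_classes \<Sigma> T" and y: "y \<in> RK_classes \<Sigma> T"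
    and "chain_types \<Sigma> T x \<inter> chain_types \<Sigma> T y \<noteq> {}"
  shows "x = y"
proof -
  obtain M q N M' q' N' where M: "iso_type \<Sigma> M = iso_type \<Sigma> M'"
    and x': "prime_over_type \<Sigma> T q N" "iso_type \<Sigma> N \<in> x" "chain_over \<Sigma> T q M"
    and y': "prime_over_type \<Sigma> T q' N'" "iso_type \<Sigma> N' \<in> y" "chain_over \<Sigma> T q' M'"
    using assms(3) by (auto simp: chain_types_def)
  have "is_struct \<Sigma> M'" using y'(3) by (simp add: chain_over_def model_def)
  then have "iso M M'" using M iso_type_eq_iff by blast
  then have "embeds \<Sigma> M M'" "embeds \<Sigma> M' M" using iso_embeds iso_sym by blast+
  then have "embeds \<Sigma> N N'" "embeds \<Sigma> N' N"
    using chain_over_embeds[OF x'(3) y'(3) _ x'(1) y'(1)]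
      chain_over_embeds[OF y'(3) x'(3) _ y'(1) x'(1)] by auto
  moreover have "prime_over_tuple \<Sigma> T N" "prime_over_tuple \<Sigma> T N'"
    using x'(1) y'(1) by (auto simp: prime_over_tuple_iff)
  ultimately have "iso_type \<Sigma> N' \<in> x" using in_RK_class[OF x _ x'(2)] by blast
  then show ?thesis using RK_classes_disjoint[OF x y] y'(2) by blast
qed

lemma chain_types_subset:
  fixes T :: "'r fm set"
  shows "chain_types \<Sigma> T x \<subseteq> {iso_type \<Sigma> M |M :: 'r cstruct. model \<Sigma> T M}"
  unfolding chain_types_def chain_over_def by blast

text \<open>The type \<open>q\<close> provided by \<open>model_chain_over\<close> determines the
  class: it is the one containing the model prime over \<open>q\<close>.\<close>

lemma Union_chain_types:
  fixes T :: "'r fm set"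
  assumes "countable (dom \<Sigma>)" "T \<subseteq> sentences \<Sigma>" "num_models \<Sigma> T < \<infinity>"
  shows "(\<Union>x\<in>RK_classes \<Sigma> T. chain_types \<Sigma> T x) = {iso_type \<Sigma> M |M :: 'r cstruct. model \<Sigma> T M}"
proof
  show "{iso_type \<Sigma> M |M :: 'r cstruct. model \<Sigma> T M} \<subseteq> (\<Union>x\<in>RK_classes \<Sigma> T. chain_types \<Sigma> T x)"
  proof
    fix X assume "X \<in> {iso_type \<Sigma> M |M :: 'r cstruct. model \<Sigma> T M}"
    then obtain M :: "'r cstruct" where M: "X = iso_type \<Sigma> M" "model \<Sigma> T M" by blast
    obtain q where q: "chain_over \<Sigma> T q M" using model_chain_over[OF assms M(2)] by blast
    then obtain N where N: "prime_over_type \<Sigma> T q N" by (auto simp: chain_over_def)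
    then have "iso_type \<Sigma> N \<in> RK \<Sigma> T" by (auto simp: RK_eq prime_over_tuple_iff)
    then obtain x where "x \<in> RK_classes \<Sigma> T" "iso_type \<Sigma> N \<in> x" using ex_RK_class by blast
    then show "X \<in> (\<Union>x\<in>RK_classes \<Sigma> T. chain_types \<Sigma> T x)"
      using M(1) q N unfolding chain_types_def by blast
  qed
qed (use chain_types_subset in blast)

section \<open>Splitting structures over a disjoint union\<close>

section \<open>Relativization\<close>

definition restr :: "'r \<Rightarrow> 'r lang \<Rightarrow> ('r, 'a) struct \<Rightarrow> ('r, 'a) struct" where
  "restr P \<Sigma> N = \<lparr>univ = {a \<in> univ N. [a] \<in> interp N P},
     interp = (\<lambda>R. if R \<in> dom \<Sigma> then interp N R \<inter> lists {a \<in> univ N. [a] \<in> interp N P} else {})\<rparr>"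

lemma univ_restr: "univ (restr P \<Sigma> N) = {a \<in> univ N. [a] \<in> interp N P}"
  by (simp add: restr_def)

lemma interp_restr:
  "interp (restr P \<Sigma> N) R = (if R \<in> dom \<Sigma> then interp N R \<inter> lists (univ (restr P \<Sigma> N)) else {})"
  by (simp add: restr_def)

primrec relat :: "'r \<Rightarrow> 'r fm \<Rightarrow> 'r fm" where
  "relat P (Equ i j) = Equ i j"
| "relat P (Rel R is) = Rel R is"
| "relat P (Neg \<phi>) = Neg (relat P \<phi>)"
| "relat P (Conj \<phi> \<psi>) = Conj (relat P \<phi>) (relat P \<psi>)"
| "relat P (Exists i \<phi>) = Exists i (Conj (Rel P [i]) (relat P \<phi>))"

lemma fv_relat [simp]: "fv (relat P \<phi>) = fv \<phi>"
  by (induction \<phi>) auto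

lemma in_lang_relat:
  "in_lang \<Sigma> \<phi> \<Longrightarrow> \<Sigma> \<subseteq>\<^sub>m \<Sigma>' \<Longrightarrow> \<Sigma>' P = Some 1 \<Longrightarrow> in_lang \<Sigma>' (relat P \<phi>)"
  by (induction \<phi>) (auto simp: map_le_def dom_def)

lemma sat_relat:
  "in_lang \<Sigma> \<phi> \<Longrightarrow> (\<And>j. j \<in> fv \<phi> \<Longrightarrow> s j \<in> univ (restr P \<Sigma> N)) \<Longrightarrow>
    sat N s (relat P \<phi>) \<longleftrightarrow> sat (restr P \<Sigma> N) s \<phi>"
proof (induction \<phi> arbitrary: s)
  case (Rel R "is")
  then have "map s is \<in> lists (univ (restr P \<Sigma> N))" "R \<in> dom \<Sigma>" by auto
  then show ?case by (simp add: interp_restr)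
next
  case (Neg \<phi>)
  then show ?case by simp
next
  case (Conj \<phi> \<psi>)
  then show ?case by simp
next
  case (Exists i \<phi>)
  have l: "in_lang \<Sigma> \<phi>" using Exists.prems by simp
  have IH: "sat N (s(i := a)) (relat P \<phi>) \<longleftrightarrow> sat (restr P \<Sigma> N) (s(i := a)) \<phi>"
    if "a \<in> univ (restr P \<Sigma> N)" for a
    by (rule Exists.IH[OF l]) (use Exists.prems that in auto)
  have "sat N s (relat P (Exists i \<phi>)) \<longleftrightarrow>
      (\<exists>a\<in>univ (restr P \<Sigma> N). sat N (s(i := a)) (relat P \<phi>))"
    by (auto simp: univ_restr)
  then show ?case using IH by simp
qed simp

lemma is_struct_restr:
  assumes "is_struct \<Sigma>' N" "\<Sigma> \<subseteq>\<^sub>m \<Sigma>'" "univ (restr P \<Sigma> N) \<noteq> {}"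
  shows "is_struct \<Sigma> (restr P \<Sigma> N)"
proof -
  have "\<Sigma> R = Some (length xs) \<and> set xs \<subseteq> univ (restr P \<Sigma> N)"
    if "xs \<in> interp (restr P \<Sigma> N) R" for xs R
  proof -
    have xs: "R \<in> dom \<Sigma>" "xs \<in> interp N R" "xs \<in> lists (univ (restr P \<Sigma> N))"
      using that by (auto simp: interp_restr split: if_splits)
    then have "\<Sigma>' R = Some (length xs)" using assms(1) by (auto simp: is_struct_def)
    then show ?thesis using xs assms(2) by (auto simp: map_le_def)
  qed
  then show ?thesis using assms(3) by (simp add: is_struct_def)
qed

lemma emb_restr:
  assumes emb: "elementary_embedding \<Sigma>' f N K" and sub: "\<Sigma> \<subseteq>\<^sub>m \<Sigma>'" and P: "\<Sigma>' P = Some 1"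
  shows "elementary_embedding \<Sigma> f (restr P \<Sigma> N) (restr P \<Sigma> K)"
proof -
  have U: "f a \<in> univ (restr P \<Sigma> K)" if a: "a \<in> univ (restr P \<Sigma> N)" for a
  proof -
    have "sat N (\<lambda>_. a) (Rel P [0]) \<longleftrightarrow> sat K (f \<circ> (\<lambda>_. a)) (Rel P [0])"
      using a P by (intro emb_sat[OF emb]) (auto simp: univ_restr)
    then show ?thesis using a emb_range[OF emb] by (auto simp: univ_restr)
  qed
  have "sat (restr P \<Sigma> N) s \<phi> \<longleftrightarrow> sat (restr P \<Sigma> K) (f \<circ> s) \<phi>"
    if \<phi>: "in_lang \<Sigma> \<phi>" and s: "range s \<subseteq> univ (restr P \<Sigma> N)" for s \<phi>
  proof -
    have sN: "s j \<in> univ (restr P \<Sigma> N)" for j using s by blast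
    have "sat (restr P \<Sigma> N) s \<phi> \<longleftrightarrow> sat N s (relat P \<phi>)"
      by (rule sat_relat[symmetric, OF \<phi> sN])
    also have "\<dots> \<longleftrightarrow> sat K (f \<circ> s) (relat P \<phi>)"
      using sN sN[of 0] by (intro emb_sat[OF emb in_lang_relat[OF \<phi> sub P]]) (auto simp: univ_restr)
    also have "\<dots> \<longleftrightarrow> sat (restr P \<Sigma> K) (f \<circ> s) \<phi>"
      by (rule sat_relat[OF \<phi>]) (simp add: U sN)
    finally show ?thesis .
  qed
  then show ?thesis using U by (auto simp: elementary_embedding_def)
qed

lemma iso_via_restr:
  assumes "iso_via f N K"
  shows "iso_via f (restr P \<Sigma> N) (restr P \<Sigma> K)"
proof -
  have b: "bij_betw f (univ N) (univ K)" and i: "\<And>R xs. set xs \<subseteq> univ N \<Longrightarrow> xs \<in> interp N R \<longleftrightarrow> map f xs \<in> interp K R"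
    using assms by (auto simp: iso_via_def)
  have U: "f a \<in> univ (restr P \<Sigma> K) \<longleftrightarrow> a \<in> univ (restr P \<Sigma> N)" if "a \<in> univ N" for a
    using i[of "[a]" P] that b by (auto simp: univ_restr bij_betw_def)
  have "f ` univ (restr P \<Sigma> N) = univ (restr P \<Sigma> K)"
  proof
    show "f ` univ (restr P \<Sigma> N) \<subseteq> univ (restr P \<Sigma> K)" using U by (auto simp: univ_restr)
    show "univ (restr P \<Sigma> K) \<subseteq> f ` univ (restr P \<Sigma> N)"
    proof
      fix y assume y: "y \<in> univ (restr P \<Sigma> K)"
      then obtain a where "a \<in> univ N" "y = f a" using b by (auto simp: univ_restr bij_betw_def)
      then show "y \<in> f ` univ (restr P \<Sigma> N)" using U y by blast
    qed
  qed
  moreover have "inj_on f (univ (restr P \<Sigma> N))"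
    using b by (auto simp: bij_betw_def univ_restr inj_on_def)
  moreover have "xs \<in> interp (restr P \<Sigma> N) R \<longleftrightarrow> map f xs \<in> interp (restr P \<Sigma> K) R"
    if xs: "set xs \<subseteq> univ (restr P \<Sigma> N)" for xs R
  proof -
    have xsN: "set xs \<subseteq> univ N" using xs by (auto simp: univ_restr)
    moreover have "map f xs \<in> lists (univ (restr P \<Sigma> K))"
      using xs xsN U by (auto simp: subset_iff)
    ultimately show ?thesis using xs i[of xs R] by (auto simp: interp_restr)
  qed
  ultimately show ?thesis by (simp add: iso_via_def bij_betw_def)
qed

lemma iso_restr: "iso N K \<Longrightarrow> iso (restr P \<Sigma> N) (restr P \<Sigma> K)"
  unfolding iso_iff by (elim exE) (rule exI, rule iso_via_restr)

text \<open>Membership in \<open>P\<close> is part of the type, so the corresponding coordinates of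
  \<open>d\<close> lie in the \<open>P\<close>-part of \<open>K\<close>. Relativized formulas then
  read off the types of the subtuples indexed by \<open>I\<close>.\<close>

lemma tp_restr:
  fixes N :: "('r, 'a) struct" and K :: "('r, 'b) struct"
  assumes tp: "tp \<Sigma>' N c = tp \<Sigma>' K d" and sub: "\<Sigma> \<subseteq>\<^sub>m \<Sigma>'" and P: "\<Sigma>' P = Some 1"
    and I: "set I \<subseteq> {..<length c}" and c: "\<And>i. i \<in> set I \<Longrightarrow> c ! i \<in> univ (restr P \<Sigma> N)"
    and d: "d \<in> lists (univ K)"
  shows "tp \<Sigma> (restr P \<Sigma> N) (map ((!) c) I) = tp \<Sigma> (restr P \<Sigma> K) (map ((!) d) I)"
    and "\<And>i. i \<in> set I \<Longrightarrow> d ! i \<in> univ (restr P \<Sigma> K)"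
proof -
  have len: "length c = length d" using tp by (rule tp_length)
  show d': "d ! i \<in> univ (restr P \<Sigma> K)" if "i \<in> set I" for i
  proof -
    have "i < length c" using I that by auto
    then have "sat N (\<lambda>j. c ! i) (Rel P [0]) \<longleftrightarrow> sat K (\<lambda>j. d ! i) (Rel P [0])"
      by (intro tp_sat[OF tp]) (auto simp: P)
    then show ?thesis using c[OF that] d len \<open>i < length c\<close> nth_mem by (auto simp: univ_restr)
  qed
  show "tp \<Sigma> (restr P \<Sigma> N) (map ((!) c) I) = tp \<Sigma> (restr P \<Sigma> K) (map ((!) d) I)"
  proof (rule tp_eqI)
    fix \<phi> assume "\<phi> \<in> formulas \<Sigma> (length (map ((!) c) I))"
    then have \<phi>: "in_lang \<Sigma> \<phi>" and fv: "fv \<phi> \<subseteq> {..<length I}" by (auto simp: formulas_def)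
    then have i: "i \<in> fv \<phi> \<Longrightarrow> I ! i \<in> set I" for i by auto
    have "sat (restr P \<Sigma> N) ((!) (map ((!) c) I)) \<phi> \<longleftrightarrow> sat (restr P \<Sigma> N) (\<lambda>i. c ! (I ! i)) \<phi>"
      by (rule sat_cong) (use fv in auto)
    also have "\<dots> \<longleftrightarrow> sat N (\<lambda>i. c ! (I ! i)) (relat P \<phi>)"
      by (rule sat_relat[symmetric, OF \<phi>]) (use i c in auto)
    also have "\<dots> \<longleftrightarrow> sat K (\<lambda>i. d ! (I ! i)) (relat P \<phi>)"
      by (rule tp_sat[OF tp in_lang_relat[OF \<phi> sub P]]) (use i I in auto)
    also have "\<dots> \<longleftrightarrow> sat (restr P \<Sigma> K) (\<lambda>i. d ! (I ! i)) \<phi>"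
      by (rule sat_relat[OF \<phi>]) (use i d' in auto)
    also have "\<dots> \<longleftrightarrow> sat (restr P \<Sigma> K) ((!) (map ((!) d) I)) \<phi>"
      by (rule sat_cong) (use fv in auto)
    finally show "sat (restr P \<Sigma> N) ((!) (map ((!) c) I)) \<phi> \<longleftrightarrow> sat (restr P \<Sigma> K) ((!) (map ((!) d) I)) \<phi>" .
  qed simp
qed

section \<open>Formulas over disjoint unions\<close>

definition verum :: "'r fm" where
  "verum = Exists 0 (Equ 0 0)"

lemma verum_simps [simp]: "fv verum = {}" "in_lang \<Sigma> verum" "univ M \<noteq> {} \<Longrightarrow> sat M s verum"
  by (auto simp: verum_def)

text \<open>A list of pairs stands for the disjunction of the conjunctions of a statement about the first
  component with a statement about the second.\<close>

definition sat_pairs :: "('r, 'a) struct \<Rightarrow> (nat \<Rightarrow> 'a) \<Rightarrow> ('r, 'b) struct \<Rightarrow> (nat \<Rightarrow> 'b) \<Rightarrow>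
    ('r fm \<times> 'r fm) list \<Rightarrow> bool" where
  "sat_pairs A s B t K \<longleftrightarrow> (\<exists>p\<in>set K. sat A s (fst p) \<and> sat B t (snd p))"

text \<open>De Morgan followed by distribution: each pair must fail in its first or in its second
  component, and the result has one pair for every way of choosing the failing components.\<close>

primrec neg_pairs :: "('r fm \<times> 'r fm) list \<Rightarrow> ('r fm \<times> 'r fm) list" where
  "neg_pairs [] = [(verum, verum)]"
| "neg_pairs (p # K) = map (\<lambda>q. (Conj (Neg (fst p)) (fst q), snd q)) (neg_pairs K) @
     map (\<lambda>q. (fst q, Conj (Neg (snd p)) (snd q))) (neg_pairs K)"

lemma sat_neg_pairs:
  "univ A \<noteq> {} \<Longrightarrow> univ B \<noteq> {} \<Longrightarrow> sat_pairs A s B t (neg_pairs K) \<longleftrightarrow> \<not> sat_pairs A s B t K"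
proof (induction K)
  case (Cons p K)
  have "sat_pairs A s B t (neg_pairs (p # K)) \<longleftrightarrow>
      (\<not> sat A s (fst p) \<or> \<not> sat B t (snd p)) \<and> sat_pairs A s B t (neg_pairs K)"
    unfolding sat_pairs_def by (simp add: bex_Un) blast
  moreover have "sat_pairs A s B t (p # K) \<longleftrightarrow>
      sat A s (fst p) \<and> sat B t (snd p) \<or> sat_pairs A s B t K"
    unfolding sat_pairs_def by simp
  ultimately show ?case using Cons by blast
qed (simp add: sat_pairs_def)

text \<open>The function \<open>\<sigma>\<close> tells which variables take their values in the first component.\<close>

primrec split_fm :: "'r \<Rightarrow> 'r \<Rightarrow> 'r lang \<Rightarrow> 'r fm \<Rightarrow> (nat \<Rightarrow> bool) \<Rightarrow> ('r fm \<times> 'r fm) list" where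
  "split_fm P\<^sub>1 P\<^sub>2 \<Sigma>\<^sub>1 (Equ i j) \<sigma> =
     (if \<sigma> i \<and> \<sigma> j then [(Equ i j, verum)] else if \<not> \<sigma> i \<and> \<not> \<sigma> j then [(verum, Equ i j)] else [])"
| "split_fm P\<^sub>1 P\<^sub>2 \<Sigma>\<^sub>1 (Rel R is) \<sigma> =
     (if R = P\<^sub>1 then (if \<forall>i\<in>set is. \<sigma> i then [(verum, verum)] else [])
      else if R = P\<^sub>2 then (if \<forall>i\<in>set is. \<not> \<sigma> i then [(verum, verum)] else [])
      else if R \<in> dom \<Sigma>\<^sub>1 then (if \<forall>i\<in>set is. \<sigma> i then [(Rel R is, verum)] else [])
      else (if \<forall>i\<in>set is. \<not> \<sigma> i then [(verum, Rel R is)] else []))"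
| "split_fm P\<^sub>1 P\<^sub>2 \<Sigma>\<^sub>1 (Neg \<phi>) \<sigma> = neg_pairs (split_fm P\<^sub>1 P\<^sub>2 \<Sigma>\<^sub>1 \<phi> \<sigma>)"
| "split_fm P\<^sub>1 P\<^sub>2 \<Sigma>\<^sub>1 (Conj \<phi> \<psi>) \<sigma> =
     [(Conj (fst p) (fst q), Conj (snd p) (snd q)). p \<leftarrow> split_fm P\<^sub>1 P\<^sub>2 \<Sigma>\<^sub>1 \<phi> \<sigma>, q \<leftarrow> split_fm P\<^sub>1 P\<^sub>2 \<Sigma>\<^sub>1 \<psi> \<sigma>]"
| "split_fm P\<^sub>1 P\<^sub>2 \<Sigma>\<^sub>1 (Exists i \<phi>) \<sigma> =
     map (\<lambda>p. (Exists i (fst p), snd p)) (split_fm P\<^sub>1 P\<^sub>2 \<Sigma>\<^sub>1 \<phi> (\<sigma>(i := True))) @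
     map (\<lambda>p. (fst p, Exists i (snd p))) (split_fm P\<^sub>1 P\<^sub>2 \<Sigma>\<^sub>1 \<phi> (\<sigma>(i := False)))"

locale two_languages =
  fixes \<Sigma>\<^sub>1 \<Sigma>\<^sub>2 :: "'r lang" and P\<^sub>1 P\<^sub>2 :: 'r
  assumes disj: "dom \<Sigma>\<^sub>1 \<inter> dom \<Sigma>\<^sub>2 = {}"
    and P\<^sub>1: "P\<^sub>1 \<notin> dom \<Sigma>\<^sub>1 \<union> dom \<Sigma>\<^sub>2" and P\<^sub>2: "P\<^sub>2 \<notin> dom \<Sigma>\<^sub>1 \<union> dom \<Sigma>\<^sub>2" and P_neq: "P\<^sub>1 \<noteq> P\<^sub>2"
begin

abbreviation \<Sigma> :: "'r lang" where "\<Sigma> \<equiv> dunion_lang P\<^sub>1 P\<^sub>2 \<Sigma>\<^sub>1 \<Sigma>\<^sub>2"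

abbreviation r\<^sub>1 :: "('r, 'a) struct \<Rightarrow> ('r, 'a) struct" where "r\<^sub>1 \<equiv> restr P\<^sub>1 \<Sigma>\<^sub>1"
abbreviation r\<^sub>2 :: "('r, 'a) struct \<Rightarrow> ('r, 'a) struct" where "r\<^sub>2 \<equiv> restr P\<^sub>2 \<Sigma>\<^sub>2"

lemma \<Sigma>_simps: "\<Sigma> P\<^sub>1 = Some 1" "\<Sigma> P\<^sub>2 = Some 1"
  "R \<in> dom \<Sigma>\<^sub>1 \<Longrightarrow> \<Sigma> R = \<Sigma>\<^sub>1 R" "R \<in> dom \<Sigma>\<^sub>2 \<Longrightarrow> \<Sigma> R = \<Sigma>\<^sub>2 R"
  using disj P\<^sub>1 P\<^sub>2 P_neq by (auto simp: dunion_lang_def map_add_def split: option.splits)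

lemma dom_\<Sigma>: "dom \<Sigma> = insert P\<^sub>1 (insert P\<^sub>2 (dom \<Sigma>\<^sub>1 \<union> dom \<Sigma>\<^sub>2))"
  by (auto simp: dunion_lang_def)

lemma \<Sigma>_sub: "\<Sigma>\<^sub>1 \<subseteq>\<^sub>m \<Sigma>" "\<Sigma>\<^sub>2 \<subseteq>\<^sub>m \<Sigma>"
  by (simp_all add: map_le_def \<Sigma>_simps)

text \<open>An intrinsic description of disjoint unions up to isomorphism. It applies to models on
  \<open>nat\<close>, which are not literally of the form \<open>dunion\<close>, and apart from
  \<open>is_struct\<close> it is expressible by sentences.\<close>

definition decomposed :: "('r, 'a) struct \<Rightarrow> bool" where
  "decomposed N \<longleftrightarrow> is_struct \<Sigma> N \<and> univ N = univ (r\<^sub>1 N) \<union> univ (r\<^sub>2 N) \<and>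
     univ (r\<^sub>1 N) \<inter> univ (r\<^sub>2 N) = {} \<and> univ (r\<^sub>1 N) \<noteq> {} \<and> univ (r\<^sub>2 N) \<noteq> {} \<and>
     (\<forall>R\<in>dom \<Sigma>\<^sub>1. interp N R \<subseteq> lists (univ (r\<^sub>1 N))) \<and>
     (\<forall>R\<in>dom \<Sigma>\<^sub>2. interp N R \<subseteq> lists (univ (r\<^sub>2 N)))"

lemma decomposedD:
  assumes "decomposed N"
  shows "is_struct \<Sigma> N" "univ N = univ (r\<^sub>1 N) \<union> univ (r\<^sub>2 N)"
    "a \<in> univ (r\<^sub>1 N) \<Longrightarrow> a \<in> univ (r\<^sub>2 N) \<Longrightarrow> False" "univ (r\<^sub>1 N) \<noteq> {}" "univ (r\<^sub>2 N) \<noteq> {}"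
    "R \<in> dom \<Sigma>\<^sub>1 \<Longrightarrow> xs \<in> interp N R \<longleftrightarrow> xs \<in> interp (r\<^sub>1 N) R"
    "R \<in> dom \<Sigma>\<^sub>2 \<Longrightarrow> xs \<in> interp N R \<longleftrightarrow> xs \<in> interp (r\<^sub>2 N) R"
proof -
  show "R \<in> dom \<Sigma>\<^sub>1 \<Longrightarrow> xs \<in> interp N R \<longleftrightarrow> xs \<in> interp (r\<^sub>1 N) R"
    using assms unfolding decomposed_def interp_restr[of P\<^sub>1]
    by (metis IntD1 IntI subsetD)
  show "R \<in> dom \<Sigma>\<^sub>2 \<Longrightarrow> xs \<in> interp N R \<longleftrightarrow> xs \<in> interp (r\<^sub>2 N) R"
    using assms unfolding decomposed_def interp_restr[of P\<^sub>2]
    by (metis IntD1 IntI subsetD)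
qed (use assms in \<open>auto simp: decomposed_def\<close>)

lemma is_struct_components:
  assumes "decomposed N"
  shows "is_struct \<Sigma>\<^sub>1 (r\<^sub>1 N)" "is_struct \<Sigma>\<^sub>2 (r\<^sub>2 N)"
  using is_struct_restr[OF decomposedD(1)[OF assms] \<Sigma>_sub(1)] is_struct_restr[OF decomposedD(1)[OF assms] \<Sigma>_sub(2)]
    decomposedD(4,5)[OF assms] by blast+

lemma interp_P:
  assumes "a \<in> univ N"
  shows "[a] \<in> interp N P\<^sub>1 \<longleftrightarrow> a \<in> univ (r\<^sub>1 N)" "[a] \<in> interp N P\<^sub>2 \<longleftrightarrow> a \<in> univ (r\<^sub>2 N)"
  using assms by (auto simp: univ_restr)

text \<open>Feferman-Vaught for two components. A witness lies in one of the two parts, which sets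
  \<open>\<sigma>\<close> at the quantified variable. Separate assignments \<open>s\<^sub>1\<close>
  and \<open>s\<^sub>2\<close> allow one component to be updated while the other stays
  fixed.\<close>

lemma sat_split_fm:
  assumes N: "decomposed N"
  shows "in_lang \<Sigma> \<phi> \<Longrightarrow>
    (\<And>i. if \<sigma> i then s i = s\<^sub>1 i \<and> s i \<in> univ (r\<^sub>1 N) else s i = s\<^sub>2 i \<and> s i \<in> univ (r\<^sub>2 N)) \<Longrightarrow>
    sat N s \<phi> \<longleftrightarrow> sat_pairs (r\<^sub>1 N) s\<^sub>1 (r\<^sub>2 N) s\<^sub>2 (split_fm P\<^sub>1 P\<^sub>2 \<Sigma>\<^sub>1 \<phi> \<sigma>)"
proof (induction \<phi> arbitrary: s s\<^sub>1 s\<^sub>2 \<sigma>)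
  case (Equ i j)
  show ?case
    using Equ.prems(2)[of i] Equ.prems(2)[of j] decomposedD[OF N]
    by (auto simp: sat_pairs_def split: if_splits)
next
  case (Rel R "is")
  have in1: "s i \<in> univ (r\<^sub>1 N) \<longleftrightarrow> \<sigma> i" and in2: "s i \<in> univ (r\<^sub>2 N) \<longleftrightarrow> \<not> \<sigma> i"
    and inN: "s i \<in> univ N" for i
    using Rel.prems(2)[of i] decomposedD(2,3)[OF N] by (auto split: if_splits)
  have R: "\<Sigma> R = Some (length is)" using Rel.prems by simp
  then have "R \<in> dom \<Sigma>" by blast
  then consider "R = P\<^sub>1" | "R = P\<^sub>2" | "R \<in> dom \<Sigma>\<^sub>1" "R \<noteq> P\<^sub>1" "R \<noteq> P\<^sub>2"
    | "R \<in> dom \<Sigma>\<^sub>2" "R \<noteq> P\<^sub>1" "R \<noteq> P\<^sub>2" "R \<notin> dom \<Sigma>\<^sub>1"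
    unfolding dom_\<Sigma> using disj by blast
  then show ?case
  proof cases
    case 1
    then have "length is = 1" using R \<Sigma>_simps(1,2) by simp
    then obtain i where "is = [i]" by (auto simp: length_Suc_conv)
    then show ?thesis using \<open>R = P\<^sub>1\<close> interp_P(1)[OF inN] in1 decomposedD(4,5)[OF N]
      by (auto simp: sat_pairs_def)
  next
    case 2
    then have "length is = 1" using R \<Sigma>_simps(1,2) by simp
    then obtain i where "is = [i]" by (auto simp: length_Suc_conv)
    then show ?thesis using \<open>R = P\<^sub>2\<close> P_neq interp_P(2)[OF inN] in2 decomposedD(4,5)[OF N]
      by (auto simp: sat_pairs_def)
  next
    case 3
    show ?thesis
    proof (cases "\<forall>i\<in>set is. \<sigma> i")
      case True
      then have "map s is = map s\<^sub>1 is" using Rel.prems(2) by (auto split: if_splits)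
      then show ?thesis using 3 True decomposedD(4-6)[OF N]
        by (simp add: sat_pairs_def del: map_eq_conv)
    next
      case False
      then have "map s is \<notin> interp (r\<^sub>1 N) R" using in1 by (auto simp: interp_restr)
      then show ?thesis using 3 False decomposedD(6)[OF N] by (auto simp: sat_pairs_def)
    qed
  next
    case 4
    show ?thesis
    proof (cases "\<forall>i\<in>set is. \<not> \<sigma> i")
      case True
      then have "map s is = map s\<^sub>2 is" using Rel.prems(2) by (auto split: if_splits)
      then show ?thesis using 4 True decomposedD(4,5,7)[OF N]
        by (simp add: sat_pairs_def del: map_eq_conv)
    next
      case False
      then have "map s is \<notin> interp (r\<^sub>2 N) R" using in2 by (auto simp: interp_restr)
      then show ?thesis using 4 False decomposedD(7)[OF N] by (auto simp: sat_pairs_def)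
    qed
  qed
next
  case (Neg \<phi>)
  have l: "in_lang \<Sigma> \<phi>" using Neg.prems by simp
  show ?case
    using Neg.IH[OF l Neg.prems(2)] sat_neg_pairs[OF decomposedD(4,5)[OF N]] by simp
next
  case (Conj \<phi> \<psi>)
  have l: "in_lang \<Sigma> \<phi>" "in_lang \<Sigma> \<psi>" using Conj.prems by simp_all
  have eq: "sat N s (Conj \<phi> \<psi>) \<longleftrightarrow>
      sat_pairs (r\<^sub>1 N) s\<^sub>1 (r\<^sub>2 N) s\<^sub>2 (split_fm P\<^sub>1 P\<^sub>2 \<Sigma>\<^sub>1 \<phi> \<sigma>) \<and>
      sat_pairs (r\<^sub>1 N) s\<^sub>1 (r\<^sub>2 N) s\<^sub>2 (split_fm P\<^sub>1 P\<^sub>2 \<Sigma>\<^sub>1 \<psi> \<sigma>)"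
    using Conj.IH(1)[OF l(1) Conj.prems(2)] Conj.IH(2)[OF l(2) Conj.prems(2)] by simp
  show ?case unfolding eq sat_pairs_def by simp blast
next
  case (Exists i \<phi>)
  have l: "in_lang \<Sigma> \<phi>" using Exists.prems by simp
  have IH1: "sat N (s(i := a)) \<phi> \<longleftrightarrow>
      sat_pairs (r\<^sub>1 N) (s\<^sub>1(i := a)) (r\<^sub>2 N) s\<^sub>2 (split_fm P\<^sub>1 P\<^sub>2 \<Sigma>\<^sub>1 \<phi> (\<sigma>(i := True)))"
    if a: "a \<in> univ (r\<^sub>1 N)" for a
  proof (rule Exists.IH[OF l])
    show "if (\<sigma>(i := True)) j then (s(i := a)) j = (s\<^sub>1(i := a)) j \<and> (s(i := a)) j \<in> univ (r\<^sub>1 N)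
      else (s(i := a)) j = s\<^sub>2 j \<and> (s(i := a)) j \<in> univ (r\<^sub>2 N)" for j
      using Exists.prems(2)[of j] a by (cases "j = i") auto
  qed
  have IH2: "sat N (s(i := a)) \<phi> \<longleftrightarrow>
      sat_pairs (r\<^sub>1 N) s\<^sub>1 (r\<^sub>2 N) (s\<^sub>2(i := a)) (split_fm P\<^sub>1 P\<^sub>2 \<Sigma>\<^sub>1 \<phi> (\<sigma>(i := False)))"
    if a: "a \<in> univ (r\<^sub>2 N)" for a
  proof (rule Exists.IH[OF l])
    show "if (\<sigma>(i := False)) j then (s(i := a)) j = s\<^sub>1 j \<and> (s(i := a)) j \<in> univ (r\<^sub>1 N)
      else (s(i := a)) j = (s\<^sub>2(i := a)) j \<and> (s(i := a)) j \<in> univ (r\<^sub>2 N)" for j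
      using Exists.prems(2)[of j] a by (cases "j = i") auto
  qed
  have "sat N s (Exists i \<phi>) \<longleftrightarrow>
      (\<exists>a\<in>univ (r\<^sub>1 N). sat N (s(i := a)) \<phi>) \<or> (\<exists>a\<in>univ (r\<^sub>2 N). sat N (s(i := a)) \<phi>)"
    using decomposedD(2)[OF N] by auto
  also have "\<dots> \<longleftrightarrow> sat_pairs (r\<^sub>1 N) s\<^sub>1 (r\<^sub>2 N) s\<^sub>2 (split_fm P\<^sub>1 P\<^sub>2 \<Sigma>\<^sub>1 (Exists i \<phi>) \<sigma>)"
    by (simp add: IH1 IH2 sat_pairs_def bex_Un del: fun_upd_apply) blast
  finally show ?case .
qed

lemma neg_pairs_lang:
  assumes "\<forall>p\<in>set K. in_lang \<Sigma>\<^sub>1 (fst p) \<and> in_lang \<Sigma>\<^sub>2 (snd p) \<and> fv (fst p) \<subseteq> A \<and> fv (snd p) \<subseteq> B"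
  shows "\<forall>p\<in>set (neg_pairs K). in_lang \<Sigma>\<^sub>1 (fst p) \<and> in_lang \<Sigma>\<^sub>2 (snd p) \<and> fv (fst p) \<subseteq> A \<and> fv (snd p) \<subseteq> B"
  using assms
proof (induction K)
  case (Cons p K)
  then show ?case by (simp add: ball_Un)
qed simp

lemma split_fm_lang:
  "in_lang \<Sigma> \<phi> \<Longrightarrow> \<forall>p\<in>set (split_fm P\<^sub>1 P\<^sub>2 \<Sigma>\<^sub>1 \<phi> \<sigma>). in_lang \<Sigma>\<^sub>1 (fst p) \<and> in_lang \<Sigma>\<^sub>2 (snd p) \<and>
     fv (fst p) \<subseteq> {i \<in> fv \<phi>. \<sigma> i} \<and> fv (snd p) \<subseteq> {i \<in> fv \<phi>. \<not> \<sigma> i}"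
proof (induction \<phi> arbitrary: \<sigma>)
  case (Rel R "is")
  then have "\<Sigma> R = Some (length is)" by simp
  moreover from this have "R \<in> dom \<Sigma>" by blast
  moreover have "in_lang \<Sigma>\<^sub>1 (Rel R is)" if "R \<in> dom \<Sigma>\<^sub>1"
    using calculation(1) \<Sigma>_simps(3)[OF that] by simp
  moreover have "in_lang \<Sigma>\<^sub>2 (Rel R is)" if "R \<in> dom \<Sigma>\<^sub>2"
    using calculation(1) \<Sigma>_simps(4)[OF that] by simp
  ultimately show ?case unfolding dom_\<Sigma> by (simp del: in_lang.simps) blast
next
  case (Neg \<phi>)
  have l: "in_lang \<Sigma> \<phi>" using Neg.prems by simp
  show ?case using neg_pairs_lang[OF Neg.IH[OF l]] by simp
next
  case (Conj \<phi> \<psi>)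
  then show ?case by fastforce
next
  case (Exists i \<phi>)
  have l: "in_lang \<Sigma> \<phi>" using Exists.prems by simp
  show ?case using Exists.IH[OF l, of "\<sigma>(i := True)"] Exists.IH[OF l, of "\<sigma>(i := False)"]
    by (fastforce split: if_splits)
qed auto

text \<open>Both sides split into the same list of pairs, because \<open>split_fm\<close> depends
  only on the formula and on the distribution \<open>\<sigma>\<close> of its variables, not on the
  structure.\<close>

lemma sat_transfer:
  fixes N :: "('r, 'a) struct" and K :: "('r, 'b) struct"
  assumes N: "decomposed N" and K: "decomposed K" and \<phi>: "in_lang \<Sigma> \<phi>"
    and s: "\<And>i. i \<in> fv \<phi> \<Longrightarrow> if \<sigma> i then s i \<in> univ (r\<^sub>1 N) else s i \<in> univ (r\<^sub>2 N)"
    and t: "\<And>i. i \<in> fv \<phi> \<Longrightarrow> if \<sigma> i then t i \<in> univ (r\<^sub>1 K) else t i \<in> univ (r\<^sub>2 K)"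
    and eq\<^sub>1: "\<And>\<alpha>. in_lang \<Sigma>\<^sub>1 \<alpha> \<Longrightarrow> fv \<alpha> \<subseteq> {i \<in> fv \<phi>. \<sigma> i} \<Longrightarrow> sat (r\<^sub>1 N) s \<alpha> \<longleftrightarrow> sat (r\<^sub>1 K) t \<alpha>"
    and eq\<^sub>2: "\<And>\<alpha>. in_lang \<Sigma>\<^sub>2 \<alpha> \<Longrightarrow> fv \<alpha> \<subseteq> {i \<in> fv \<phi>. \<not> \<sigma> i} \<Longrightarrow> sat (r\<^sub>2 N) s \<alpha> \<longleftrightarrow> sat (r\<^sub>2 K) t \<alpha>"
  shows "sat N s \<phi> \<longleftrightarrow> sat K t \<phi>"
proof -
  obtain d e where d: "d \<in> univ (r\<^sub>1 N)" and e: "e \<in> univ (r\<^sub>1 K)"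
    using decomposedD(4)[OF N] decomposedD(4)[OF K] by blast
  \<comment> \<open>\<open>sat_split_fm\<close> constrains all variables, also those not in
    \<open>\<phi>\<close>. These are sent to the first component, with the values \<open>d\<close>
    and \<open>e\<close>.\<close>
  define \<tau> where "\<tau> i \<longleftrightarrow> i \<in> fv \<phi> \<longrightarrow> \<sigma> i" for i
  define s' where "s' i = (if i \<in> fv \<phi> then s i else d)" for i
  define t' where "t' i = (if i \<in> fv \<phi> then t i else e)" for i
  let ?K = "split_fm P\<^sub>1 P\<^sub>2 \<Sigma>\<^sub>1 \<phi> \<tau>"
  have "sat N s \<phi> \<longleftrightarrow> sat N s' \<phi>" by (rule sat_cong) (simp add: s'_def)
  also have "\<dots> \<longleftrightarrow> sat_pairs (r\<^sub>1 N) s' (r\<^sub>2 N) s' ?K"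
    by (rule sat_split_fm[OF N \<phi>]) (use s d in \<open>auto simp: s'_def \<tau>_def split: if_splits\<close>)
  also have "\<dots> \<longleftrightarrow> sat_pairs (r\<^sub>1 K) t' (r\<^sub>2 K) t' ?K"
  proof -
    have "sat (r\<^sub>1 N) s' \<alpha> \<and> sat (r\<^sub>2 N) s' \<beta> \<longleftrightarrow> sat (r\<^sub>1 K) t' \<alpha> \<and> sat (r\<^sub>2 K) t' \<beta>"
      if "(\<alpha>, \<beta>) \<in> set ?K" for \<alpha> \<beta>
    proof -
      have lang: "in_lang \<Sigma>\<^sub>1 \<alpha>" "in_lang \<Sigma>\<^sub>2 \<beta>" "fv \<alpha> \<subseteq> {i \<in> fv \<phi>. \<sigma> i}" "fv \<beta> \<subseteq> {i \<in> fv \<phi>. \<not> \<sigma> i}"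
        using split_fm_lang[OF \<phi>, of \<tau>] that by (auto simp: \<tau>_def dest!: bspec[of _ _ "(\<alpha>, \<beta>)"])
      have "sat (r\<^sub>1 N) s' \<alpha> \<longleftrightarrow> sat (r\<^sub>1 N) s \<alpha>" "sat (r\<^sub>2 N) s' \<beta> \<longleftrightarrow> sat (r\<^sub>2 N) s \<beta>"
        "sat (r\<^sub>1 K) t' \<alpha> \<longleftrightarrow> sat (r\<^sub>1 K) t \<alpha>" "sat (r\<^sub>2 K) t' \<beta> \<longleftrightarrow> sat (r\<^sub>2 K) t \<beta>"
        by (rule sat_cong; use lang in \<open>auto simp: s'_def t'_def\<close>)+
      then show ?thesis using eq\<^sub>1[OF lang(1,3)] eq\<^sub>2[OF lang(2,4)] by simp
    qed
    then show ?thesis unfolding sat_pairs_def by (intro bex_cong) auto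
  qed
  also have "\<dots> \<longleftrightarrow> sat K t' \<phi>"
    by (rule sat_split_fm[OF K \<phi>, symmetric]) (use t e in \<open>auto simp: t'_def \<tau>_def split: if_splits\<close>)
  also have "\<dots> \<longleftrightarrow> sat K t \<phi>" by (rule sat_cong) (simp add: t'_def)
  finally show ?thesis .
qed

end

section \<open>Gluing structures\<close>

text \<open>One construction for both the disjoint union on the sum type, by \<open>Inl\<close> and
  \<open>Inr\<close>, and its coding into \<open>nat\<close>, by even and odd numbers.\<close>

definition glue :: "'r \<Rightarrow> 'r \<Rightarrow> ('a \<Rightarrow> 'c) \<Rightarrow> ('b \<Rightarrow> 'c) \<Rightarrow> ('r, 'a) struct \<Rightarrow> ('r, 'b) struct \<Rightarrow>
    ('r, 'c) struct" where
  "glue P\<^sub>1 P\<^sub>2 f g M\<^sub>1 M\<^sub>2 =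
     \<lparr>univ = f ` univ M\<^sub>1 \<union> g ` univ M\<^sub>2,
      interp = (\<lambda>R. if R = P\<^sub>1 then {[f a] |a. a \<in> univ M\<^sub>1}
                    else if R = P\<^sub>2 then {[g b] |b. b \<in> univ M\<^sub>2}
                    else map f ` interp M\<^sub>1 R \<union> map g ` interp M\<^sub>2 R)\<rparr>"

lemma is_struct_interp_dom: "is_struct \<Sigma> M \<Longrightarrow> R \<notin> dom \<Sigma> \<Longrightarrow> interp M R = {}"
  by (auto simp: is_struct_def)

lemma dunion_eq_glue: "dunion P\<^sub>1 P\<^sub>2 M\<^sub>1 M\<^sub>2 = glue P\<^sub>1 P\<^sub>2 Inl Inr M\<^sub>1 M\<^sub>2"
  by (simp add: dunion_def glue_def Plus_def)

abbreviation even_code :: "nat \<Rightarrow> nat" where "even_code x \<equiv> 2 * x"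
abbreviation odd_code :: "nat \<Rightarrow> nat" where "odd_code x \<equiv> Suc (2 * x)"

context two_languages
begin

lemma is_struct_glue:
  assumes M: "is_struct \<Sigma>\<^sub>1 M\<^sub>1" "is_struct \<Sigma>\<^sub>2 M\<^sub>2"
  shows "is_struct \<Sigma> (glue P\<^sub>1 P\<^sub>2 f g M\<^sub>1 M\<^sub>2)"
proof -
  have "\<Sigma> R = Some (length xs) \<and> set xs \<subseteq> f ` univ M\<^sub>1 \<union> g ` univ M\<^sub>2"
    if xs: "xs \<in> interp (glue P\<^sub>1 P\<^sub>2 f g M\<^sub>1 M\<^sub>2) R" for R xs
  proof -
    consider "R = P\<^sub>1" "xs \<in> {[f a] |a. a \<in> univ M\<^sub>1}" | "R = P\<^sub>2" "xs \<in> {[g b] |b. b \<in> univ M\<^sub>2}"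
      | ys where "ys \<in> interp M\<^sub>1 R" "xs = map f ys" | ys where "ys \<in> interp M\<^sub>2 R" "xs = map g ys"
      using xs by (auto simp: glue_def split: if_splits)
    then show ?thesis
    proof cases
      case 3
      then have "\<Sigma>\<^sub>1 R = Some (length ys)" "set ys \<subseteq> univ M\<^sub>1" using M(1) by (auto simp: is_struct_def)
      then show ?thesis using 3 \<Sigma>_simps(3)[of R] by auto
    next
      case 4
      then have "\<Sigma>\<^sub>2 R = Some (length ys)" "set ys \<subseteq> univ M\<^sub>2" using M(2) by (auto simp: is_struct_def)
      then show ?thesis using 4 \<Sigma>_simps(4)[of R] by auto
    qed (auto simp: \<Sigma>_simps(1,2))
  qed
  moreover have "univ M\<^sub>1 \<noteq> {}" using M(1) by (simp add: is_struct_def)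
  ultimately show ?thesis by (simp add: is_struct_def) (simp add: glue_def)
qed

lemma restr_glue:
  assumes M: "is_struct \<Sigma>\<^sub>1 M\<^sub>1" "is_struct \<Sigma>\<^sub>2 M\<^sub>2"
  shows "r\<^sub>1 (glue P\<^sub>1 P\<^sub>2 f g M\<^sub>1 M\<^sub>2) = copy f M\<^sub>1" and "r\<^sub>2 (glue P\<^sub>1 P\<^sub>2 f g M\<^sub>1 M\<^sub>2) = copy g M\<^sub>2"
proof -
  let ?N = "glue P\<^sub>1 P\<^sub>2 f g M\<^sub>1 M\<^sub>2"
  have U1: "univ (r\<^sub>1 ?N) = f ` univ M\<^sub>1" unfolding univ_restr by (auto simp: glue_def)
  have U2: "univ (r\<^sub>2 ?N) = g ` univ M\<^sub>2" unfolding univ_restr using P_neq by (auto simp: glue_def)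
  have "interp (r\<^sub>1 ?N) R = map f ` interp M\<^sub>1 R" for R
  proof (cases "R \<in> dom \<Sigma>\<^sub>1")
    case True
    then have "R \<notin> dom \<Sigma>\<^sub>2" "R \<noteq> P\<^sub>1" "R \<noteq> P\<^sub>2" using disj P\<^sub>1 P\<^sub>2 by blast+
    then have "interp ?N R = map f ` interp M\<^sub>1 R"
      using is_struct_interp_dom[OF M(2)] by (simp add: glue_def)
    moreover have "map f ` interp M\<^sub>1 R \<subseteq> lists (f ` univ M\<^sub>1)" using M(1) by (force simp: is_struct_def)
    ultimately show ?thesis using True unfolding interp_restr U1 by auto
  next
    case False
    then show ?thesis using is_struct_interp_dom[OF M(1)] by (simp add: interp_restr)
  qed
  then show "r\<^sub>1 ?N = copy f M\<^sub>1" using U1 by (intro struct.equality) (auto simp: copy_def)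
  have "interp (r\<^sub>2 ?N) R = map g ` interp M\<^sub>2 R" for R
  proof (cases "R \<in> dom \<Sigma>\<^sub>2")
    case True
    then have "R \<notin> dom \<Sigma>\<^sub>1" "R \<noteq> P\<^sub>1" "R \<noteq> P\<^sub>2" using disj P\<^sub>1 P\<^sub>2 by blast+
    then have "interp ?N R = map g ` interp M\<^sub>2 R"
      using is_struct_interp_dom[OF M(1)] by (simp add: glue_def)
    moreover have "map g ` interp M\<^sub>2 R \<subseteq> lists (g ` univ M\<^sub>2)" using M(2) by (force simp: is_struct_def)
    ultimately show ?thesis using True unfolding interp_restr U2 by auto
  next
    case False
    then show ?thesis using is_struct_interp_dom[OF M(2)] by (simp add: interp_restr)
  qed
  then show "r\<^sub>2 ?N = copy g M\<^sub>2" using U2 by (intro struct.equality) (auto simp: copy_def)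
qed

lemma decomposed_glue:
  assumes M: "is_struct \<Sigma>\<^sub>1 M\<^sub>1" "is_struct \<Sigma>\<^sub>2 M\<^sub>2"
    and fg: "f ` univ M\<^sub>1 \<inter> g ` univ M\<^sub>2 = {}"
  shows "decomposed (glue P\<^sub>1 P\<^sub>2 f g M\<^sub>1 M\<^sub>2)"
proof -
  have "interp (glue P\<^sub>1 P\<^sub>2 f g M\<^sub>1 M\<^sub>2) R \<subseteq> lists (f ` univ M\<^sub>1)" if "R \<in> dom \<Sigma>\<^sub>1" for R
  proof -
    have "R \<notin> dom \<Sigma>\<^sub>2" "R \<noteq> P\<^sub>1" "R \<noteq> P\<^sub>2" using disj P\<^sub>1 P\<^sub>2 that by blast+
    then have "interp (glue P\<^sub>1 P\<^sub>2 f g M\<^sub>1 M\<^sub>2) R = map f ` interp M\<^sub>1 R"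
      using is_struct_interp_dom[OF M(2)] by (simp add: glue_def)
    moreover have "map f ` interp M\<^sub>1 R \<subseteq> lists (f ` univ M\<^sub>1)" using M(1) by (force simp: is_struct_def)
    ultimately show ?thesis by simp
  qed
  moreover have "interp (glue P\<^sub>1 P\<^sub>2 f g M\<^sub>1 M\<^sub>2) R \<subseteq> lists (g ` univ M\<^sub>2)" if "R \<in> dom \<Sigma>\<^sub>2" for R
  proof -
    have "R \<notin> dom \<Sigma>\<^sub>1" "R \<noteq> P\<^sub>1" "R \<noteq> P\<^sub>2" using disj P\<^sub>1 P\<^sub>2 that by blast+
    then have "interp (glue P\<^sub>1 P\<^sub>2 f g M\<^sub>1 M\<^sub>2) R = map g ` interp M\<^sub>2 R"
      using is_struct_interp_dom[OF M(1)] by (simp add: glue_def)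
    moreover have "map g ` interp M\<^sub>2 R \<subseteq> lists (g ` univ M\<^sub>2)" using M(2) by (force simp: is_struct_def)
    ultimately show ?thesis by simp
  qed
  moreover have "univ M\<^sub>1 \<noteq> {}" "univ M\<^sub>2 \<noteq> {}" using M by (auto simp: is_struct_def)
  moreover have "univ (glue P\<^sub>1 P\<^sub>2 f g M\<^sub>1 M\<^sub>2) = f ` univ M\<^sub>1 \<union> g ` univ M\<^sub>2"
    by (simp add: glue_def)
  ultimately show ?thesis
    unfolding decomposed_def restr_glue[OF M] using is_struct_glue[OF M] fg
    by (simp add: copy_def)
qed

lemma emb_combine:
  assumes N: "decomposed N" and K: "decomposed K"
    and f\<^sub>1: "elementary_embedding \<Sigma>\<^sub>1 f\<^sub>1 (r\<^sub>1 N) (r\<^sub>1 K)" and f\<^sub>2: "elementary_embedding \<Sigma>\<^sub>2 f\<^sub>2 (r\<^sub>2 N) (r\<^sub>2 K)"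
  shows "elementary_embedding \<Sigma> (\<lambda>x. if x \<in> univ (r\<^sub>1 N) then f\<^sub>1 x else f\<^sub>2 x) N K"
proof -
  let ?f = "\<lambda>x. if x \<in> univ (r\<^sub>1 N) then f\<^sub>1 x else f\<^sub>2 x"
  have "?f ` univ N \<subseteq> univ K"
    using emb_range[OF f\<^sub>1] emb_range[OF f\<^sub>2] decomposedD(2)[OF N] decomposedD(2)[OF K] by auto
  moreover have "sat N s \<phi> \<longleftrightarrow> sat K (?f \<circ> s) \<phi>" if \<phi>: "in_lang \<Sigma> \<phi>" and s: "range s \<subseteq> univ N" for s \<phi>
  proof (rule sat_transfer[OF N K \<phi>, where \<sigma> = "\<lambda>i. s i \<in> univ (r\<^sub>1 N)"])
    have s2: "s i \<in> univ (r\<^sub>2 N)" if "s i \<notin> univ (r\<^sub>1 N)" for i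
      using s that decomposedD(2)[OF N] by (auto simp: image_subset_iff)
    show "if s i \<in> univ (r\<^sub>1 N) then s i \<in> univ (r\<^sub>1 N) else s i \<in> univ (r\<^sub>2 N)" for i using s2 by auto
    show "if s i \<in> univ (r\<^sub>1 N) then (?f \<circ> s) i \<in> univ (r\<^sub>1 K) else (?f \<circ> s) i \<in> univ (r\<^sub>2 K)" for i
      using s2 emb_range[OF f\<^sub>1] emb_range[OF f\<^sub>2] by auto
    fix \<alpha>
    { assume \<alpha>: "in_lang \<Sigma>\<^sub>1 \<alpha>" "fv \<alpha> \<subseteq> {i \<in> fv \<phi>. s i \<in> univ (r\<^sub>1 N)}"
      have "sat (r\<^sub>1 N) s \<alpha> \<longleftrightarrow> sat (r\<^sub>1 K) (f\<^sub>1 \<circ> s) \<alpha>"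
        using \<alpha> decomposedD(4)[OF N] by (intro emb_sat[OF f\<^sub>1]) auto
      also have "\<dots> \<longleftrightarrow> sat (r\<^sub>1 K) (?f \<circ> s) \<alpha>" by (rule sat_cong) (use \<alpha> in auto)
      finally show "sat (r\<^sub>1 N) s \<alpha> \<longleftrightarrow> sat (r\<^sub>1 K) (?f \<circ> s) \<alpha>" . }
    { assume \<alpha>: "in_lang \<Sigma>\<^sub>2 \<alpha>" "fv \<alpha> \<subseteq> {i \<in> fv \<phi>. s i \<notin> univ (r\<^sub>1 N)}"
      have "sat (r\<^sub>2 N) s \<alpha> \<longleftrightarrow> sat (r\<^sub>2 K) (f\<^sub>2 \<circ> s) \<alpha>"
        using \<alpha> s2 decomposedD(5)[OF N] by (intro emb_sat[OF f\<^sub>2]) auto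
      also have "\<dots> \<longleftrightarrow> sat (r\<^sub>2 K) (?f \<circ> s) \<alpha>" by (rule sat_cong) (use \<alpha> in auto)
      finally show "sat (r\<^sub>2 N) s \<alpha> \<longleftrightarrow> sat (r\<^sub>2 K) (?f \<circ> s) \<alpha>" . }
  qed
  ultimately show ?thesis by (simp add: elementary_embedding_def)
qed

lemma embeds_components:
  assumes N: "decomposed N" and K: "decomposed K"
  shows "embeds \<Sigma> N K \<longleftrightarrow> embeds \<Sigma>\<^sub>1 (r\<^sub>1 N) (r\<^sub>1 K) \<and> embeds \<Sigma>\<^sub>2 (r\<^sub>2 N) (r\<^sub>2 K)"
  unfolding embeds_def
  using emb_restr[OF _ \<Sigma>_sub(1) \<Sigma>_simps(1), of _ N K] emb_restr[OF _ \<Sigma>_sub(2) \<Sigma>_simps(2), of _ N K]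
    emb_combine[OF N K] by blast

lemma iso_combine:
  assumes N: "decomposed N" and K: "decomposed K" and "iso (r\<^sub>1 N) (r\<^sub>1 K)" "iso (r\<^sub>2 N) (r\<^sub>2 K)"
  shows "iso N K"
proof -
  obtain f\<^sub>1 f\<^sub>2 where f\<^sub>1: "iso_via f\<^sub>1 (r\<^sub>1 N) (r\<^sub>1 K)" and f\<^sub>2: "iso_via f\<^sub>2 (r\<^sub>2 N) (r\<^sub>2 K)"
    using assms by (auto simp: iso_iff)
  define f where "f x = (if x \<in> univ (r\<^sub>1 N) then f\<^sub>1 x else f\<^sub>2 x)" for x
  have f1: "x \<in> univ (r\<^sub>1 N) \<Longrightarrow> f x = f\<^sub>1 x" for x by (simp add: f_def)
  have f2: "x \<in> univ (r\<^sub>2 N) \<Longrightarrow> f x = f\<^sub>2 x" for x using decomposedD(3)[OF N] by (auto simp: f_def)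
  have b1: "bij_betw f (univ (r\<^sub>1 N)) (univ (r\<^sub>1 K))"
    using f\<^sub>1 f1 by (simp add: iso_via_def cong: bij_betw_cong)
  have b2: "bij_betw f (univ (r\<^sub>2 N)) (univ (r\<^sub>2 K))"
    using f\<^sub>2 f2 by (simp add: iso_via_def cong: bij_betw_cong)
  have b: "bij_betw f (univ N) (univ K)"
    unfolding decomposedD(2)[OF N] decomposedD(2)[OF K]
    using b1 b2 decomposedD(3)[OF K] by (intro bij_betw_combine) auto
  have in1: "f x \<in> univ (r\<^sub>1 K) \<longleftrightarrow> x \<in> univ (r\<^sub>1 N)" and in2: "f x \<in> univ (r\<^sub>2 K) \<longleftrightarrow> x \<in> univ (r\<^sub>2 N)"
    if "x \<in> univ N" for x
  proof -
    have "x \<in> univ (r\<^sub>1 N) \<Longrightarrow> f x \<in> univ (r\<^sub>1 K)" "x \<in> univ (r\<^sub>2 N) \<Longrightarrow> f x \<in> univ (r\<^sub>2 K)"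
      using b1 b2 by (auto simp: bij_betw_def)
    moreover have "x \<in> univ (r\<^sub>1 N) \<or> x \<in> univ (r\<^sub>2 N)" using that decomposedD(2)[OF N] by blast
    ultimately show "f x \<in> univ (r\<^sub>1 K) \<longleftrightarrow> x \<in> univ (r\<^sub>1 N)" "f x \<in> univ (r\<^sub>2 K) \<longleftrightarrow> x \<in> univ (r\<^sub>2 N)"
      using decomposedD(3)[OF N] decomposedD(3)[OF K] by blast+
  qed
  have "xs \<in> interp N R \<longleftrightarrow> map f xs \<in> interp K R" if xs: "set xs \<subseteq> univ N" for R xs
  proof -
    \<comment> \<open>Lists of length other than 1 lie in neither interpretation of a unary symbol,
      so only singletons have to be compared.\<close>
    have P: "xs \<in> interp N R \<longleftrightarrow> map f xs \<in> interp K R"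
      if R: "\<Sigma> R = Some 1" and iff: "\<And>x. x \<in> univ N \<Longrightarrow> [x] \<in> interp N R \<longleftrightarrow> [f x] \<in> interp K R"
    proof (cases "length xs = 1")
      case True
      then obtain x where "xs = [x]" by (auto simp: length_Suc_conv)
      then show ?thesis using iff xs by simp
    next
      case False
      then show ?thesis using R decomposedD(1)[OF N] decomposedD(1)[OF K]
        by (auto simp: is_struct_def dest!: spec[of _ R] bspec)
    qed
    have fx: "x \<in> univ N \<Longrightarrow> f x \<in> univ K" for x using b by (auto simp: bij_betw_def)
    consider "R = P\<^sub>1" | "R = P\<^sub>2" | "R \<in> dom \<Sigma>\<^sub>1" | "R \<in> dom \<Sigma>\<^sub>2" | "R \<notin> dom \<Sigma>"
      unfolding dom_\<Sigma> by blast
    then show ?thesis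
    proof cases
      case 1
      then show ?thesis
        using in1 fx interp_P(1)[of _ N] interp_P(1)[of _ K] by (intro P) (auto simp: \<Sigma>_simps(1))
    next
      case 2
      then show ?thesis
        using in2 fx interp_P(2)[of _ N] interp_P(2)[of _ K] by (intro P) (auto simp: \<Sigma>_simps(2))
    next
      case 3
      show ?thesis
      proof (cases "set xs \<subseteq> univ (r\<^sub>1 N)")
        case True
        then have eq: "map f xs = map f\<^sub>1 xs" using f1 by (auto simp: subset_iff)
        show ?thesis using f\<^sub>1 True unfolding eq decomposedD(6)[OF N 3] decomposedD(6)[OF K 3]
          by (simp add: iso_via_def)
      next
        case False
        then obtain x where x: "x \<in> set xs" "x \<notin> univ (r\<^sub>1 N)" by blast
        then have "f x \<notin> univ (r\<^sub>1 K)" using in1 xs by blast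
        then have "\<not> set (map f xs) \<subseteq> univ (r\<^sub>1 K)" using x by auto
        then show ?thesis using False unfolding decomposedD(6)[OF N 3] decomposedD(6)[OF K 3] interp_restr
          by auto
      qed
    next
      case 4
      show ?thesis
      proof (cases "set xs \<subseteq> univ (r\<^sub>2 N)")
        case True
        then have eq: "map f xs = map f\<^sub>2 xs" using f2 by (auto simp: subset_iff)
        show ?thesis using f\<^sub>2 True unfolding eq decomposedD(7)[OF N 4] decomposedD(7)[OF K 4]
          by (simp add: iso_via_def)
      next
        case False
        then obtain x where x: "x \<in> set xs" "x \<notin> univ (r\<^sub>2 N)" by blast
        then have "f x \<notin> univ (r\<^sub>2 K)" using in2 xs by blast
        then have "\<not> set (map f xs) \<subseteq> univ (r\<^sub>2 K)" using x by auto
        then show ?thesis using False unfolding decomposedD(7)[OF N 4] decomposedD(7)[OF K 4] interp_restr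
          by auto
      qed
    next
      case 5
      then show ?thesis
        using is_struct_interp_dom[OF decomposedD(1)[OF N]] is_struct_interp_dom[OF decomposedD(1)[OF K]]
        by simp
    qed
  qed
  then have "iso_via f N K" using b by (simp add: iso_via_def)
  then show ?thesis by (auto simp: iso_iff)
qed

lemma tp_append:
  assumes N: "decomposed N" and K: "decomposed K"
    and a: "a \<in> lists (univ (r\<^sub>1 N))" "b \<in> lists (univ (r\<^sub>2 N))"
    and c: "c \<in> lists (univ (r\<^sub>1 K))" "d \<in> lists (univ (r\<^sub>2 K))"
    and tp1: "tp \<Sigma>\<^sub>1 (r\<^sub>1 N) a = tp \<Sigma>\<^sub>1 (r\<^sub>1 K) c" and tp2: "tp \<Sigma>\<^sub>2 (r\<^sub>2 N) b = tp \<Sigma>\<^sub>2 (r\<^sub>2 K) d"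
  shows "tp \<Sigma> N (a @ b) = tp \<Sigma> K (c @ d)"
proof -
  have len: "length a = length c" "length b = length d" using tp1 tp2 by (auto dest: tp_length)
  show ?thesis
  proof (rule tp_eqI)
    show "length (a @ b) = length (c @ d)" using len by simp
    fix \<phi> assume "\<phi> \<in> formulas \<Sigma> (length (a @ b))"
    then have \<phi>: "in_lang \<Sigma> \<phi>" and fv: "i \<in> fv \<phi> \<Longrightarrow> i < length a + length b" for i
      by (auto simp: formulas_def)
    show "sat N ((!) (a @ b)) \<phi> \<longleftrightarrow> sat K ((!) (c @ d)) \<phi>"
    proof (rule sat_transfer[OF N K \<phi>, where \<sigma> = "\<lambda>i. i < length a"])
      fix i assume i: "i \<in> fv \<phi>"
      have "i - length a < length b" if "\<not> i < length a" using fv[OF i] that by linarith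
      then show "if i < length a then (a @ b) ! i \<in> univ (r\<^sub>1 N) else (a @ b) ! i \<in> univ (r\<^sub>2 N)"
        and "if i < length a then (c @ d) ! i \<in> univ (r\<^sub>1 K) else (c @ d) ! i \<in> univ (r\<^sub>2 K)"
        using a c len nth_mem[of i a] nth_mem[of i c] nth_mem[of "i - length a" b]
          nth_mem[of "i - length a" d]
        by (auto simp: nth_append)
    next
      fix \<alpha> assume \<alpha>: "in_lang \<Sigma>\<^sub>1 \<alpha>" "fv \<alpha> \<subseteq> {i \<in> fv \<phi>. i < length a}"
      have "sat (r\<^sub>1 N) ((!) (a @ b)) \<alpha> \<longleftrightarrow> sat (r\<^sub>1 N) (\<lambda>i. a ! id i) \<alpha>"
        by (rule sat_cong) (use \<alpha> in \<open>auto simp: nth_append\<close>)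
      also have "\<dots> \<longleftrightarrow> sat (r\<^sub>1 K) (\<lambda>i. c ! id i) \<alpha>"
        by (rule tp_sat[OF tp1 \<alpha>(1)]) (use \<alpha> in auto)
      also have "\<dots> \<longleftrightarrow> sat (r\<^sub>1 K) ((!) (c @ d)) \<alpha>"
        by (rule sat_cong) (use \<alpha> len in \<open>auto simp: nth_append\<close>)
      finally show "sat (r\<^sub>1 N) ((!) (a @ b)) \<alpha> \<longleftrightarrow> sat (r\<^sub>1 K) ((!) (c @ d)) \<alpha>" .
    next
      fix \<alpha> assume \<alpha>: "in_lang \<Sigma>\<^sub>2 \<alpha>" "fv \<alpha> \<subseteq> {i \<in> fv \<phi>. \<not> i < length a}"
      have "sat (r\<^sub>2 N) ((!) (a @ b)) \<alpha> \<longleftrightarrow> sat (r\<^sub>2 N) (\<lambda>i. b ! (i - length a)) \<alpha>"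
        by (rule sat_cong) (use \<alpha> in \<open>auto simp: nth_append\<close>)
      also have "\<dots> \<longleftrightarrow> sat (r\<^sub>2 K) (\<lambda>i. d ! (i - length a)) \<alpha>"
        by (rule tp_sat[OF tp2 \<alpha>(1)]) (use \<alpha> fv in force)
      also have "\<dots> \<longleftrightarrow> sat (r\<^sub>2 K) ((!) (c @ d)) \<alpha>"
        by (rule sat_cong) (use \<alpha> len in \<open>auto simp: nth_append\<close>)
      finally show "sat (r\<^sub>2 N) ((!) (a @ b)) \<alpha> \<longleftrightarrow> sat (r\<^sub>2 K) ((!) (c @ d)) \<alpha>" .
    qed
  qed
qed

end

section \<open>Prime models and chains over a disjoint union\<close>

lemma model_copy:
  assumes "model \<Sigma> T M" "T \<subseteq> sentences \<Sigma>" "inj_on f (univ M)"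
  shows "model \<Sigma> T (copy f M)"
proof -
  have st: "is_struct \<Sigma> M" using assms(1) by (simp add: model_def)
  have "elementary_embedding \<Sigma> f M (copy f M)" by (rule iso_via_emb[OF iso_via_copy[OF assms(3) st]])
  then show ?thesis using emb_model[OF _ assms(2) st is_struct_copy[OF st]] assms(1) by blast
qed

text \<open>Conjugating the inclusion with \<open>f\<close> gives the inclusion of the copies, since
  both are copied along the same map. This keeps chains of submodels chains after coding.\<close>

lemma copy_emb:
  assumes emb: "elementary_embedding \<Sigma> id A B" and A: "is_struct \<Sigma> A" and B: "is_struct \<Sigma> B" and f: "inj f"
  shows "elementary_embedding \<Sigma> id (copy f A) (copy f B)"
proof -
  have inj: "inj_on f X" for X using f by (rule inj_on_subset) simp
  have "elementary_embedding \<Sigma> (inv_into (univ A) f) (copy f A) A"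
    by (rule iso_via_emb[OF iso_via_inv[OF iso_via_copy[OF inj A]]])
  from emb_comp[OF emb_comp[OF this emb] iso_via_emb[OF iso_via_copy[OF inj B]]]
  have "elementary_embedding \<Sigma> (f \<circ> (id \<circ> inv_into (univ A) f)) (copy f A) (copy f B)" .
  then show ?thesis
    by (rule emb_cong) (auto simp: copy_def inj)
qed

lemma filter_conv_nth: "filter Q xs = map ((!) xs) (filter (\<lambda>i. Q (xs ! i)) [0..<length xs])"
proof -
  have "filter Q (map ((!) xs) [0..<length xs]) = map ((!) xs) (filter (Q \<circ> (!) xs) [0..<length xs])"
    by (rule filter_map)
  then show ?thesis by (simp add: map_nth comp_def)
qed

text \<open>The description \<open>model_T\<close> of the countable models keeps the particular
  theory \<open>Th \<Sigma> (dunion ...)\<close> out of the arguments. It is symmetric in the two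
  components.\<close>

locale two_theories = two_languages \<Sigma>\<^sub>1 \<Sigma>\<^sub>2 P\<^sub>1 P\<^sub>2 for \<Sigma>\<^sub>1 \<Sigma>\<^sub>2 :: "'r lang" and P\<^sub>1 P\<^sub>2 :: 'r +
  fixes T\<^sub>1 T\<^sub>2 T :: "'r fm set"
  assumes T\<^sub>1: "T\<^sub>1 \<subseteq> sentences \<Sigma>\<^sub>1" and T\<^sub>2: "T\<^sub>2 \<subseteq> sentences \<Sigma>\<^sub>2" and T: "T \<subseteq> sentences \<Sigma>"
    and model_T: "\<And>N :: 'r cstruct. model \<Sigma> T N \<longleftrightarrow>
      decomposed N \<and> model \<Sigma>\<^sub>1 T\<^sub>1 (r\<^sub>1 N) \<and> model \<Sigma>\<^sub>2 T\<^sub>2 (r\<^sub>2 N)"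
begin

abbreviation G :: "'r cstruct \<Rightarrow> 'r cstruct \<Rightarrow> 'r cstruct" where
  "G \<equiv> glue P\<^sub>1 P\<^sub>2 even_code odd_code"

lemma inj_even_code: "inj even_code" by (simp add: inj_def)
lemma inj_odd_code: "inj odd_code" by (simp add: inj_def)

lemma codes_disjoint: "even_code ` A \<inter> odd_code ` B = {}"
proof -
  have "even_code x \<noteq> odd_code y" for x y by presburger
  then show ?thesis by blast
qed

lemma G_components:
  assumes "is_struct \<Sigma>\<^sub>1 M\<^sub>1" "is_struct \<Sigma>\<^sub>2 M\<^sub>2"
  shows "decomposed (G M\<^sub>1 M\<^sub>2)" "r\<^sub>1 (G M\<^sub>1 M\<^sub>2) = copy even_code M\<^sub>1" "r\<^sub>2 (G M\<^sub>1 M\<^sub>2) = copy odd_code M\<^sub>2"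
    "iso_via even_code M\<^sub>1 (r\<^sub>1 (G M\<^sub>1 M\<^sub>2))" "iso_via odd_code M\<^sub>2 (r\<^sub>2 (G M\<^sub>1 M\<^sub>2))"
proof -
  show r: "r\<^sub>1 (G M\<^sub>1 M\<^sub>2) = copy even_code M\<^sub>1" "r\<^sub>2 (G M\<^sub>1 M\<^sub>2) = copy odd_code M\<^sub>2"
    by (rule restr_glue[OF assms])+
  show "decomposed (G M\<^sub>1 M\<^sub>2)" using assms codes_disjoint by (rule decomposed_glue)
  show "iso_via even_code M\<^sub>1 (r\<^sub>1 (G M\<^sub>1 M\<^sub>2))" "iso_via odd_code M\<^sub>2 (r\<^sub>2 (G M\<^sub>1 M\<^sub>2))"
    unfolding r using assms
    by (auto intro!: iso_via_copy inj_on_subset[OF inj_even_code] inj_on_subset[OF inj_odd_code])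
qed

lemma model_G:
  assumes "model \<Sigma>\<^sub>1 T\<^sub>1 M\<^sub>1" "model \<Sigma>\<^sub>2 T\<^sub>2 M\<^sub>2"
  shows "model \<Sigma> T (G M\<^sub>1 M\<^sub>2)"
proof -
  have st: "is_struct \<Sigma>\<^sub>1 M\<^sub>1" "is_struct \<Sigma>\<^sub>2 M\<^sub>2" using assms by (auto simp: model_def)
  have "model \<Sigma>\<^sub>1 T\<^sub>1 (copy even_code M\<^sub>1)" "model \<Sigma>\<^sub>2 T\<^sub>2 (copy odd_code M\<^sub>2)"
    using assms T\<^sub>1 T\<^sub>2 by (auto intro!: model_copy inj_on_subset[OF inj_even_code] inj_on_subset[OF inj_odd_code])
  then show ?thesis unfolding model_T G_components(2,3)[OF st] using G_components(1)[OF st] by blast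
qed

text \<open>Exchanging the components changes neither the language nor the decomposed structures, so
  statements about the second component follow from those about the first.\<close>

lemma swapped: "two_theories \<Sigma>\<^sub>2 \<Sigma>\<^sub>1 P\<^sub>2 P\<^sub>1 T\<^sub>2 T\<^sub>1 T"
proof -
  interpret swap: two_languages \<Sigma>\<^sub>2 \<Sigma>\<^sub>1 P\<^sub>2 P\<^sub>1
    using disj P\<^sub>1 P\<^sub>2 P_neq by unfold_locales auto
  have \<Sigma>: "dunion_lang P\<^sub>2 P\<^sub>1 \<Sigma>\<^sub>2 \<Sigma>\<^sub>1 = \<Sigma>"
    using map_add_comm[OF disj] P_neq by (auto simp: dunion_lang_def)
  have "swap.decomposed N \<longleftrightarrow> decomposed N" for N :: "'r cstruct"
    unfolding swap.decomposed_def decomposed_def \<Sigma> by blast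
  then show ?thesis using T\<^sub>1 T\<^sub>2 T model_T by unfold_locales (auto simp: \<Sigma>)
qed

lemma swapped_\<Sigma>: "dunion_lang P\<^sub>2 P\<^sub>1 \<Sigma>\<^sub>2 \<Sigma>\<^sub>1 = \<Sigma>"
  using map_add_comm[OF disj] P_neq by (auto simp: dunion_lang_def)

text \<open>To test primeness of the first part against a model \<open>N'\<close>, it is glued to
  the unchanged second part of \<open>N\<close>. Replacing in \<open>c\<close> the entries of the
  first part by the given realization preserves the type, so \<open>N\<close> embeds into the glued
  model, and the embedding restricts to the first parts.\<close>

lemma prime_component\<^sub>1:
  assumes "prime_over \<Sigma> T N c"
  shows "prime_over \<Sigma>\<^sub>1 T\<^sub>1 (r\<^sub>1 N) (filter (\<lambda>x. x \<in> univ (r\<^sub>1 N)) c)"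
proof -
  let ?a = "filter (\<lambda>x. x \<in> univ (r\<^sub>1 N)) c"
  let ?n = "length c"
  have N: "model \<Sigma> T N" and c: "c \<in> lists (univ N)" using assms by (auto simp: prime_over_def)
  then have dN: "decomposed N" and m1: "model \<Sigma>\<^sub>1 T\<^sub>1 (r\<^sub>1 N)" and m2: "model \<Sigma>\<^sub>2 T\<^sub>2 (r\<^sub>2 N)"
    by (auto simp: model_T)
  have "\<exists>F. elementary_embedding \<Sigma>\<^sub>1 F (r\<^sub>1 N) N' \<and> map F ?a = b"
    if N': "model \<Sigma>\<^sub>1 T\<^sub>1 N'" "b \<in> lists (univ N')" and tp: "tp \<Sigma>\<^sub>1 N' b = tp \<Sigma>\<^sub>1 (r\<^sub>1 N) ?a"
    for N' :: "'r cstruct" and b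
  proof -
    have len: "length b = length ?a" using tp by (rule tp_length)
    define K where "K = G N' (r\<^sub>2 N)"
    have st: "is_struct \<Sigma>\<^sub>1 N'" "is_struct \<Sigma>\<^sub>2 (r\<^sub>2 N)" using N' m2 by (auto simp: model_def)
    have mK: "model \<Sigma> T K" unfolding K_def using N'(1) m2 by (rule model_G)
    then have dK: "decomposed K" by (simp add: model_T)
    have i1: "iso_via even_code N' (r\<^sub>1 K)" and i2: "iso_via odd_code (r\<^sub>2 N) (r\<^sub>2 K)"
      unfolding K_def using G_components(4,5)[OF st] .
    have e1: "elementary_embedding \<Sigma>\<^sub>1 even_code N' (r\<^sub>1 K)"
      and e2: "elementary_embedding \<Sigma>\<^sub>2 odd_code (r\<^sub>2 N) (r\<^sub>2 K)"
      using i1 i2 by (auto intro: iso_via_emb)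
    \<comment> \<open>\<open>h i\<close> is a position in the filtered list at which the entry
      \<open>c ! i\<close> stands; repetitions in \<open>c\<close> make it a choice.\<close>
    define h where "h i = (SOME j. j < length ?a \<and> ?a ! j = c ! i)" for i
    have h: "h i < length ?a \<and> ?a ! h i = c ! i" if "i < ?n" "c ! i \<in> univ (r\<^sub>1 N)" for i
    proof -
      have "c ! i \<in> set ?a" using that by simp
      then have "\<exists>j. j < length ?a \<and> ?a ! j = c ! i" by (metis in_set_conv_nth)
      then show ?thesis unfolding h_def by (rule someI_ex)
    qed
    have bh: "b ! h i \<in> univ N'" if "i < ?n" "c ! i \<in> univ (r\<^sub>1 N)" for i
    proof -
      have "h i < length b" using h[OF that] len by simp
      then show ?thesis using N'(2) nth_mem by blast
    qed
    have c2: "c ! i \<in> univ (r\<^sub>2 N)" if "i < ?n" "c ! i \<notin> univ (r\<^sub>1 N)" for i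
    proof -
      have "c ! i \<in> univ N" using c that(1) nth_mem by blast
      then show ?thesis using decomposedD(2)[OF dN] that(2) by blast
    qed
    define d where "d = map (\<lambda>i. if c ! i \<in> univ (r\<^sub>1 N) then even_code (b ! h i) else odd_code (c ! i)) [0..<?n]"
    have d1: "d ! i = even_code (b ! h i)" if "i < ?n" "c ! i \<in> univ (r\<^sub>1 N)" for i
      using that by (simp add: d_def)
    have d2: "d ! i = odd_code (c ! i)" if "i < ?n" "c ! i \<notin> univ (r\<^sub>1 N)" for i
      using that by (simp add: d_def)
    have d1K: "d ! i \<in> univ (r\<^sub>1 K)" if "i < ?n" "c ! i \<in> univ (r\<^sub>1 N)" for i
      unfolding d1[OF that] by (rule emb_range[OF e1 bh[OF that]])
    have d2K: "d ! i \<in> univ (r\<^sub>2 K)" if "i < ?n" "c ! i \<notin> univ (r\<^sub>1 N)" for i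
      unfolding d2[OF that] by (rule emb_range[OF e2 c2[OF that]])
    have dl: "d \<in> lists (univ K)"
    proof -
      have "d ! i \<in> univ K" if "i < ?n" for i
        using d1K[OF that] d2K[OF that] decomposedD(2)[OF dK] by blast
      moreover have "length d = ?n" by (simp add: d_def)
      ultimately show ?thesis by (metis in_listsI in_set_conv_nth)
    qed
    have "tp \<Sigma> K d = tp \<Sigma> N c"
    proof (rule tp_eqI)
      fix \<phi> assume "\<phi> \<in> formulas \<Sigma> (length d)"
      then have \<phi>: "in_lang \<Sigma> \<phi>" and fv: "i \<in> fv \<phi> \<Longrightarrow> i < ?n" for i
        by (auto simp: formulas_def d_def)
      show "sat K ((!) d) \<phi> \<longleftrightarrow> sat N ((!) c) \<phi>"
      proof (rule sat_transfer[OF dK dN \<phi>, where \<sigma> = "\<lambda>i. c ! i \<in> univ (r\<^sub>1 N)"])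
        fix i assume "i \<in> fv \<phi>"
        then have i: "i < ?n" by (rule fv)
        show "if c ! i \<in> univ (r\<^sub>1 N) then d ! i \<in> univ (r\<^sub>1 K) else d ! i \<in> univ (r\<^sub>2 K)"
          using d1K[OF i] d2K[OF i] by simp
        show "if c ! i \<in> univ (r\<^sub>1 N) then c ! i \<in> univ (r\<^sub>1 N) else c ! i \<in> univ (r\<^sub>2 N)"
          using c2[OF i] by simp
      next
        fix \<alpha> assume \<alpha>: "in_lang \<Sigma>\<^sub>1 \<alpha>" "fv \<alpha> \<subseteq> {i \<in> fv \<phi>. c ! i \<in> univ (r\<^sub>1 N)}"
        then have i: "i < ?n" "c ! i \<in> univ (r\<^sub>1 N)" if "i \<in> fv \<alpha>" for i using that fv by auto
        have "sat (r\<^sub>1 K) ((!) d) \<alpha> \<longleftrightarrow> sat (r\<^sub>1 K) (even_code \<circ> (\<lambda>i. b ! h i)) \<alpha>"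
          by (rule sat_cong) (simp add: d1[OF i])
        also have "\<dots> \<longleftrightarrow> sat N' (\<lambda>i. b ! h i) \<alpha>"
          using bh[OF i] st(1) by (intro emb_sat[symmetric, OF e1 \<alpha>(1)]) (auto simp: is_struct_def)
        also have "\<dots> \<longleftrightarrow> sat (r\<^sub>1 N) (\<lambda>i. ?a ! h i) \<alpha>"
          by (rule tp_sat[OF tp \<alpha>(1)]) (use h[OF i] len in auto)
        also have "\<dots> \<longleftrightarrow> sat (r\<^sub>1 N) ((!) c) \<alpha>"
          by (rule sat_cong) (use h[OF i] in blast)
        finally show "sat (r\<^sub>1 K) ((!) d) \<alpha> \<longleftrightarrow> sat (r\<^sub>1 N) ((!) c) \<alpha>" .
      next
        fix \<alpha> assume \<alpha>: "in_lang \<Sigma>\<^sub>2 \<alpha>" "fv \<alpha> \<subseteq> {i \<in> fv \<phi>. c ! i \<notin> univ (r\<^sub>1 N)}"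
        then have i: "i < ?n" "c ! i \<notin> univ (r\<^sub>1 N)" if "i \<in> fv \<alpha>" for i using that fv by auto
        have "sat (r\<^sub>2 K) ((!) d) \<alpha> \<longleftrightarrow> sat (r\<^sub>2 K) (odd_code \<circ> (!) c) \<alpha>"
          by (rule sat_cong) (simp add: d2[OF i])
        also have "\<dots> \<longleftrightarrow> sat (r\<^sub>2 N) ((!) c) \<alpha>"
          using c2[OF i] st(2) by (intro emb_sat[symmetric, OF e2 \<alpha>(1)]) (auto simp: is_struct_def)
        finally show "sat (r\<^sub>2 K) ((!) d) \<alpha> \<longleftrightarrow> sat (r\<^sub>2 N) ((!) c) \<alpha>" .
      qed
    qed (simp add: d_def)
    then obtain F where F: "elementary_embedding \<Sigma> F N K" "map F c = d"
      using assms mK dl unfolding prime_over_def by blast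
    have F1: "elementary_embedding \<Sigma>\<^sub>1 F (r\<^sub>1 N) (r\<^sub>1 K)"
      by (rule emb_restr[OF F(1) \<Sigma>_sub(1) \<Sigma>_simps(1)])
    let ?inv = "inv_into (univ N') even_code"
    have "elementary_embedding \<Sigma>\<^sub>1 (?inv \<circ> F) (r\<^sub>1 N) N'"
      by (rule emb_comp[OF F1 iso_via_emb[OF iso_via_inv[OF i1]]])
    moreover have "map (?inv \<circ> F) ?a = b"
    proof (rule nth_equalityI)
      fix j assume "j < length (map (?inv \<circ> F) ?a)"
      then have j: "j < length ?a" by simp
      then have "?a ! j \<in> set ?a" by (rule nth_mem)
      then obtain i where i: "i < ?n" "c ! i = ?a ! j" "c ! i \<in> univ (r\<^sub>1 N)"
        by (auto simp: in_set_conv_nth)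
      have "F (?a ! j) = d ! i" using F(2) i(1,2) by (metis nth_map)
      then have "(?inv \<circ> F) (?a ! j) = b ! h i"
        using d1[OF i(1,3)] bh[OF i(1,3)] inj_on_subset[OF inj_even_code, of "univ N'"] by simp
      \<comment> \<open>With repeated entries \<open>h i\<close> may differ from \<open>j\<close>.
        Equality of the entries at both positions is part of the type and carries over to
        \<open>b\<close>.\<close>
      moreover have "b ! h i = b ! j"
      proof -
        have "sat N' (\<lambda>k. b ! (if k = 0 then h i else j)) (Equ 0 1) \<longleftrightarrow>
            sat (r\<^sub>1 N) (\<lambda>k. ?a ! (if k = 0 then h i else j)) (Equ 0 1)"
          by (rule tp_sat[OF tp]) (use h[OF i(1,3)] j len in auto)
        then show ?thesis using h[OF i(1,3)] i(2) by simp
      qed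
      ultimately show "map (?inv \<circ> F) ?a ! j = b ! j" using j by simp
    qed (simp add: len)
    ultimately show ?thesis by blast
  qed
  then show ?thesis using m1 by (auto simp: prime_over_def)
qed

lemma prime_component\<^sub>2:
  assumes "prime_over \<Sigma> T N c"
  shows "prime_over \<Sigma>\<^sub>2 T\<^sub>2 (r\<^sub>2 N) (filter (\<lambda>x. x \<in> univ (r\<^sub>2 N)) c)"
proof -
  interpret swap: two_theories \<Sigma>\<^sub>2 \<Sigma>\<^sub>1 P\<^sub>2 P\<^sub>1 T\<^sub>2 T\<^sub>1 T by (rule swapped)
  show ?thesis using swap.prime_component\<^sub>1 assms unfolding swapped_\<Sigma> by blast
qed

text \<open>In a realization \<open>e\<close> the first \<open>length a\<close> coordinates fall
  into the first part and the others into the second, with the component types of \<open>a\<close>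
  and \<open>b\<close>. The two embeddings from primeness of the components are then patched
  together.\<close>

lemma prime_combine:
  assumes N: "model \<Sigma> T N" and a: "prime_over \<Sigma>\<^sub>1 T\<^sub>1 (r\<^sub>1 N) a" and b: "prime_over \<Sigma>\<^sub>2 T\<^sub>2 (r\<^sub>2 N) b"
  shows "prime_over \<Sigma> T N (a @ b)"
proof -
  have dN: "decomposed N" using N by (simp add: model_T)
  have la: "a \<in> lists (univ (r\<^sub>1 N))" and lb: "b \<in> lists (univ (r\<^sub>2 N))"
    using a b by (auto simp: prime_over_def)
  have "a @ b \<in> lists (univ N)" using la lb decomposedD(2)[OF dN] by auto
  moreover have "\<exists>f. elementary_embedding \<Sigma> f N K \<and> map f (a @ b) = e"
    if K: "model \<Sigma> T K" "e \<in> lists (univ K)" "tp \<Sigma> K e = tp \<Sigma> N (a @ b)" for K :: "'r cstruct" and e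
  proof -
    have dK: "decomposed K" "model \<Sigma>\<^sub>1 T\<^sub>1 (r\<^sub>1 K)" "model \<Sigma>\<^sub>2 T\<^sub>2 (r\<^sub>2 K)" using K(1) by (auto simp: model_T)
    have len: "length e = length a + length b" using tp_length[OF K(3)] by simp
    let ?I = "[0..<length a]" and ?J = "[length a..<length a + length b]"
    have maps: "map ((!) (a @ b)) ?I = a" "map ((!) (a @ b)) ?J = b"
      by (auto intro!: nth_equalityI simp: nth_append)
    have eI: "map ((!) e) ?I @ map ((!) e) ?J = e"
      unfolding map_append[symmetric] using len map_nth[of e] upt_add_eq_append[of 0 "length a" "length b"] by simp
    have ab1: "(a @ b) ! i \<in> univ (r\<^sub>1 N)" if "i \<in> set ?I" for i
      using la that nth_mem[of i a] by (auto simp: nth_append)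
    have ab2: "(a @ b) ! i \<in> univ (r\<^sub>2 N)" if "i \<in> set ?J" for i
      using lb that nth_mem[of "i - length a" b] by (auto simp: nth_append)
    have "set ?I \<subseteq> {..<length (a @ b)}" "set ?J \<subseteq> {..<length (a @ b)}" by auto
    then have 1: "tp \<Sigma>\<^sub>1 (r\<^sub>1 N) (map ((!) (a @ b)) ?I) = tp \<Sigma>\<^sub>1 (r\<^sub>1 K) (map ((!) e) ?I)"
        "\<And>i. i \<in> set ?I \<Longrightarrow> e ! i \<in> univ (r\<^sub>1 K)"
      and 2: "tp \<Sigma>\<^sub>2 (r\<^sub>2 N) (map ((!) (a @ b)) ?J) = tp \<Sigma>\<^sub>2 (r\<^sub>2 K) (map ((!) e) ?J)"
        "\<And>i. i \<in> set ?J \<Longrightarrow> e ! i \<in> univ (r\<^sub>2 K)"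
      using tp_restr[OF K(3)[symmetric] \<Sigma>_sub(1) \<Sigma>_simps(1) _ ab1 K(2)]
        tp_restr[OF K(3)[symmetric] \<Sigma>_sub(2) \<Sigma>_simps(2) _ ab2 K(2)] by blast+
    have "map ((!) e) ?I \<in> lists (univ (r\<^sub>1 K))" using 1(2) by auto
    then obtain f\<^sub>1 where f1: "elementary_embedding \<Sigma>\<^sub>1 f\<^sub>1 (r\<^sub>1 N) (r\<^sub>1 K)" "map f\<^sub>1 a = map ((!) e) ?I"
      using a 1(1) dK(2) unfolding prime_over_def maps by metis
    have "map ((!) e) ?J \<in> lists (univ (r\<^sub>2 K))" using 2(2) by auto
    then obtain f\<^sub>2 where f2: "elementary_embedding \<Sigma>\<^sub>2 f\<^sub>2 (r\<^sub>2 N) (r\<^sub>2 K)" "map f\<^sub>2 b = map ((!) e) ?J"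
      using b 2(1) dK(3) unfolding prime_over_def maps by metis
    let ?f = "\<lambda>x. if x \<in> univ (r\<^sub>1 N) then f\<^sub>1 x else f\<^sub>2 x"
    have ma: "map ?f a = map ((!) e) ?I" unfolding f1(2)[symmetric] using la by auto
    have mb: "map ?f b = map ((!) e) ?J"
      unfolding f2(2)[symmetric] using lb decomposedD(3)[OF dN] by auto
    have "map ?f (a @ b) = e" by (simp only: map_append ma mb eI)
    moreover have "elementary_embedding \<Sigma> ?f N K" by (rule emb_combine[OF dN dK(1) f1(1) f2(1)])
    ultimately show ?thesis by blast
  qed
  ultimately show ?thesis using N by (simp add: prime_over_def)
qed

lemma prime_over_tuple_components:
  assumes "model \<Sigma> T N"
  shows "prime_over_tuple \<Sigma> T N \<longleftrightarrow> prime_over_tuple \<Sigma>\<^sub>1 T\<^sub>1 (r\<^sub>1 N) \<and> prime_over_tuple \<Sigma>\<^sub>2 T\<^sub>2 (r\<^sub>2 N)"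
  unfolding prime_over_tuple_def
  using prime_component\<^sub>1 prime_component\<^sub>2 prime_combine[OF assms] by blast

text \<open>The point is uniformity: \<open>q\<close> decides which coordinates lie in the first
  part and what their type is, so one \<open>q\<^sub>1\<close> serves all models prime over
  \<open>q\<close>, in particular all members of a chain.\<close>

lemma prime_over_type_component\<^sub>1:
  "\<exists>q\<^sub>1. \<forall>N. prime_over_type \<Sigma> T q N \<longrightarrow> prime_over_type \<Sigma>\<^sub>1 T\<^sub>1 q\<^sub>1 (r\<^sub>1 N)"
proof (cases "\<exists>N. prime_over_type \<Sigma> T q N")
  case True
  then obtain N c where N: "prime_over \<Sigma> T N c" "tp \<Sigma> N c = q" by (auto simp: prime_over_type_def)
  let ?I = "\<lambda>N c. filter (\<lambda>i. c ! i \<in> univ (r\<^sub>1 N)) [0..<length c]"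
  let ?a = "\<lambda>N c. filter (\<lambda>x. x \<in> univ (r\<^sub>1 N)) c"
  have "prime_over_type \<Sigma>\<^sub>1 T\<^sub>1 (tp \<Sigma>\<^sub>1 (r\<^sub>1 N) (?a N c)) (r\<^sub>1 K)" if "prime_over_type \<Sigma> T q K" for K
  proof -
    obtain d where K: "prime_over \<Sigma> T K d" "tp \<Sigma> K d = q" using \<open>prime_over_type \<Sigma> T q K\<close>
      by (auto simp: prime_over_type_def)
    have tp: "tp \<Sigma> N c = tp \<Sigma> K d" "tp \<Sigma> K d = tp \<Sigma> N c" using N K by simp_all
    have c: "c \<in> lists (univ N)" and d: "d \<in> lists (univ K)" using N K by (auto simp: prime_over_def)
    have len: "length c = length d" using tp(1) by (rule tp_length)
    have "c ! i \<in> univ (r\<^sub>1 N) \<longleftrightarrow> d ! i \<in> univ (r\<^sub>1 K)" if "i < length c" for i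
      using tp_restr(2)[OF tp(1) \<Sigma>_sub(1) \<Sigma>_simps(1), of "[i]" i]
        tp_restr(2)[OF tp(2) \<Sigma>_sub(1) \<Sigma>_simps(1), of "[i]" i] c d len that by auto
    then have I: "?I N c = ?I K d" unfolding len[symmetric] by (intro filter_cong) auto
    have "tp \<Sigma>\<^sub>1 (r\<^sub>1 N) (map ((!) c) (?I N c)) = tp \<Sigma>\<^sub>1 (r\<^sub>1 K) (map ((!) d) (?I N c))"
      by (rule tp_restr(1)[OF tp(1) \<Sigma>_sub(1) \<Sigma>_simps(1) _ _ d]) auto
    then have "tp \<Sigma>\<^sub>1 (r\<^sub>1 N) (?a N c) = tp \<Sigma>\<^sub>1 (r\<^sub>1 K) (?a K d)"
      unfolding filter_conv_nth[of _ c] filter_conv_nth[of _ d] I[symmetric] .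
    then show ?thesis using prime_component\<^sub>1[OF K(1)] by (auto simp: prime_over_type_def)
  qed
  then show ?thesis by blast
qed blast

text \<open>The chain is restricted member by member. The second conjunct ties
  \<open>q\<^sub>1\<close> to \<open>q\<close>, so that the class of the restricted chain can be
  read from any model prime over \<open>q\<close>.\<close>

lemma chain_component\<^sub>1:
  assumes "chain_over \<Sigma> T q N"
  shows "\<exists>q\<^sub>1. chain_over \<Sigma>\<^sub>1 T\<^sub>1 q\<^sub>1 (r\<^sub>1 N) \<and>
    (\<forall>K. prime_over_type \<Sigma> T q K \<longrightarrow> prime_over_type \<Sigma>\<^sub>1 T\<^sub>1 q\<^sub>1 (r\<^sub>1 K))"
proof -
  obtain C where C: "\<And>n. prime_over_type \<Sigma> T q (C n)" "elementary_chain_union \<Sigma> C N"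
    and N: "model \<Sigma> T N" using assms by (auto simp: chain_over_def)
  obtain q\<^sub>1 where q: "\<And>K. prime_over_type \<Sigma> T q K \<Longrightarrow> prime_over_type \<Sigma>\<^sub>1 T\<^sub>1 q\<^sub>1 (r\<^sub>1 K)"
    using prime_over_type_component\<^sub>1 by metis
  have dC: "decomposed (C n)" for n using C(1) prime_over_type_model model_T by blast
  have U: "univ N = (\<Union>n. univ (C n))" "\<And>R. interp N R = (\<Union>n. interp (C n) R)"
    and step: "\<And>n. elementary_embedding \<Sigma> id (C n) (C (Suc n))"
    using C(2) by (auto simp: elementary_chain_union_def elementary_substruct_def)
  have "elementary_chain_union \<Sigma>\<^sub>1 (\<lambda>n. r\<^sub>1 (C n)) (r\<^sub>1 N)"
    unfolding elementary_chain_union_def elementary_substruct_def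
  proof (intro conjI allI)
    show "elementary_embedding \<Sigma>\<^sub>1 id (r\<^sub>1 (C n)) (r\<^sub>1 (C (Suc n)))" for n
      by (rule emb_restr[OF step \<Sigma>_sub(1) \<Sigma>_simps(1)])
    have P: "a \<in> univ (C n)" if "[a] \<in> interp (C n) P\<^sub>1" for a n
      using decomposedD(1)[OF dC[of n]] that by (auto simp: is_struct_def dest!: spec[of _ P\<^sub>1] bspec)
    show V: "univ (r\<^sub>1 N) = (\<Union>n. univ (r\<^sub>1 (C n)))"
      using P by (auto simp: univ_restr U)
    fix R
    show "interp (r\<^sub>1 N) R = (\<Union>n. interp (r\<^sub>1 (C n)) R)"
    proof (cases "R \<in> dom \<Sigma>\<^sub>1")
      case True
      have "interp (C n) R = interp (r\<^sub>1 (C n)) R" for n using decomposedD(6)[OF dC True] by blast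
      moreover have "decomposed N" using N by (simp add: model_T)
      then have "interp N R = interp (r\<^sub>1 N) R" using decomposedD(6) True by blast
      ultimately show ?thesis using U(2) by simp
    next
      case False
      then show ?thesis by (simp add: interp_restr)
    qed
  qed
  moreover have "model \<Sigma>\<^sub>1 T\<^sub>1 (r\<^sub>1 N)" using N by (simp add: model_T)
  ultimately have "chain_over \<Sigma>\<^sub>1 T\<^sub>1 q\<^sub>1 (r\<^sub>1 N)" 
    unfolding chain_over_def using q[OF C(1)]
    by (intro conjI exI[of _ "\<lambda>n. r\<^sub>1 (C n)"]) simp_all
  then show ?thesis using q by blast
qed

lemma chain_component\<^sub>2:
  assumes "chain_over \<Sigma> T q N"
  shows "\<exists>q\<^sub>2. chain_over \<Sigma>\<^sub>2 T\<^sub>2 q\<^sub>2 (r\<^sub>2 N) \<and>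
    (\<forall>K. prime_over_type \<Sigma> T q K \<longrightarrow> prime_over_type \<Sigma>\<^sub>2 T\<^sub>2 q\<^sub>2 (r\<^sub>2 K))"
proof -
  interpret swap: two_theories \<Sigma>\<^sub>2 \<Sigma>\<^sub>1 P\<^sub>2 P\<^sub>1 T\<^sub>2 T\<^sub>1 T by (rule swapped)
  show ?thesis using swap.chain_component\<^sub>1 assms unfolding swapped_\<Sigma> by blast
qed

text \<open>Again uniformity is needed for chains: by \<open>tp_append\<close> the type of the coded
  and concatenated tuple depends only on \<open>q\<^sub>1\<close> and
  \<open>q\<^sub>2\<close>.\<close>

lemma prime_over_type_G:
  "\<exists>q. \<forall>A B. prime_over_type \<Sigma>\<^sub>1 T\<^sub>1 q\<^sub>1 A \<longrightarrow> prime_over_type \<Sigma>\<^sub>2 T\<^sub>2 q\<^sub>2 B \<longrightarrow> prime_over_type \<Sigma> T q (G A B)"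
proof (cases "\<exists>A B. prime_over_type \<Sigma>\<^sub>1 T\<^sub>1 q\<^sub>1 A \<and> prime_over_type \<Sigma>\<^sub>2 T\<^sub>2 q\<^sub>2 B")
  case True
  then obtain A B a b where A: "prime_over \<Sigma>\<^sub>1 T\<^sub>1 A a" "tp \<Sigma>\<^sub>1 A a = q\<^sub>1"
    and B: "prime_over \<Sigma>\<^sub>2 T\<^sub>2 B b" "tp \<Sigma>\<^sub>2 B b = q\<^sub>2"
    by (auto simp: prime_over_type_def)
  let ?c = "\<lambda>a b. map even_code a @ map odd_code b"
  have parts: "prime_over \<Sigma>\<^sub>1 T\<^sub>1 (r\<^sub>1 (G A B)) (map even_code a)" "tp \<Sigma>\<^sub>1 (r\<^sub>1 (G A B)) (map even_code a) = tp \<Sigma>\<^sub>1 A a"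
      "prime_over \<Sigma>\<^sub>2 T\<^sub>2 (r\<^sub>2 (G A B)) (map odd_code b)" "tp \<Sigma>\<^sub>2 (r\<^sub>2 (G A B)) (map odd_code b) = tp \<Sigma>\<^sub>2 B b"
      "model \<Sigma> T (G A B)"
    if "prime_over \<Sigma>\<^sub>1 T\<^sub>1 A a" "prime_over \<Sigma>\<^sub>2 T\<^sub>2 B b" for A B a b
  proof -
    have m: "model \<Sigma>\<^sub>1 T\<^sub>1 A" "model \<Sigma>\<^sub>2 T\<^sub>2 B" using that by (auto simp: prime_over_def)
    then have st: "is_struct \<Sigma>\<^sub>1 A" "is_struct \<Sigma>\<^sub>2 B" by (auto simp: model_def)
    show "model \<Sigma> T (G A B)" using m by (rule model_G)
    then have "is_struct \<Sigma>\<^sub>1 (r\<^sub>1 (G A B))" "is_struct \<Sigma>\<^sub>2 (r\<^sub>2 (G A B))"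
      using is_struct_components model_T by blast+
    then show "prime_over \<Sigma>\<^sub>1 T\<^sub>1 (r\<^sub>1 (G A B)) (map even_code a)" "tp \<Sigma>\<^sub>1 (r\<^sub>1 (G A B)) (map even_code a) = tp \<Sigma>\<^sub>1 A a"
      "prime_over \<Sigma>\<^sub>2 T\<^sub>2 (r\<^sub>2 (G A B)) (map odd_code b)" "tp \<Sigma>\<^sub>2 (r\<^sub>2 (G A B)) (map odd_code b) = tp \<Sigma>\<^sub>2 B b"
      using iso_prime_over[OF G_components(4)[OF st] _ T\<^sub>1 that(1)] iso_prime_over[OF G_components(5)[OF st] _ T\<^sub>2 that(2)] by auto
  qed
  have "prime_over_type \<Sigma> T (tp \<Sigma> (G A B) (?c a b)) (G A' B')"
    if A': "prime_over_type \<Sigma>\<^sub>1 T\<^sub>1 q\<^sub>1 A'" and B': "prime_over_type \<Sigma>\<^sub>2 T\<^sub>2 q\<^sub>2 B'" for A' B'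
  proof -
    obtain a' b' where a': "prime_over \<Sigma>\<^sub>1 T\<^sub>1 A' a'" "tp \<Sigma>\<^sub>1 A' a' = q\<^sub>1"
      and b': "prime_over \<Sigma>\<^sub>2 T\<^sub>2 B' b'" "tp \<Sigma>\<^sub>2 B' b' = q\<^sub>2"
      using A' B' by (auto simp: prime_over_type_def)
    note p = parts[OF A(1) B(1)] and p' = parts[OF a'(1) b'(1)]
    have dec: "decomposed (G A' B')" "decomposed (G A B)" using p(5) p'(5) by (simp_all add: model_T)
    have "tp \<Sigma> (G A' B') (?c a' b') = tp \<Sigma> (G A B) (?c a b)"
      by (rule tp_append[OF dec]) (use p p' A B a' b' in \<open>simp_all add: prime_over_def\<close>)
    then show ?thesis
      using prime_combine[OF p'(5,1,3)] unfolding prime_over_type_def by blast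
  qed
  then show ?thesis by blast
qed blast

text \<open>The two chains are glued index by index. The codes do not depend on the index, so the
  inclusions remain inclusions.\<close>

lemma chain_over_G:
  assumes M\<^sub>1: "chain_over \<Sigma>\<^sub>1 T\<^sub>1 q\<^sub>1 M\<^sub>1" and M\<^sub>2: "chain_over \<Sigma>\<^sub>2 T\<^sub>2 q\<^sub>2 M\<^sub>2"
    and A: "prime_over_type \<Sigma>\<^sub>1 T\<^sub>1 q\<^sub>1 A" and B: "prime_over_type \<Sigma>\<^sub>2 T\<^sub>2 q\<^sub>2 B"
  shows "\<exists>q. chain_over \<Sigma> T q (G M\<^sub>1 M\<^sub>2) \<and> prime_over_type \<Sigma> T q (G A B)"
proof -
  obtain C where C: "\<And>n. prime_over_type \<Sigma>\<^sub>1 T\<^sub>1 q\<^sub>1 (C n)" "elementary_chain_union \<Sigma>\<^sub>1 C M\<^sub>1"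
    using M\<^sub>1 by (auto simp: chain_over_def)
  obtain D where D: "\<And>n. prime_over_type \<Sigma>\<^sub>2 T\<^sub>2 q\<^sub>2 (D n)" "elementary_chain_union \<Sigma>\<^sub>2 D M\<^sub>2"
    using M\<^sub>2 by (auto simp: chain_over_def)
  obtain q where q: "\<And>A B. prime_over_type \<Sigma>\<^sub>1 T\<^sub>1 q\<^sub>1 A \<Longrightarrow> prime_over_type \<Sigma>\<^sub>2 T\<^sub>2 q\<^sub>2 B \<Longrightarrow>
      prime_over_type \<Sigma> T q (G A B)"
    using prime_over_type_G by metis
  have st: "is_struct \<Sigma>\<^sub>1 (C n)" "is_struct \<Sigma>\<^sub>2 (D n)" for n
    using prime_over_type_model[OF C(1)] prime_over_type_model[OF D(1)] by (auto simp: model_def)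
  have UC: "univ M\<^sub>1 = (\<Union>n. univ (C n))" "\<And>R. interp M\<^sub>1 R = (\<Union>n. interp (C n) R)"
      "\<And>n. elementary_embedding \<Sigma>\<^sub>1 id (C n) (C (Suc n))"
    and UD: "univ M\<^sub>2 = (\<Union>n. univ (D n))" "\<And>R. interp M\<^sub>2 R = (\<Union>n. interp (D n) R)"
      "\<And>n. elementary_embedding \<Sigma>\<^sub>2 id (D n) (D (Suc n))"
    using C(2) D(2) by (auto simp: elementary_chain_union_def elementary_substruct_def)
  have "elementary_chain_union \<Sigma> (\<lambda>n. G (C n) (D n)) (G M\<^sub>1 M\<^sub>2)"
    unfolding elementary_chain_union_def elementary_substruct_def
  proof (intro conjI allI)
    fix n
    have "elementary_embedding \<Sigma>\<^sub>1 id (r\<^sub>1 (G (C n) (D n))) (r\<^sub>1 (G (C (Suc n)) (D (Suc n))))"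
      unfolding G_components(2)[OF st] by (rule copy_emb[OF UC(3) st(1) st(1) inj_even_code])
    moreover have "elementary_embedding \<Sigma>\<^sub>2 id (r\<^sub>2 (G (C n) (D n))) (r\<^sub>2 (G (C (Suc n)) (D (Suc n))))"
      unfolding G_components(3)[OF st] by (rule copy_emb[OF UD(3) st(2) st(2) inj_odd_code])
    ultimately have "elementary_embedding \<Sigma> (\<lambda>x. if x \<in> univ (r\<^sub>1 (G (C n) (D n))) then id x else id x)
        (G (C n) (D n)) (G (C (Suc n)) (D (Suc n)))"
      by (rule emb_combine[OF G_components(1)[OF st] G_components(1)[OF st]])
    then show "elementary_embedding \<Sigma> id (G (C n) (D n)) (G (C (Suc n)) (D (Suc n)))"
      by (rule emb_cong) simp
  next
    show "univ (G M\<^sub>1 M\<^sub>2) = (\<Union>n. univ (G (C n) (D n)))"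
      by (auto simp: glue_def UC(1) UD(1))
    show "interp (G M\<^sub>1 M\<^sub>2) R = (\<Union>n. interp (G (C n) (D n)) R)" for R
      by (auto simp: glue_def UC(1,2) UD(1,2))
  qed
  moreover have "model \<Sigma> T (G M\<^sub>1 M\<^sub>2)" using M\<^sub>1 M\<^sub>2 by (intro model_G) (auto simp: chain_over_def)
  ultimately have "chain_over \<Sigma> T q (G M\<^sub>1 M\<^sub>2)" 
    unfolding chain_over_def using q[OF C(1) D(1)]
    by (intro conjI exI[of _ "\<lambda>n. G (C n) (D n)"]) simp_all
  then show ?thesis using q A B by blast
qed

end

section \<open>The theory of a disjoint union\<close>

text \<open>\<open>complete_theory\<close> quantifies over models on \<open>nat\<close> only; a
  countable elementary submodel brings a structure on any type within its scope.\<close>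

lemma complete_true_in:
  fixes M :: "('r, 'a) struct" and N :: "'r cstruct"
  assumes "complete_theory \<Sigma> T" "countable (dom \<Sigma>)" "model \<Sigma> T M" "model \<Sigma> T N" "\<phi> \<in> sentences \<Sigma>"
  shows "true_in M \<phi> \<longleftrightarrow> true_in N \<phi>"
proof -
  have T: "T \<subseteq> sentences \<Sigma>" using assms(1) by (simp add: complete_theory_def)
  have st: "is_struct \<Sigma> M" using assms(3) by (simp add: model_def)
  obtain M' :: "'r cstruct" and f where M': "is_struct \<Sigma> M'" "elementary_embedding \<Sigma> f M' M"
    using Loewenheim_Skolem[OF assms(2) st, of "{}"] by auto
  have "model \<Sigma> T M'" using emb_model[OF M'(2) T M'(1) st] assms(3) by blast
  moreover have "true_in K (Neg \<phi>) \<longleftrightarrow> \<not> true_in K \<phi>" for K :: "'r cstruct"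
  proof -
    have "Neg \<phi> \<in> sentences \<Sigma>" using assms(5) by (simp add: sentences_def formulas_def)
    then show ?thesis
      using sat_sentence[OF assms(5), of K undefined] sat_sentence[of "Neg \<phi>" \<Sigma> K undefined] by simp
  qed
  ultimately have "true_in M' \<phi> \<longleftrightarrow> true_in N \<phi>"
    using assms(1,4,5) unfolding complete_theory_def by blast
  then show ?thesis
    using emb_true_in[OF M'(2) assms(5)] M'(1) by (simp add: is_struct_def)
qed

lemma sat_foldr_Exists:
  "sat M s (foldr Exists l \<phi>) \<longleftrightarrow>
    (\<exists>t. (\<forall>i. i \<notin> set l \<longrightarrow> t i = s i) \<and> (\<forall>i\<in>set l. t i \<in> univ M) \<and> sat M t \<phi>)"
proof (induction l arbitrary: s)
  case Nil
  show ?case by (simp add: fun_eq_iff[symmetric])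
next
  case (Cons j l)
  show ?case
  proof
    assume "sat M s (foldr Exists (j # l) \<phi>)"
    then obtain a t where "a \<in> univ M" "\<forall>i. i \<notin> set l \<longrightarrow> t i = (s(j := a)) i"
      "\<forall>i\<in>set l. t i \<in> univ M" "sat M t \<phi>"
      using Cons by auto
    moreover from this have "t j \<in> univ M" by (cases "j \<in> set l") auto
    ultimately show "\<exists>t. (\<forall>i. i \<notin> set (j # l) \<longrightarrow> t i = s i) \<and> (\<forall>i\<in>set (j # l). t i \<in> univ M) \<and> sat M t \<phi>"
      by (intro exI[of _ t]) auto
  next
    assume "\<exists>t. (\<forall>i. i \<notin> set (j # l) \<longrightarrow> t i = s i) \<and> (\<forall>i\<in>set (j # l). t i \<in> univ M) \<and> sat M t \<phi>"
    then obtain t where t: "\<forall>i. i \<notin> set (j # l) \<longrightarrow> t i = s i" "\<forall>i\<in>set (j # l). t i \<in> univ M" "sat M t \<phi>"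
      by blast
    then have "sat M (s(j := t j)) (foldr Exists l \<phi>)"
      unfolding Cons by (intro exI[of _ t]) auto
    then show "sat M s (foldr Exists (j # l) \<phi>)" using t(2) by auto
  qed
qed

lemma fv_foldr_Exists: "fv (foldr Exists l \<phi>) = fv \<phi> - set l"
  by (induction l) auto

lemma in_lang_foldr_Exists: "in_lang \<Sigma> (foldr Exists l \<phi>) \<longleftrightarrow> in_lang \<Sigma> \<phi>"
  by (induction l) auto

text \<open>For each coordinate \<open>k\<close> a single sentence excludes \<open>R\<close>-tuples
  whose \<open>k\<close>-th entry is outside \<open>P\<close>; it holds in \<open>D\<close> and
  therefore in \<open>N\<close>.\<close>

lemma relation_within_transfer:
  fixes D :: "('r, 'a) struct" and N :: "('r, 'b) struct"
  assumes tr: "\<And>\<phi>. \<phi> \<in> sentences \<Sigma> \<Longrightarrow> true_in D \<phi> \<Longrightarrow> true_in N \<phi>"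
    and D: "\<And>xs x. xs \<in> interp D R \<Longrightarrow> x \<in> set xs \<Longrightarrow> [x] \<in> interp D P"
    and R: "\<Sigma> R = Some n" and P: "\<Sigma> P = Some 1" and N: "is_struct \<Sigma> N"
    and xs: "xs \<in> interp N R" and x: "x \<in> set xs"
  shows "[x] \<in> interp N P"
proof (rule ccontr)
  assume neg: "[x] \<notin> interp N P"
  have len: "length xs = n" and sub: "set xs \<subseteq> univ N" using N R xs by (auto simp: is_struct_def)
  obtain k where k: "k < n" "xs ! k = x" using x len by (auto simp: in_set_conv_nth)
  let ?\<psi> = "Conj (Rel R [0..<n]) (Neg (Rel P [k]))"
  let ?\<phi> = "Neg (foldr Exists [0..<n] ?\<psi>)"
  have \<phi>: "?\<phi> \<in> sentences \<Sigma>"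
    using k R P by (auto simp: sentences_def formulas_def fv_foldr_Exists in_lang_foldr_Exists)
  have "sat D s ?\<phi>" for s
    using D[of "map _ [0..<n]"] k by (auto simp: sat_foldr_Exists)
  then have "true_in N ?\<phi>" using tr[OF \<phi>] by (simp add: true_in_def)
  then have f: "\<not> sat N (\<lambda>_. x) (foldr Exists [0..<n] ?\<psi>)" by (simp add: true_in_def)
  let ?t = "\<lambda>i. if i < n then xs ! i else x"
  have "map ?t [0..<n] = xs" using len by (intro nth_equalityI) auto
  then have "sat N ?t ?\<psi>" using k xs neg by simp
  moreover have "?t i \<in> univ N" if "i < n" for i using that len sub nth_mem by fastforce
  ultimately have "sat N (\<lambda>_. x) (foldr Exists [0..<n] ?\<psi>)"
    unfolding sat_foldr_Exists by (intro exI[of _ ?t]) auto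
  then show False using f by blast
qed

lemma true_in_relat:
  assumes "\<phi> \<in> sentences \<Sigma>\<^sub>0" "\<Sigma>\<^sub>0 \<subseteq>\<^sub>m \<Sigma>" "\<Sigma> P = Some 1"
  shows "relat P \<phi> \<in> sentences \<Sigma>" "true_in N (relat P \<phi>) \<longleftrightarrow> true_in (restr P \<Sigma>\<^sub>0 N) \<phi>"
proof -
  have \<phi>: "in_lang \<Sigma>\<^sub>0 \<phi>" "fv \<phi> = {}" using assms(1) by (auto simp: sentences_def formulas_def)
  show "relat P \<phi> \<in> sentences \<Sigma>"
    using \<phi> in_lang_relat[OF \<phi>(1) assms(2,3)] by (simp add: sentences_def formulas_def)
  have "sat N s (relat P \<phi>) \<longleftrightarrow> sat (restr P \<Sigma>\<^sub>0 N) s \<phi>" for s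
    by (rule sat_relat[OF \<phi>(1)]) (simp add: \<phi>(2))
  then show "true_in N (relat P \<phi>) \<longleftrightarrow> true_in (restr P \<Sigma>\<^sub>0 N) \<phi>" by (simp add: true_in_def)
qed

context two_languages
begin

lemma decomposed_transfer:
  fixes D :: "('r, 'a) struct" and N :: "('r, 'b) struct"
  assumes D: "decomposed D" and N: "is_struct \<Sigma> N"
    and tr: "\<And>\<phi>. \<phi> \<in> sentences \<Sigma> \<Longrightarrow> true_in D \<phi> \<Longrightarrow> true_in N \<phi>"
  shows "decomposed N"
proof -
  have UD: "([a] \<in> interp D P\<^sub>1) \<noteq> ([a] \<in> interp D P\<^sub>2)" if "a \<in> univ D" for a
    unfolding interp_P[OF that] using decomposedD(2)[OF D] decomposedD(3)[OF D, of a] that by blast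
  \<comment> \<open>In this order: the two predicates cover the universe, they are disjoint, and
    neither is empty.\<close>
  let ?\<phi>1 = "Neg (Exists 0 (Conj (Neg (Rel P\<^sub>1 [0])) (Neg (Rel P\<^sub>2 [0]))))"
  let ?\<phi>2 = "Neg (Exists 0 (Conj (Rel P\<^sub>1 [0]) (Rel P\<^sub>2 [0])))"
  let ?\<phi>3 = "Exists 0 (Rel P\<^sub>1 [0])" and ?\<phi>4 = "Exists 0 (Rel P\<^sub>2 [0])"
  have "true_in D ?\<phi>1" "true_in D ?\<phi>2" "true_in D ?\<phi>3" "true_in D ?\<phi>4"
    using UD decomposedD(4,5)[OF D] by (auto simp: true_in_def univ_restr)
  then have "true_in N ?\<phi>1" "true_in N ?\<phi>2" "true_in N ?\<phi>3" "true_in N ?\<phi>4"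
    by (auto intro!: tr simp: sentences_def formulas_def \<Sigma>_simps(1,2) simp del: One_nat_def)
  then have U: "univ N = univ (r\<^sub>1 N) \<union> univ (r\<^sub>2 N)" "univ (r\<^sub>1 N) \<inter> univ (r\<^sub>2 N) = {}"
      "univ (r\<^sub>1 N) \<noteq> {}" "univ (r\<^sub>2 N) \<noteq> {}"
    by (auto simp: true_in_def univ_restr)
  have 1: "interp N R \<subseteq> lists (univ (r\<^sub>1 N))" if R: "R \<in> dom \<Sigma>\<^sub>1" for R
  proof
    fix xs assume xs: "xs \<in> interp N R"
    obtain n where n: "\<Sigma> R = Some n" using R \<Sigma>_simps(3)[OF R] by auto
    have "[x] \<in> interp D P\<^sub>1" if "ys \<in> interp D R" "x \<in> set ys" for ys x
      using that decomposedD(6)[OF D R, of ys] by (auto simp: interp_restr univ_restr split: if_splits)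
    then have "[x] \<in> interp N P\<^sub>1" if "x \<in> set xs" for x
      using relation_within_transfer[OF tr _ n \<Sigma>_simps(1) N xs that] by blast
    moreover have "set xs \<subseteq> univ N" using N xs by (auto simp: is_struct_def)
    ultimately show "xs \<in> lists (univ (r\<^sub>1 N))" by (auto simp: univ_restr)
  qed
  have 2: "interp N R \<subseteq> lists (univ (r\<^sub>2 N))" if R: "R \<in> dom \<Sigma>\<^sub>2" for R
  proof
    fix xs assume xs: "xs \<in> interp N R"
    obtain n where n: "\<Sigma> R = Some n" using R \<Sigma>_simps(4)[OF R] by auto
    have "[x] \<in> interp D P\<^sub>2" if "ys \<in> interp D R" "x \<in> set ys" for ys x
      using that decomposedD(7)[OF D R, of ys] by (auto simp: interp_restr univ_restr split: if_splits)
    then have "[x] \<in> interp N P\<^sub>2" if "x \<in> set xs" for x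
      using relation_within_transfer[OF tr _ n \<Sigma>_simps(2) N xs that] by blast
    moreover have "set xs \<subseteq> univ N" using N xs by (auto simp: is_struct_def)
    ultimately show "xs \<in> lists (univ (r\<^sub>2 N))" by (auto simp: univ_restr)
  qed
  show ?thesis unfolding decomposed_def using N U 1 2 by blast
qed

text \<open>From left to right, being decomposed and satisfying the relativized axioms are expressed
  by sentences true in the union. From right to left, completeness makes corresponding components
  elementarily equivalent, and \<open>sat_transfer\<close> lifts this to the whole
  structures.\<close>

lemma model_Th_dunion:
  fixes M\<^sub>1 :: "('r, 'a) struct" and M\<^sub>2 :: "('r, 'b) struct" and N :: "'r cstruct"
  assumes cnt: "countable (dom \<Sigma>\<^sub>1)" "countable (dom \<Sigma>\<^sub>2)"
    and T\<^sub>1: "complete_theory \<Sigma>\<^sub>1 T\<^sub>1" and T\<^sub>2: "complete_theory \<Sigma>\<^sub>2 T\<^sub>2"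
    and M\<^sub>1: "model \<Sigma>\<^sub>1 T\<^sub>1 M\<^sub>1" and M\<^sub>2: "model \<Sigma>\<^sub>2 T\<^sub>2 M\<^sub>2"
  shows "model \<Sigma> (Th \<Sigma> (dunion P\<^sub>1 P\<^sub>2 M\<^sub>1 M\<^sub>2)) N \<longleftrightarrow>
    decomposed N \<and> model \<Sigma>\<^sub>1 T\<^sub>1 (r\<^sub>1 N) \<and> model \<Sigma>\<^sub>2 T\<^sub>2 (r\<^sub>2 N)"
proof -
  define D where "D = dunion P\<^sub>1 P\<^sub>2 M\<^sub>1 M\<^sub>2"
  have D: "D = glue P\<^sub>1 P\<^sub>2 Inl Inr M\<^sub>1 M\<^sub>2" by (simp add: D_def dunion_eq_glue)
  have st: "is_struct \<Sigma>\<^sub>1 M\<^sub>1" "is_struct \<Sigma>\<^sub>2 M\<^sub>2" using M\<^sub>1 M\<^sub>2 by (auto simp: model_def)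
  have dD: "decomposed D" unfolding D using st by (rule decomposed_glue) auto
  have S: "T\<^sub>1 \<subseteq> sentences \<Sigma>\<^sub>1" "T\<^sub>2 \<subseteq> sentences \<Sigma>\<^sub>2" using T\<^sub>1 T\<^sub>2 by (auto simp: complete_theory_def)
  have m1: "model \<Sigma>\<^sub>1 T\<^sub>1 (r\<^sub>1 D)" unfolding D restr_glue[OF st] using M\<^sub>1 S(1) by (rule model_copy) simp
  have m2: "model \<Sigma>\<^sub>2 T\<^sub>2 (r\<^sub>2 D)" unfolding D restr_glue[OF st] using M\<^sub>2 S(2) by (rule model_copy) simp
  have "model \<Sigma> (Th \<Sigma> D) N \<longleftrightarrow> decomposed N \<and> model \<Sigma>\<^sub>1 T\<^sub>1 (r\<^sub>1 N) \<and> model \<Sigma>\<^sub>2 T\<^sub>2 (r\<^sub>2 N)"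
  proof
    assume N: "model \<Sigma> (Th \<Sigma> D) N"
    then have stN: "is_struct \<Sigma> N" and tr: "\<phi> \<in> sentences \<Sigma> \<Longrightarrow> true_in D \<phi> \<Longrightarrow> true_in N \<phi>" for \<phi>
      by (auto simp: model_def Th_def)
    have dN: "decomposed N" using dD stN tr by (rule decomposed_transfer)
    have "true_in (r\<^sub>1 N) \<phi>" if "\<phi> \<in> T\<^sub>1" for \<phi>
    proof -
      have \<phi>: "\<phi> \<in> sentences \<Sigma>\<^sub>1" using S that by blast
      note rel = true_in_relat[OF \<phi> \<Sigma>_sub(1) \<Sigma>_simps(1)]
      have "true_in (r\<^sub>1 D) \<phi>" using m1 that by (simp add: model_def)
      then show ?thesis using tr[OF rel(1)] by (simp add: rel(2))
    qed
    moreover have "true_in (r\<^sub>2 N) \<phi>" if "\<phi> \<in> T\<^sub>2" for \<phi>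
    proof -
      have \<phi>: "\<phi> \<in> sentences \<Sigma>\<^sub>2" using S that by blast
      note rel = true_in_relat[OF \<phi> \<Sigma>_sub(2) \<Sigma>_simps(2)]
      have "true_in (r\<^sub>2 D) \<phi>" using m2 that by (simp add: model_def)
      then show ?thesis using tr[OF rel(1)] by (simp add: rel(2))
    qed
    ultimately show "decomposed N \<and> model \<Sigma>\<^sub>1 T\<^sub>1 (r\<^sub>1 N) \<and> model \<Sigma>\<^sub>2 T\<^sub>2 (r\<^sub>2 N)"
      using dN is_struct_components[OF dN] by (simp add: model_def)
  next
    assume N: "decomposed N \<and> model \<Sigma>\<^sub>1 T\<^sub>1 (r\<^sub>1 N) \<and> model \<Sigma>\<^sub>2 T\<^sub>2 (r\<^sub>2 N)"
    have "true_in N \<phi>" if "\<phi> \<in> Th \<Sigma> D" for \<phi>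
    proof -
      have \<phi>: "\<phi> \<in> sentences \<Sigma>" "true_in D \<phi>" using that by (auto simp: Th_def)
      then have l: "in_lang \<Sigma> \<phi>" "fv \<phi> = {}" by (auto simp: sentences_def formulas_def)
      \<comment> \<open>A sentence has no free variables, so the assignments and the distribution
        \<open>\<sigma>\<close> may be arbitrary.\<close>
      have "sat N undefined \<phi> \<longleftrightarrow> sat D undefined \<phi>"
      proof (rule sat_transfer[OF _ dD l(1), where \<sigma> = "\<lambda>_. True"])
        show "decomposed N" using N by blast
        fix \<alpha> :: "'r fm"
        { assume "in_lang \<Sigma>\<^sub>1 \<alpha>" "fv \<alpha> \<subseteq> {i \<in> fv \<phi>. True}"
          then have \<alpha>: "\<alpha> \<in> sentences \<Sigma>\<^sub>1" using l(2) by (auto simp: sentences_def formulas_def)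
          show "sat (r\<^sub>1 N) undefined \<alpha> \<longleftrightarrow> sat (r\<^sub>1 D) undefined \<alpha>"
            unfolding sat_sentence[OF \<alpha>] using complete_true_in[OF T\<^sub>1 cnt(1) m1 _ \<alpha>] N by blast }
        { assume "in_lang \<Sigma>\<^sub>2 \<alpha>" "fv \<alpha> \<subseteq> {i \<in> fv \<phi>. \<not> True}"
          then have \<alpha>: "\<alpha> \<in> sentences \<Sigma>\<^sub>2" using l(2) by (auto simp: sentences_def formulas_def)
          show "sat (r\<^sub>2 N) undefined \<alpha> \<longleftrightarrow> sat (r\<^sub>2 D) undefined \<alpha>"
            unfolding sat_sentence[OF \<alpha>] using complete_true_in[OF T\<^sub>2 cnt(2) m2 _ \<alpha>] N by blast }
      qed (simp_all add: l(2))
      then show ?thesis using \<phi>(2) by (simp add: sat_sentence[OF \<phi>(1)])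
    qed
    moreover have "is_struct \<Sigma> N" using N decomposedD(1) by blast
    ultimately show "model \<Sigma> (Th \<Sigma> D) N" by (simp add: model_def)
  qed
  then show ?thesis by (simp add: D_def)
qed

end

section \<open>Order theory of products and counting of isomorphism types\<close>

section \<open>Lattices and products\<close>

definition poset :: "'a gorder \<Rightarrow> bool" where
  "poset L \<longleftrightarrow> (\<forall>x\<in>carrier L. x \<sqsubseteq>\<^bsub>L\<^esub> x) \<and>
     (\<forall>x\<in>carrier L. \<forall>y\<in>carrier L. x \<sqsubseteq>\<^bsub>L\<^esub> y \<longrightarrow> y \<sqsubseteq>\<^bsub>L\<^esub> x \<longrightarrow> x = y) \<and>
     (\<forall>x\<in>carrier L. \<forall>y\<in>carrier L. \<forall>z\<in>carrier L. x \<sqsubseteq>\<^bsub>L\<^esub> y \<longrightarrow> y \<sqsubseteq>\<^bsub>L\<^esub> z \<longrightarrow> x \<sqsubseteq>\<^bsub>L\<^esub> z)"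

text \<open>Joins and meets of the library are choice terms that are meaningful only where bounds
  exist. The relational form splits over products before existence is known.\<close>

definition lub :: "'a gorder \<Rightarrow> 'a \<Rightarrow> 'a \<Rightarrow> 'a \<Rightarrow> bool" where
  "lub L x y s \<longleftrightarrow> s \<in> carrier L \<and> x \<sqsubseteq>\<^bsub>L\<^esub> s \<and> y \<sqsubseteq>\<^bsub>L\<^esub> s \<and>
     (\<forall>u\<in>carrier L. x \<sqsubseteq>\<^bsub>L\<^esub> u \<longrightarrow> y \<sqsubseteq>\<^bsub>L\<^esub> u \<longrightarrow> s \<sqsubseteq>\<^bsub>L\<^esub> u)"

definition glb :: "'a gorder \<Rightarrow> 'a \<Rightarrow> 'a \<Rightarrow> 'a \<Rightarrow> bool" where
  "glb L x y s \<longleftrightarrow> s \<in> carrier L \<and> s \<sqsubseteq>\<^bsub>L\<^esub> x \<and> s \<sqsubseteq>\<^bsub>L\<^esub> y \<and>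
     (\<forall>u\<in>carrier L. u \<sqsubseteq>\<^bsub>L\<^esub> x \<longrightarrow> u \<sqsubseteq>\<^bsub>L\<^esub> y \<longrightarrow> u \<sqsubseteq>\<^bsub>L\<^esub> s)"

lemma least_Upper_pair:
  "x \<in> carrier L \<Longrightarrow> y \<in> carrier L \<Longrightarrow> least L s (Upper L {x, y}) \<longleftrightarrow> lub L x y s"
  unfolding least_def Upper_def lub_def by auto

lemma greatest_Lower_pair:
  "x \<in> carrier L \<Longrightarrow> y \<in> carrier L \<Longrightarrow> greatest L s (Lower L {x, y}) \<longleftrightarrow> glb L x y s"
  unfolding greatest_def Lower_def glb_def by auto

lemma partial_order_iff:
  assumes "eq L = (=)"
  shows "partial_order L \<longleftrightarrow> poset L"
proof
  assume "partial_order L"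
  then interpret partial_order L .
  show "poset L" unfolding poset_def using le_antisym le_trans by blast
next
  assume L: "poset L"
  have r: "x \<sqsubseteq>\<^bsub>L\<^esub> x" if "x \<in> carrier L" for x using L that unfolding poset_def by blast
  have as: "x = y" if "x \<sqsubseteq>\<^bsub>L\<^esub> y" "y \<sqsubseteq>\<^bsub>L\<^esub> x" "x \<in> carrier L" "y \<in> carrier L" for x y
    using L that unfolding poset_def by blast
  have t: "x \<sqsubseteq>\<^bsub>L\<^esub> z" if "x \<sqsubseteq>\<^bsub>L\<^esub> y" "y \<sqsubseteq>\<^bsub>L\<^esub> z" "x \<in> carrier L" "y \<in> carrier L" "z \<in> carrier L" for x y z
    using L that unfolding poset_def by blast
  show "partial_order L"
  proof unfold_locales
    show "x \<sqsubseteq>\<^bsub>L\<^esub> z" if "x \<sqsubseteq>\<^bsub>L\<^esub> y" "y \<sqsubseteq>\<^bsub>L\<^esub> z" "x \<in> carrier L" "y \<in> carrier L" "z \<in> carrier L" for x y z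
      using that by (rule t)
    show "x .=\<^bsub>L\<^esub> y" if "x \<sqsubseteq>\<^bsub>L\<^esub> y" "y \<sqsubseteq>\<^bsub>L\<^esub> x" "x \<in> carrier L" "y \<in> carrier L" for x y
      using as[OF that] by (simp add: assms)
  qed (simp_all add: assms r)
qed

lemma lattice_iff:
  assumes "eq L = (=)"
  shows "lattice L \<longleftrightarrow> poset L \<and> (\<forall>x\<in>carrier L. \<forall>y\<in>carrier L. (\<exists>s. lub L x y s) \<and> (\<exists>s. glb L x y s))"
  unfolding lattice_def upper_semilattice_def lower_semilattice_def partial_order_iff[OF assms]
    upper_semilattice_axioms_def lower_semilattice_axioms_def
  by (auto simp: least_Upper_pair greatest_Lower_pair)

lemma lub_unique: "poset L \<Longrightarrow> lub L x y s \<Longrightarrow> lub L x y t \<Longrightarrow> s = t"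
  unfolding poset_def lub_def by blast

lemma glb_unique: "poset L \<Longrightarrow> glb L x y s \<Longrightarrow> glb L x y t \<Longrightarrow> s = t"
  unfolding poset_def glb_def by blast

lemma join_eq:
  assumes "poset L" "x \<in> carrier L" "y \<in> carrier L" "lub L x y s"
  shows "x \<squnion>\<^bsub>L\<^esub> y = s"
  unfolding join_def sup_def least_Upper_pair[OF assms(2,3)]
  by (rule some_equality[where P = "lub L x y", OF assms(4)]) (rule lub_unique[OF assms(1) _ assms(4)])

lemma meet_eq:
  assumes "poset L" "x \<in> carrier L" "y \<in> carrier L" "glb L x y s"
  shows "x \<sqinter>\<^bsub>L\<^esub> y = s"
  unfolding meet_def inf_def greatest_Lower_pair[OF assms(2,3)]
  by (rule some_equality[where P = "glb L x y", OF assms(4)]) (rule glb_unique[OF assms(1) _ assms(4)])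

lemma bounded_lattice_iff:
  assumes "eq L = (=)"
  shows "bounded_lattice L \<longleftrightarrow> lattice L \<and> (\<exists>b. least L b (carrier L)) \<and> (\<exists>t. greatest L t (carrier L))"
proof
  assume "bounded_lattice L"
  then interpret bounded_lattice L .
  show "lattice L \<and> (\<exists>b. least L b (carrier L)) \<and> (\<exists>t. greatest L t (carrier L))"
    using lattice_axioms bottom_exists top_exists by blast
next
  assume L: "lattice L \<and> (\<exists>b. least L b (carrier L)) \<and> (\<exists>t. greatest L t (carrier L))"
  then interpret lattice L by blast
  show "bounded_lattice L" using L by unfold_locales auto
qed

lemma bottom_equality:
  assumes "poset L" "least L b (carrier L)"
  shows "\<bottom>\<^bsub>L\<^esub> = b"
  unfolding bottom_def using assms(2)
  by (rule some_equality) (use assms in \<open>auto simp: poset_def least_def\<close>)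

lemma top_equality:
  assumes "poset L" "greatest L t (carrier L)"
  shows "\<top>\<^bsub>L\<^esub> = t"
  unfolding top_def using assms(2)
  by (rule some_equality) (use assms in \<open>auto simp: poset_def greatest_def\<close>)

text \<open>An empty factor would make the product empty and erase all information about the other
  factor, so the equivalences for lattices require both to be nonempty.\<close>

locale nonempty_product =
  fixes A :: "'a gorder" and B :: "'b gorder"
  assumes eqA: "eq A = (=)" and eqB: "eq B = (=)" and neA: "carrier A \<noteq> {}" and neB: "carrier B \<noteq> {}"
begin

abbreviation AB where "AB \<equiv> preorder_prod A B"

lemma carrier_AB: "carrier AB = carrier A \<times> carrier B"
  and le_AB: "(x, x') \<sqsubseteq>\<^bsub>AB\<^esub> (y, y') \<longleftrightarrow> x \<sqsubseteq>\<^bsub>A\<^esub> y \<and> x' \<sqsubseteq>\<^bsub>B\<^esub> y'"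
  and eq_AB: "eq AB = (=)"
  by (simp_all add: preorder_prod_def)

lemma poset_AB: "poset AB \<longleftrightarrow> poset A \<and> poset B"
proof
  assume P: "poset AB"
  \<comment> \<open>Fixing an element of the other factor places each factor as a row in the
    product.\<close>
  obtain a b where ab: "a \<in> carrier A" "b \<in> carrier B" using neA neB by blast
  have r: "x \<sqsubseteq>\<^bsub>A\<^esub> x" "y \<sqsubseteq>\<^bsub>B\<^esub> y" if "x \<in> carrier A" "y \<in> carrier B" for x y
    using P that unfolding poset_def carrier_AB by (auto simp: le_AB)
  have t: "(x, x') \<sqsubseteq>\<^bsub>AB\<^esub> (y, y') \<Longrightarrow> (y, y') \<sqsubseteq>\<^bsub>AB\<^esub> (z, z') \<Longrightarrow> (x, x') \<sqsubseteq>\<^bsub>AB\<^esub> (z, z')"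
    and as: "(x, x') \<sqsubseteq>\<^bsub>AB\<^esub> (y, y') \<Longrightarrow> (y, y') \<sqsubseteq>\<^bsub>AB\<^esub> (x, x') \<Longrightarrow> (x, x') = (y, y')"
    if "x \<in> carrier A" "y \<in> carrier A" "z \<in> carrier A" "x' \<in> carrier B" "y' \<in> carrier B" "z' \<in> carrier B"
    for x y z x' y' z'
    using P that unfolding poset_def carrier_AB by blast+
  have "poset A" unfolding poset_def
  proof (intro conjI ballI impI)
    show "x \<sqsubseteq>\<^bsub>A\<^esub> x" if "x \<in> carrier A" for x using r that ab by blast
    show "x = y" if "x \<in> carrier A" "y \<in> carrier A" "x \<sqsubseteq>\<^bsub>A\<^esub> y" "y \<sqsubseteq>\<^bsub>A\<^esub> x" for x y
      using as[of x y x b b b] that ab r by (simp add: le_AB)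
    show "x \<sqsubseteq>\<^bsub>A\<^esub> z" if "x \<in> carrier A" "y \<in> carrier A" "z \<in> carrier A" "x \<sqsubseteq>\<^bsub>A\<^esub> y" "y \<sqsubseteq>\<^bsub>A\<^esub> z" for x y z
      using t[of x y z b b b] that ab r by (simp add: le_AB)
  qed
  moreover have "poset B" unfolding poset_def
  proof (intro conjI ballI impI)
    show "x \<sqsubseteq>\<^bsub>B\<^esub> x" if "x \<in> carrier B" for x using r that ab by blast
    show "x = y" if "x \<in> carrier B" "y \<in> carrier B" "x \<sqsubseteq>\<^bsub>B\<^esub> y" "y \<sqsubseteq>\<^bsub>B\<^esub> x" for x y
      using as[of a a a x y x] that ab r by (simp add: le_AB)
    show "x \<sqsubseteq>\<^bsub>B\<^esub> z" if "x \<in> carrier B" "y \<in> carrier B" "z \<in> carrier B" "x \<sqsubseteq>\<^bsub>B\<^esub> y" "y \<sqsubseteq>\<^bsub>B\<^esub> z" for x y z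
      using t[of a a a x y z] that ab r by (simp add: le_AB)
  qed
  ultimately show "poset A \<and> poset B" by blast
next
  assume "poset A \<and> poset B"
  then show "poset AB" unfolding poset_def carrier_AB by (simp add: Ball_def le_AB) blast
qed

lemma lub_AB: "lub AB (x, x') (y, y') (s, s') \<longleftrightarrow> lub A x y s \<and> lub B x' y' s'"
  unfolding lub_def carrier_AB by (auto simp: le_AB)

lemma glb_AB: "glb AB (x, x') (y, y') (s, s') \<longleftrightarrow> glb A x y s \<and> glb B x' y' s'"
  unfolding glb_def carrier_AB by (auto simp: le_AB)

lemma least_AB: "least AB (b, b') (carrier AB) \<longleftrightarrow> least A b (carrier A) \<and> least B b' (carrier B)"
  unfolding least_def carrier_AB using neA neB by (auto simp: le_AB)

lemma greatest_AB: "greatest AB (b, b') (carrier AB) \<longleftrightarrow> greatest A b (carrier A) \<and> greatest B b' (carrier B)"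
  unfolding greatest_def carrier_AB using neA neB by (auto simp: le_AB)

lemma lattice_AB: "lattice AB \<longleftrightarrow> lattice A \<and> lattice B"
proof -
  have "(\<forall>x\<in>carrier AB. \<forall>y\<in>carrier AB. (\<exists>s. lub AB x y s) \<and> (\<exists>s. glb AB x y s)) \<longleftrightarrow>
      (\<forall>x\<in>carrier A. \<forall>y\<in>carrier A. (\<exists>s. lub A x y s) \<and> (\<exists>s. glb A x y s)) \<and>
      (\<forall>x\<in>carrier B. \<forall>y\<in>carrier B. (\<exists>s. lub B x y s) \<and> (\<exists>s. glb B x y s))"
    unfolding carrier_AB using neA neB by (simp add: split_paired_Ex lub_AB glb_AB) blast
  then show ?thesis
    unfolding lattice_iff[OF eqA] lattice_iff[OF eqB] lattice_iff[OF eq_AB] poset_AB by blast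
qed

lemma bounded_lattice_AB: "bounded_lattice AB \<longleftrightarrow> bounded_lattice A \<and> bounded_lattice B"
  unfolding bounded_lattice_iff[OF eqA] bounded_lattice_iff[OF eqB] bounded_lattice_iff[OF eq_AB] lattice_AB
    split_paired_Ex least_AB greatest_AB by blast

text \<open>The operations of the product are componentwise only once all joins, meets and bounds
  exist; hence the case distinction on bounded lattices comes first.\<close>

lemma boolean_lattice_AB: "boolean_lattice AB \<longleftrightarrow> boolean_lattice A \<and> boolean_lattice B"
proof (cases "bounded_lattice A \<and> bounded_lattice B")
  case False
  then show ?thesis unfolding boolean_lattice_def bounded_lattice_AB by blast
next
  case True
  then interpret A: bounded_lattice A by blast
  interpret B: bounded_lattice B using True by blast
  have po: "poset A" "poset B" "poset AB"
    using A.partial_order_axioms B.partial_order_axioms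
    unfolding poset_AB partial_order_iff[OF eqA] partial_order_iff[OF eqB] by blast+
  have join: "(x, x') \<squnion>\<^bsub>AB\<^esub> (y, y') = (x \<squnion>\<^bsub>A\<^esub> y, x' \<squnion>\<^bsub>B\<^esub> y')"
    and meet: "(x, x') \<sqinter>\<^bsub>AB\<^esub> (y, y') = (x \<sqinter>\<^bsub>A\<^esub> y, x' \<sqinter>\<^bsub>B\<^esub> y')"
    if xy: "x \<in> carrier A" "y \<in> carrier A" "x' \<in> carrier B" "y' \<in> carrier B" for x y x' y'
  proof -
    obtain s s' where s: "lub A x y s" "lub B x' y' s'"
      using A.sup_of_two_exists B.sup_of_two_exists xy by (metis least_Upper_pair)
    then show "(x, x') \<squnion>\<^bsub>AB\<^esub> (y, y') = (x \<squnion>\<^bsub>A\<^esub> y, x' \<squnion>\<^bsub>B\<^esub> y')"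
      using join_eq[OF po(1) xy(1,2) s(1)] join_eq[OF po(2) xy(3,4) s(2)]
        join_eq[OF po(3), of "(x, x')" "(y, y')" "(s, s')"] xy
      by (simp add: carrier_AB lub_AB)
    obtain t t' where t: "glb A x y t" "glb B x' y' t'"
      using A.inf_of_two_exists B.inf_of_two_exists xy by (metis greatest_Lower_pair)
    then show "(x, x') \<sqinter>\<^bsub>AB\<^esub> (y, y') = (x \<sqinter>\<^bsub>A\<^esub> y, x' \<sqinter>\<^bsub>B\<^esub> y')"
      using meet_eq[OF po(1) xy(1,2) t(1)] meet_eq[OF po(2) xy(3,4) t(2)]
        meet_eq[OF po(3), of "(x, x')" "(y, y')" "(t, t')"] xy
      by (simp add: carrier_AB glb_AB)
  qed
  have bot: "\<bottom>\<^bsub>AB\<^esub> = (\<bottom>\<^bsub>A\<^esub>, \<bottom>\<^bsub>B\<^esub>)"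
    by (rule bottom_equality[OF po(3)]) (simp add: least_AB A.bottom_least B.bottom_least)
  have top: "\<top>\<^bsub>AB\<^esub> = (\<top>\<^bsub>A\<^esub>, \<top>\<^bsub>B\<^esub>)"
    by (rule top_equality[OF po(3)]) (simp add: greatest_AB A.top_greatest B.top_greatest)
  have "(\<forall>x\<in>carrier AB. \<forall>y\<in>carrier AB. \<forall>z\<in>carrier AB.
        x \<sqinter>\<^bsub>AB\<^esub> (y \<squnion>\<^bsub>AB\<^esub> z) = (x \<sqinter>\<^bsub>AB\<^esub> y) \<squnion>\<^bsub>AB\<^esub> (x \<sqinter>\<^bsub>AB\<^esub> z)) \<longleftrightarrow>
      (\<forall>x\<in>carrier A. \<forall>y\<in>carrier A. \<forall>z\<in>carrier A.
        x \<sqinter>\<^bsub>A\<^esub> (y \<squnion>\<^bsub>A\<^esub> z) = (x \<sqinter>\<^bsub>A\<^esub> y) \<squnion>\<^bsub>A\<^esub> (x \<sqinter>\<^bsub>A\<^esub> z)) \<and>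
      (\<forall>x\<in>carrier B. \<forall>y\<in>carrier B. \<forall>z\<in>carrier B.
        x \<sqinter>\<^bsub>B\<^esub> (y \<squnion>\<^bsub>B\<^esub> z) = (x \<sqinter>\<^bsub>B\<^esub> y) \<squnion>\<^bsub>B\<^esub> (x \<sqinter>\<^bsub>B\<^esub> z))"
    unfolding carrier_AB using neA neB by (simp add: join meet) blast
  moreover have "(\<forall>x\<in>carrier AB. \<exists>y\<in>carrier AB. x \<sqinter>\<^bsub>AB\<^esub> y = \<bottom>\<^bsub>AB\<^esub> \<and> x \<squnion>\<^bsub>AB\<^esub> y = \<top>\<^bsub>AB\<^esub>) \<longleftrightarrow>
      (\<forall>x\<in>carrier A. \<exists>y\<in>carrier A. x \<sqinter>\<^bsub>A\<^esub> y = \<bottom>\<^bsub>A\<^esub> \<and> x \<squnion>\<^bsub>A\<^esub> y = \<top>\<^bsub>A\<^esub>) \<and>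
      (\<forall>x\<in>carrier B. \<exists>y\<in>carrier B. x \<sqinter>\<^bsub>B\<^esub> y = \<bottom>\<^bsub>B\<^esub> \<and> x \<squnion>\<^bsub>B\<^esub> y = \<top>\<^bsub>B\<^esub>)"
    unfolding carrier_AB bot top using neA neB by (simp add: join meet) blast
  ultimately show ?thesis unfolding boolean_lattice_def bounded_lattice_AB by blast
qed

end

section \<open>Isomorphism types of models of the disjoint union\<close>

definition model_types :: "'r lang \<Rightarrow> 'r fm set \<Rightarrow> 'r cstruct set set" where
  "model_types \<Sigma> T = {iso_type \<Sigma> M |M :: 'r cstruct. model \<Sigma> T M}"

lemma num_models_eq: "num_models \<Sigma> T = ecard (model_types \<Sigma> T)"
  by (simp add: num_models_def model_types_def)

lemma RK_subset_model_types: "RK \<Sigma> T \<subseteq> model_types \<Sigma> T"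
  unfolding RK_eq model_types_def using prime_over_tuple_model by blast

lemma RK_class_eq:
  assumes "x \<in> RK_classes \<Sigma> T" "X \<in> x"
  shows "x = {Y \<in> RK \<Sigma> T. rk_le \<Sigma> T X Y \<and> rk_le \<Sigma> T Y X}"
proof -
  have "X \<in> RK \<Sigma> T" using assms RK_class_subset by blast
  obtain Z where Z: "x = rk_equiv \<Sigma> T `` {Z}"
    using assms(1) unfolding RK_classes_def by (rule quotientE) blast
  then have "(Z, X) \<in> rk_equiv \<Sigma> T" using assms(2) by simp
  then have "x = rk_equiv \<Sigma> T `` {X}" unfolding Z by (rule equiv_class_eq[OF equiv_rk_equiv])
  then show ?thesis using \<open>X \<in> RK \<Sigma> T\<close> by (auto simp: rk_equiv_def)
qed

lemma RK_class_of:
  assumes "X \<in> RK \<Sigma> T"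
  shows "{Y \<in> RK \<Sigma> T. rk_le \<Sigma> T X Y \<and> rk_le \<Sigma> T Y X} \<in> RK_classes \<Sigma> T"
proof -
  have "rk_equiv \<Sigma> T `` {X} \<in> RK_classes \<Sigma> T" unfolding RK_classes_def using assms by (rule quotientI)
  moreover have "rk_equiv \<Sigma> T `` {X} = {Y \<in> RK \<Sigma> T. rk_le \<Sigma> T X Y \<and> rk_le \<Sigma> T Y X}"
    using assms by (auto simp: rk_equiv_def)
  ultimately show ?thesis by simp
qed

context two_theories
begin

abbreviation \<Phi> where "\<Phi> \<equiv> dunion_type P\<^sub>1 P\<^sub>2 \<Sigma>\<^sub>1 \<Sigma>\<^sub>2"

lemma G_iso:
  assumes M: "is_struct \<Sigma>\<^sub>1 M\<^sub>1" "is_struct \<Sigma>\<^sub>2 M\<^sub>2"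
  shows "iso M\<^sub>1 (r\<^sub>1 (G M\<^sub>1 M\<^sub>2))" "iso M\<^sub>2 (r\<^sub>2 (G M\<^sub>1 M\<^sub>2))"
  unfolding iso_iff using G_components(4,5)[OF M] by blast+

text \<open>Isomorphic parts glue to isomorphic structures, whatever injections are used. The union
  over all representatives thus reduces to the type of a single structure on
  \<open>nat\<close>.\<close>

lemma dunion_type_eq:
  fixes M\<^sub>1 M\<^sub>2 :: "'r cstruct"
  assumes M: "is_struct \<Sigma>\<^sub>1 M\<^sub>1" "is_struct \<Sigma>\<^sub>2 M\<^sub>2"
  shows "\<Phi> (iso_type \<Sigma>\<^sub>1 M\<^sub>1, iso_type \<Sigma>\<^sub>2 M\<^sub>2) = iso_type \<Sigma> (G M\<^sub>1 M\<^sub>2)"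
proof -
  have "iso_type \<Sigma> (dunion P\<^sub>1 P\<^sub>2 A B) = iso_type \<Sigma> (G M\<^sub>1 M\<^sub>2)"
    if A: "A \<in> iso_type \<Sigma>\<^sub>1 M\<^sub>1" and B: "B \<in> iso_type \<Sigma>\<^sub>2 M\<^sub>2" for A B
  proof -
    let ?D = "glue P\<^sub>1 P\<^sub>2 Inl Inr A B"
    have st: "is_struct \<Sigma>\<^sub>1 A" "is_struct \<Sigma>\<^sub>2 B" and iA: "iso M\<^sub>1 A" and iB: "iso M\<^sub>2 B"
      using A B by (auto simp: iso_type_def)
    have d: "decomposed ?D" using st by (rule decomposed_glue) auto
    have i1: "iso (r\<^sub>1 ?D) (r\<^sub>1 (G M\<^sub>1 M\<^sub>2))"
    proof -
      have "iso_via Inl A (r\<^sub>1 ?D)" unfolding restr_glue[OF st] using st(1) by (intro iso_via_copy) simp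
      then have "iso A (r\<^sub>1 ?D)" by (auto simp: iso_iff)
      then show ?thesis using iso_trans[OF iso_sym[OF iso_trans[OF iA]] G_iso(1)[OF M]] by blast
    qed
    have i2: "iso (r\<^sub>2 ?D) (r\<^sub>2 (G M\<^sub>1 M\<^sub>2))"
    proof -
      have "iso_via Inr B (r\<^sub>2 ?D)" unfolding restr_glue[OF st] using st(2) by (intro iso_via_copy) simp
      then have "iso B (r\<^sub>2 ?D)" by (auto simp: iso_iff)
      then show ?thesis using iso_trans[OF iso_sym[OF iso_trans[OF iB]] G_iso(2)[OF M]] by blast
    qed
    have "iso ?D (G M\<^sub>1 M\<^sub>2)" by (rule iso_combine[OF d G_components(1)[OF M] i1 i2])
    then show ?thesis unfolding dunion_eq_glue by (rule iso_type_cong)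
  qed
  moreover have "M\<^sub>1 \<in> iso_type \<Sigma>\<^sub>1 M\<^sub>1" "M\<^sub>2 \<in> iso_type \<Sigma>\<^sub>2 M\<^sub>2" using M by (auto simp: iso_type_def)
  ultimately show ?thesis unfolding dunion_type.simps by blast
qed

lemma iso_type_model:
  fixes N :: "'r cstruct"
  assumes "model \<Sigma> T N"
  shows "iso_type \<Sigma> N = \<Phi> (iso_type \<Sigma>\<^sub>1 (r\<^sub>1 N), iso_type \<Sigma>\<^sub>2 (r\<^sub>2 N))"
proof -
  have dN: "decomposed N" and st: "is_struct \<Sigma>\<^sub>1 (r\<^sub>1 N)" "is_struct \<Sigma>\<^sub>2 (r\<^sub>2 N)"
    using assms is_struct_components by (auto simp: model_T)
  have "iso N (G (r\<^sub>1 N) (r\<^sub>2 N))" by (rule iso_combine[OF dN G_components(1)[OF st] G_iso[OF st]])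
  then show ?thesis unfolding dunion_type_eq[OF st] by (rule iso_type_cong)
qed

text \<open>The unary predicates let an isomorphism of the glued structures be restricted to both
  parts.\<close>

lemma dunion_type_eq_iff:
  fixes M\<^sub>1 M\<^sub>2 N\<^sub>1 N\<^sub>2 :: "'r cstruct"
  assumes M: "is_struct \<Sigma>\<^sub>1 M\<^sub>1" "is_struct \<Sigma>\<^sub>2 M\<^sub>2" and N: "is_struct \<Sigma>\<^sub>1 N\<^sub>1" "is_struct \<Sigma>\<^sub>2 N\<^sub>2"
    and eq: "\<Phi> (iso_type \<Sigma>\<^sub>1 M\<^sub>1, iso_type \<Sigma>\<^sub>2 M\<^sub>2) = \<Phi> (iso_type \<Sigma>\<^sub>1 N\<^sub>1, iso_type \<Sigma>\<^sub>2 N\<^sub>2)"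
  shows "iso_type \<Sigma>\<^sub>1 M\<^sub>1 = iso_type \<Sigma>\<^sub>1 N\<^sub>1 \<and> iso_type \<Sigma>\<^sub>2 M\<^sub>2 = iso_type \<Sigma>\<^sub>2 N\<^sub>2"
proof -
  have "iso (G M\<^sub>1 M\<^sub>2) (G N\<^sub>1 N\<^sub>2)"
    using eq iso_type_eq_iff[OF decomposedD(1)[OF G_components(1)[OF N]]] unfolding dunion_type_eq[OF M] dunion_type_eq[OF N] by blast
  then have "iso (r\<^sub>1 (G M\<^sub>1 M\<^sub>2)) (r\<^sub>1 (G N\<^sub>1 N\<^sub>2))" "iso (r\<^sub>2 (G M\<^sub>1 M\<^sub>2)) (r\<^sub>2 (G N\<^sub>1 N\<^sub>2))"
    by (auto intro: iso_restr)
  then have "iso M\<^sub>1 N\<^sub>1" "iso M\<^sub>2 N\<^sub>2"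
    using iso_trans[OF iso_trans[OF G_iso(1)[OF M]] iso_sym[OF G_iso(1)[OF N]]]
      iso_trans[OF iso_trans[OF G_iso(2)[OF M]] iso_sym[OF G_iso(2)[OF N]]] by blast+
  then show ?thesis by (intro conjI iso_type_cong)
qed

lemma inj_\<Phi>: "inj_on \<Phi> (model_types \<Sigma>\<^sub>1 T\<^sub>1 \<times> model_types \<Sigma>\<^sub>2 T\<^sub>2)"
proof (rule inj_onI)
  fix p p' assume p: "p \<in> model_types \<Sigma>\<^sub>1 T\<^sub>1 \<times> model_types \<Sigma>\<^sub>2 T\<^sub>2" and p': "p' \<in> model_types \<Sigma>\<^sub>1 T\<^sub>1 \<times> model_types \<Sigma>\<^sub>2 T\<^sub>2"
    and eq: "\<Phi> p = \<Phi> p'"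
  obtain M\<^sub>1 M\<^sub>2 :: "'r cstruct" where M: "p = (iso_type \<Sigma>\<^sub>1 M\<^sub>1, iso_type \<Sigma>\<^sub>2 M\<^sub>2)" "is_struct \<Sigma>\<^sub>1 M\<^sub>1" "is_struct \<Sigma>\<^sub>2 M\<^sub>2"
    using p by (auto simp: model_types_def model_def)
  obtain N\<^sub>1 N\<^sub>2 :: "'r cstruct" where N: "p' = (iso_type \<Sigma>\<^sub>1 N\<^sub>1, iso_type \<Sigma>\<^sub>2 N\<^sub>2)" "is_struct \<Sigma>\<^sub>1 N\<^sub>1" "is_struct \<Sigma>\<^sub>2 N\<^sub>2"
    using p' by (auto simp: model_types_def model_def)
  show "p = p'" using dunion_type_eq_iff[OF M(2,3) N(2,3)] eq unfolding M(1) N(1) by blast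
qed

lemma \<Phi>_model_types: "\<Phi> ` (model_types \<Sigma>\<^sub>1 T\<^sub>1 \<times> model_types \<Sigma>\<^sub>2 T\<^sub>2) = model_types \<Sigma> T"
proof
  show "model_types \<Sigma> T \<subseteq> \<Phi> ` (model_types \<Sigma>\<^sub>1 T\<^sub>1 \<times> model_types \<Sigma>\<^sub>2 T\<^sub>2)"
  proof
    fix X assume "X \<in> model_types \<Sigma> T"
    then obtain N :: "'r cstruct" where N: "X = iso_type \<Sigma> N" "model \<Sigma> T N" by (auto simp: model_types_def)
    then have "iso_type \<Sigma>\<^sub>1 (r\<^sub>1 N) \<in> model_types \<Sigma>\<^sub>1 T\<^sub>1" "iso_type \<Sigma>\<^sub>2 (r\<^sub>2 N) \<in> model_types \<Sigma>\<^sub>2 T\<^sub>2"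
      by (auto simp: model_types_def model_T)
    then show "X \<in> \<Phi> ` (model_types \<Sigma>\<^sub>1 T\<^sub>1 \<times> model_types \<Sigma>\<^sub>2 T\<^sub>2)"
      unfolding N(1) iso_type_model[OF N(2)] by blast
  qed
  show "\<Phi> ` (model_types \<Sigma>\<^sub>1 T\<^sub>1 \<times> model_types \<Sigma>\<^sub>2 T\<^sub>2) \<subseteq> model_types \<Sigma> T"
  proof
    fix X assume "X \<in> \<Phi> ` (model_types \<Sigma>\<^sub>1 T\<^sub>1 \<times> model_types \<Sigma>\<^sub>2 T\<^sub>2)"
    then obtain M\<^sub>1 M\<^sub>2 :: "'r cstruct" where M: "X = \<Phi> (iso_type \<Sigma>\<^sub>1 M\<^sub>1, iso_type \<Sigma>\<^sub>2 M\<^sub>2)" "model \<Sigma>\<^sub>1 T\<^sub>1 M\<^sub>1" "model \<Sigma>\<^sub>2 T\<^sub>2 M\<^sub>2"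
      by (auto simp: model_types_def simp del: dunion_type.simps)
    then have st: "is_struct \<Sigma>\<^sub>1 M\<^sub>1" "is_struct \<Sigma>\<^sub>2 M\<^sub>2" by (auto simp: model_def)
    show "X \<in> model_types \<Sigma> T"
      unfolding M(1) dunion_type_eq[OF st] model_types_def using model_G[OF M(2,3)] by blast
  qed
qed

lemma prime_over_tuple_G:
  assumes "prime_over_tuple \<Sigma>\<^sub>1 T\<^sub>1 M\<^sub>1" "prime_over_tuple \<Sigma>\<^sub>2 T\<^sub>2 M\<^sub>2"
  shows "prime_over_tuple \<Sigma> T (G M\<^sub>1 M\<^sub>2)"
proof -
  obtain q\<^sub>1 q\<^sub>2 where "prime_over_type \<Sigma>\<^sub>1 T\<^sub>1 q\<^sub>1 M\<^sub>1" "prime_over_type \<Sigma>\<^sub>2 T\<^sub>2 q\<^sub>2 M\<^sub>2"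
    using assms by (auto simp: prime_over_tuple_iff)
  then show ?thesis using prime_over_type_G[of q\<^sub>1 q\<^sub>2] unfolding prime_over_tuple_iff by blast
qed

lemma \<Phi>_RK: "\<Phi> ` (RK \<Sigma>\<^sub>1 T\<^sub>1 \<times> RK \<Sigma>\<^sub>2 T\<^sub>2) = RK \<Sigma> T"
proof
  show "RK \<Sigma> T \<subseteq> \<Phi> ` (RK \<Sigma>\<^sub>1 T\<^sub>1 \<times> RK \<Sigma>\<^sub>2 T\<^sub>2)"
  proof
    fix X assume "X \<in> RK \<Sigma> T"
    then obtain N where N: "X = iso_type \<Sigma> N" "prime_over_tuple \<Sigma> T N" by (auto simp: RK_eq)
    then have m: "model \<Sigma> T N" by (simp add: prime_over_tuple_model)
    then have "prime_over_tuple \<Sigma>\<^sub>1 T\<^sub>1 (r\<^sub>1 N)" "prime_over_tuple \<Sigma>\<^sub>2 T\<^sub>2 (r\<^sub>2 N)"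
      using N(2) prime_over_tuple_components by blast+
    then have "iso_type \<Sigma>\<^sub>1 (r\<^sub>1 N) \<in> RK \<Sigma>\<^sub>1 T\<^sub>1" "iso_type \<Sigma>\<^sub>2 (r\<^sub>2 N) \<in> RK \<Sigma>\<^sub>2 T\<^sub>2"
      by (auto simp: RK_eq)
    then show "X \<in> \<Phi> ` (RK \<Sigma>\<^sub>1 T\<^sub>1 \<times> RK \<Sigma>\<^sub>2 T\<^sub>2)"
      unfolding N(1) iso_type_model[OF m] by blast
  qed
  show "\<Phi> ` (RK \<Sigma>\<^sub>1 T\<^sub>1 \<times> RK \<Sigma>\<^sub>2 T\<^sub>2) \<subseteq> RK \<Sigma> T"
  proof
    fix X assume "X \<in> \<Phi> ` (RK \<Sigma>\<^sub>1 T\<^sub>1 \<times> RK \<Sigma>\<^sub>2 T\<^sub>2)"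
    then obtain M\<^sub>1 M\<^sub>2 where M: "X = \<Phi> (iso_type \<Sigma>\<^sub>1 M\<^sub>1, iso_type \<Sigma>\<^sub>2 M\<^sub>2)"
        "prime_over_tuple \<Sigma>\<^sub>1 T\<^sub>1 M\<^sub>1" "prime_over_tuple \<Sigma>\<^sub>2 T\<^sub>2 M\<^sub>2"
      by (auto simp: RK_eq simp del: dunion_type.simps)
    then have st: "is_struct \<Sigma>\<^sub>1 M\<^sub>1" "is_struct \<Sigma>\<^sub>2 M\<^sub>2" by (auto simp: prime_over_tuple_struct)
    show "X \<in> RK \<Sigma> T"
      unfolding M(1) dunion_type_eq[OF st] RK_eq using prime_over_tuple_G[OF M(2,3)] by blast
  qed
qed

lemma rk_le_\<Phi>:
  assumes "X \<in> RK \<Sigma>\<^sub>1 T\<^sub>1" "X' \<in> RK \<Sigma>\<^sub>1 T\<^sub>1" "Y \<in> RK \<Sigma>\<^sub>2 T\<^sub>2" "Y' \<in> RK \<Sigma>\<^sub>2 T\<^sub>2"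
  shows "rk_le \<Sigma> T (\<Phi> (X, Y)) (\<Phi> (X', Y')) \<longleftrightarrow> rk_le \<Sigma>\<^sub>1 T\<^sub>1 X X' \<and> rk_le \<Sigma>\<^sub>2 T\<^sub>2 Y Y'"
proof -
  obtain A A' B B' where X: "X = iso_type \<Sigma>\<^sub>1 A" "X' = iso_type \<Sigma>\<^sub>1 A'" "Y = iso_type \<Sigma>\<^sub>2 B" "Y' = iso_type \<Sigma>\<^sub>2 B'"
    and p: "prime_over_tuple \<Sigma>\<^sub>1 T\<^sub>1 A" "prime_over_tuple \<Sigma>\<^sub>1 T\<^sub>1 A'" "prime_over_tuple \<Sigma>\<^sub>2 T\<^sub>2 B" "prime_over_tuple \<Sigma>\<^sub>2 T\<^sub>2 B'"
    using assms by (auto simp: RK_eq)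
  note s = p[THEN prime_over_tuple_struct]
  have e: "embeds \<Sigma>\<^sub>1 A (r\<^sub>1 (G A B))" "embeds \<Sigma>\<^sub>1 (r\<^sub>1 (G A B)) A" "embeds \<Sigma>\<^sub>2 B (r\<^sub>2 (G A B))" "embeds \<Sigma>\<^sub>2 (r\<^sub>2 (G A B)) B"
    if "is_struct \<Sigma>\<^sub>1 A" "is_struct \<Sigma>\<^sub>2 B" for A B
    using G_iso[OF that] by (auto intro: iso_embeds iso_sym)
  have "embeds \<Sigma>\<^sub>1 (r\<^sub>1 (G A B)) (r\<^sub>1 (G A' B')) \<longleftrightarrow> embeds \<Sigma>\<^sub>1 A A'"
    using e[OF s(1,3)] e[OF s(2,4)] by (meson embeds_trans)
  moreover have "embeds \<Sigma>\<^sub>2 (r\<^sub>2 (G A B)) (r\<^sub>2 (G A' B')) \<longleftrightarrow> embeds \<Sigma>\<^sub>2 B B'"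
    using e[OF s(1,3)] e[OF s(2,4)] by (meson embeds_trans)
  ultimately show ?thesis
    unfolding X dunion_type_eq[OF s(1,3)] dunion_type_eq[OF s(2,4)] rk_le_iff[OF p(1,2)] rk_le_iff[OF p(3,4)]
      rk_le_iff[OF prime_over_tuple_G[OF p(1,3)] prime_over_tuple_G[OF p(2,4)]]
      embeds_components[OF G_components(1)[OF s(1,3)] G_components(1)[OF s(2,4)]] by blast
qed

lemma RK_preorder_iso:
  "preorder_iso (preorder_prod (RK_graph \<Sigma>\<^sub>1 T\<^sub>1) (RK_graph \<Sigma>\<^sub>2 T\<^sub>2)) (RK_graph \<Sigma> T) \<Phi>"
proof -
  have "inj_on \<Phi> (RK \<Sigma>\<^sub>1 T\<^sub>1 \<times> RK \<Sigma>\<^sub>2 T\<^sub>2)"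
    by (rule inj_on_subset[OF inj_\<Phi>]) (intro Sigma_mono RK_subset_model_types)
  then have "bij_betw \<Phi> (RK \<Sigma>\<^sub>1 T\<^sub>1 \<times> RK \<Sigma>\<^sub>2 T\<^sub>2) (RK \<Sigma> T)" using \<Phi>_RK by (simp add: bij_betw_def)
  then show ?thesis
    unfolding preorder_iso_def preorder_prod_def RK_graph_def
    by (auto simp: rk_le_\<Phi> simp del: dunion_type.simps)
qed

lemma \<Phi>_class:
  assumes x: "x \<in> RK_classes \<Sigma>\<^sub>1 T\<^sub>1" and y: "y \<in> RK_classes \<Sigma>\<^sub>2 T\<^sub>2"
  shows "\<Phi> ` (x \<times> y) \<in> RK_classes \<Sigma> T"
proof -
  obtain X Y where XY: "X \<in> x" "Y \<in> y" using RK_class_nonempty x y by blast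
  then have R: "X \<in> RK \<Sigma>\<^sub>1 T\<^sub>1" "Y \<in> RK \<Sigma>\<^sub>2 T\<^sub>2" using RK_class_subset x y by blast+
  have eq: "\<Phi> ` (x \<times> y) = {Z \<in> RK \<Sigma> T. rk_le \<Sigma> T (\<Phi> (X, Y)) Z \<and> rk_le \<Sigma> T Z (\<Phi> (X, Y))}"
    unfolding RK_class_eq[OF x XY(1)] RK_class_eq[OF y XY(2)] \<Phi>_RK[symmetric]
    using R by (auto simp: rk_le_\<Phi> simp del: dunion_type.simps)
  have "\<Phi> (X, Y) \<in> RK \<Sigma> T" using R \<Phi>_RK by blast
  then show ?thesis unfolding eq by (rule RK_class_of)
qed

lemma chain_types_\<Phi>:
  assumes x: "x \<in> RK_classes \<Sigma>\<^sub>1 T\<^sub>1" and y: "y \<in> RK_classes \<Sigma>\<^sub>2 T\<^sub>2"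
  shows "chain_types \<Sigma> T (\<Phi> ` (x \<times> y)) = \<Phi> ` (chain_types \<Sigma>\<^sub>1 T\<^sub>1 x \<times> chain_types \<Sigma>\<^sub>2 T\<^sub>2 y)"
proof
  show "chain_types \<Sigma> T (\<Phi> ` (x \<times> y)) \<subseteq> \<Phi> ` (chain_types \<Sigma>\<^sub>1 T\<^sub>1 x \<times> chain_types \<Sigma>\<^sub>2 T\<^sub>2 y)"
  proof
    fix Z assume "Z \<in> chain_types \<Sigma> T (\<Phi> ` (x \<times> y))"
    then obtain N q K where Z: "Z = iso_type \<Sigma> N" and K: "prime_over_type \<Sigma> T q K" "iso_type \<Sigma> K \<in> \<Phi> ` (x \<times> y)"
      and N: "chain_over \<Sigma> T q N"
      unfolding chain_types_def by blast
    obtain q\<^sub>1 where q\<^sub>1: "chain_over \<Sigma>\<^sub>1 T\<^sub>1 q\<^sub>1 (r\<^sub>1 N)" "prime_over_type \<Sigma>\<^sub>1 T\<^sub>1 q\<^sub>1 (r\<^sub>1 K)"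
      using chain_component\<^sub>1[OF N] K(1) by blast
    obtain q\<^sub>2 where q\<^sub>2: "chain_over \<Sigma>\<^sub>2 T\<^sub>2 q\<^sub>2 (r\<^sub>2 N)" "prime_over_type \<Sigma>\<^sub>2 T\<^sub>2 q\<^sub>2 (r\<^sub>2 K)"
      using chain_component\<^sub>2[OF N] K(1) by blast
    have mK: "model \<Sigma> T K" and mN: "model \<Sigma> T N" using K(1) N by (auto simp: prime_over_type_model chain_over_def)
    obtain X Y where XY: "X \<in> x" "Y \<in> y" "\<Phi> (iso_type \<Sigma>\<^sub>1 (r\<^sub>1 K), iso_type \<Sigma>\<^sub>2 (r\<^sub>2 K)) = \<Phi> (X, Y)"
      using K(2) unfolding iso_type_model[OF mK] by blast
    \<comment> \<open>Injectivity of \<open>\<Phi>\<close> turns membership of the glued type in the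
      image into membership of its components in \<open>x\<close> and \<open>y\<close>.\<close>
    have "(iso_type \<Sigma>\<^sub>1 (r\<^sub>1 K), iso_type \<Sigma>\<^sub>2 (r\<^sub>2 K)) = (X, Y)"
    proof (rule inj_onD[OF inj_\<Phi> XY(3)])
      show "(iso_type \<Sigma>\<^sub>1 (r\<^sub>1 K), iso_type \<Sigma>\<^sub>2 (r\<^sub>2 K)) \<in> model_types \<Sigma>\<^sub>1 T\<^sub>1 \<times> model_types \<Sigma>\<^sub>2 T\<^sub>2"
        using mK by (auto simp: model_types_def model_T)
      show "(X, Y) \<in> model_types \<Sigma>\<^sub>1 T\<^sub>1 \<times> model_types \<Sigma>\<^sub>2 T\<^sub>2"
        using XY(1,2) RK_class_subset[OF x] RK_class_subset[OF y] RK_subset_model_types by blast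
    qed
    then have "iso_type \<Sigma>\<^sub>1 (r\<^sub>1 N) \<in> chain_types \<Sigma>\<^sub>1 T\<^sub>1 x" "iso_type \<Sigma>\<^sub>2 (r\<^sub>2 N) \<in> chain_types \<Sigma>\<^sub>2 T\<^sub>2 y"
      using q\<^sub>1 q\<^sub>2 XY(1,2) unfolding chain_types_def by blast+
    then show "Z \<in> \<Phi> ` (chain_types \<Sigma>\<^sub>1 T\<^sub>1 x \<times> chain_types \<Sigma>\<^sub>2 T\<^sub>2 y)"
      unfolding Z iso_type_model[OF mN] by blast
  qed
  show "\<Phi> ` (chain_types \<Sigma>\<^sub>1 T\<^sub>1 x \<times> chain_types \<Sigma>\<^sub>2 T\<^sub>2 y) \<subseteq> chain_types \<Sigma> T (\<Phi> ` (x \<times> y))"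
  proof
    fix Z assume "Z \<in> \<Phi> ` (chain_types \<Sigma>\<^sub>1 T\<^sub>1 x \<times> chain_types \<Sigma>\<^sub>2 T\<^sub>2 y)"
    then obtain X Y where Z: "Z = \<Phi> (X, Y)" "X \<in> chain_types \<Sigma>\<^sub>1 T\<^sub>1 x" "Y \<in> chain_types \<Sigma>\<^sub>2 T\<^sub>2 y" by blast
    obtain M\<^sub>1 q\<^sub>1 A where X: "X = iso_type \<Sigma>\<^sub>1 M\<^sub>1" and A: "prime_over_type \<Sigma>\<^sub>1 T\<^sub>1 q\<^sub>1 A" "iso_type \<Sigma>\<^sub>1 A \<in> x"
      and M\<^sub>1: "chain_over \<Sigma>\<^sub>1 T\<^sub>1 q\<^sub>1 M\<^sub>1"
      using Z(2) unfolding chain_types_def by blast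
    obtain M\<^sub>2 q\<^sub>2 B where Y: "Y = iso_type \<Sigma>\<^sub>2 M\<^sub>2" and B: "prime_over_type \<Sigma>\<^sub>2 T\<^sub>2 q\<^sub>2 B" "iso_type \<Sigma>\<^sub>2 B \<in> y"
      and M\<^sub>2: "chain_over \<Sigma>\<^sub>2 T\<^sub>2 q\<^sub>2 M\<^sub>2"
      using Z(3) unfolding chain_types_def by blast
    obtain q where q: "chain_over \<Sigma> T q (G M\<^sub>1 M\<^sub>2)" "prime_over_type \<Sigma> T q (G A B)"
      using chain_over_G[OF M\<^sub>1 M\<^sub>2 A(1) B(1)] by blast
    have st: "is_struct \<Sigma>\<^sub>1 M\<^sub>1" "is_struct \<Sigma>\<^sub>2 M\<^sub>2" using M\<^sub>1 M\<^sub>2 by (auto simp: chain_over_def model_def)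
    have st': "is_struct \<Sigma>\<^sub>1 A" "is_struct \<Sigma>\<^sub>2 B"
      using prime_over_type_model[OF A(1)] prime_over_type_model[OF B(1)] by (auto simp: model_def)
    have "iso_type \<Sigma> (G A B) \<in> \<Phi> ` (x \<times> y)"
      unfolding dunion_type_eq[OF st', symmetric] using A(2) B(2) by blast
    then show "Z \<in> chain_types \<Sigma> T (\<Phi> ` (x \<times> y))"
      unfolding Z(1) X Y dunion_type_eq[OF st] chain_types_def using q by blast
  qed
qed

end

section \<open>Counting\<close>

lemma ecard_finite: "finite A \<Longrightarrow> ecard A = enat (card A)"
  by (simp add: ecard_def)

lemma sum_enat: "(\<Sum>(x, y)\<in>A. enat (f x y)) = enat (\<Sum>(x, y)\<in>A. f x y)"
  by (induction A rule: infinite_finite_induct) (auto simp: zero_enat_def)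

lemma finite_model_types: "num_models \<Sigma> T < \<infinity> \<Longrightarrow> finite (model_types \<Sigma> T)"
  by (auto simp: num_models_eq ecard_def split: if_splits)

lemma chain_types_model_types: "chain_types \<Sigma> T x \<subseteq> model_types \<Sigma> T"
  unfolding model_types_def by (rule chain_types_subset)

text \<open>Finitely many models make all these sets finite, so the extended counts become natural
  numbers. The classes partition \<open>RK\<close>, and their sets of chain unions partition the
  isomorphism types of all countable models.\<close>

lemma RK_classes_counting:
  assumes cnt: "countable (dom \<Sigma>)" and T: "T \<subseteq> sentences \<Sigma>" and fin: "num_models \<Sigma> T < \<infinity>"
  shows finite_RK_classes: "finite (RK_classes \<Sigma> T)"
    and card_RK: "card (RK \<Sigma> T) = (\<Sum>x\<in>RK_classes \<Sigma> T. card x)"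
    and card_model_types: "card (model_types \<Sigma> T) = (\<Sum>x\<in>RK_classes \<Sigma> T. card (chain_types \<Sigma> T x))"
    and card_chain_types: "x \<in> RK_classes \<Sigma> T \<Longrightarrow>
      card (chain_types \<Sigma> T x) = card x + card (chain_types \<Sigma> T x - RK \<Sigma> T)"
    and I_l_enat: "I_l \<Sigma> T x = enat (card (chain_types \<Sigma> T x - RK \<Sigma> T))"
proof -
  have finM: "finite (model_types \<Sigma> T)" using fin by (rule finite_model_types)
  then have finR: "finite (RK \<Sigma> T)" using RK_subset_model_types by (rule finite_subset[rotated])
  have finC: "finite (chain_types \<Sigma> T x)" for x using chain_types_model_types finM by (rule finite_subset)
  have "RK_classes \<Sigma> T \<subseteq> Pow (RK \<Sigma> T)" using RK_class_subset by blast
  then show finCl: "finite (RK_classes \<Sigma> T)" using finR by (simp add: finite_subset)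
  have "card (\<Union>x\<in>RK_classes \<Sigma> T. x) = (\<Sum>x\<in>RK_classes \<Sigma> T. card x)"
  proof (rule card_UN_disjoint[OF finCl])
    show "\<forall>x\<in>RK_classes \<Sigma> T. finite x" using finite_subset[OF RK_class_subset finR] by blast
    show "\<forall>x\<in>RK_classes \<Sigma> T. \<forall>y\<in>RK_classes \<Sigma> T. x \<noteq> y \<longrightarrow> x \<inter> y = {}"
      using RK_classes_disjoint by blast
  qed
  moreover have "(\<Union>x\<in>RK_classes \<Sigma> T. x) = RK \<Sigma> T"
  proof
    show "(\<Union>x\<in>RK_classes \<Sigma> T. x) \<subseteq> RK \<Sigma> T" by (rule UN_least) (rule RK_class_subset)
    show "RK \<Sigma> T \<subseteq> (\<Union>x\<in>RK_classes \<Sigma> T. x)" using ex_RK_class by blast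
  qed
  ultimately show "card (RK \<Sigma> T) = (\<Sum>x\<in>RK_classes \<Sigma> T. card x)" by simp
  have "card (\<Union>x\<in>RK_classes \<Sigma> T. chain_types \<Sigma> T x) = (\<Sum>x\<in>RK_classes \<Sigma> T. card (chain_types \<Sigma> T x))"
  proof (rule card_UN_disjoint[OF finCl])
    show "\<forall>x\<in>RK_classes \<Sigma> T. \<forall>y\<in>RK_classes \<Sigma> T. x \<noteq> y \<longrightarrow> chain_types \<Sigma> T x \<inter> chain_types \<Sigma> T y = {}"
      using chain_types_disjoint by blast
  qed (simp add: finC)
  then show "card (model_types \<Sigma> T) = (\<Sum>x\<in>RK_classes \<Sigma> T. card (chain_types \<Sigma> T x))"
    unfolding Union_chain_types[OF cnt T fin] model_types_def .
  show "card (chain_types \<Sigma> T x) = card x + card (chain_types \<Sigma> T x - RK \<Sigma> T)" if "x \<in> RK_classes \<Sigma> T"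
    using card_Int_Diff[OF finC, of x "RK \<Sigma> T"] chain_types_Int_RK[OF T that] by simp
  show "I_l \<Sigma> T x = enat (card (chain_types \<Sigma> T x - RK \<Sigma> T))"
    unfolding I_l_eq[OF T] using finC by (simp add: ecard_finite)
qed

theorem theorem2p1:
  fixes \<Sigma>\<^sub>1 \<Sigma>\<^sub>2 \<Sigma> :: "'r lang" and T\<^sub>1 T\<^sub>2 T :: "'r fm set" and P\<^sub>1 P\<^sub>2 :: 'r
    and M\<^sub>1 :: "('r, 'a) struct" and M\<^sub>2 :: "('r, 'b) struct"
  assumes "countable (dom \<Sigma>\<^sub>1)" and "countable (dom \<Sigma>\<^sub>2)"
    and "dom \<Sigma>\<^sub>1 \<inter> dom \<Sigma>\<^sub>2 = {}"
    and "P\<^sub>1 \<notin> dom \<Sigma>\<^sub>1 \<union> dom \<Sigma>\<^sub>2" and "P\<^sub>2 \<notin> dom \<Sigma>\<^sub>1 \<union> dom \<Sigma>\<^sub>2" and "P\<^sub>1 \<noteq> P\<^sub>2"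
    and "complete_theory \<Sigma>\<^sub>1 T\<^sub>1" and "complete_theory \<Sigma>\<^sub>2 T\<^sub>2"
    and "Ehrenfeucht \<Sigma>\<^sub>1 T\<^sub>1" and "Ehrenfeucht \<Sigma>\<^sub>2 T\<^sub>2"
    and "model \<Sigma>\<^sub>1 T\<^sub>1 M\<^sub>1" and "model \<Sigma>\<^sub>2 T\<^sub>2 M\<^sub>2"
    and "\<Sigma> = dunion_lang P\<^sub>1 P\<^sub>2 \<Sigma>\<^sub>1 \<Sigma>\<^sub>2"
    and "T = Th \<Sigma> (dunion P\<^sub>1 P\<^sub>2 M\<^sub>1 M\<^sub>2)"
  shows "(preorder_iso (preorder_prod (RK_graph \<Sigma>\<^sub>1 T\<^sub>1) (RK_graph \<Sigma>\<^sub>2 T\<^sub>2)) (RK_graph \<Sigma> T)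
           (dunion_type P\<^sub>1 P\<^sub>2 \<Sigma>\<^sub>1 \<Sigma>\<^sub>2)) \<and>
    (num_models \<Sigma> T =
           (\<Sum>(x, y) \<in> RK_classes \<Sigma>\<^sub>1 T\<^sub>1 \<times> RK_classes \<Sigma>\<^sub>2 T\<^sub>2. ecard x * ecard y) +
           (\<Sum>(x, y) \<in> RK_classes \<Sigma>\<^sub>1 T\<^sub>1 \<times> RK_classes \<Sigma>\<^sub>2 T\<^sub>2.
              I_l \<Sigma>\<^sub>1 T\<^sub>1 x * ecard y + ecard x * I_l \<Sigma>\<^sub>2 T\<^sub>2 y + I_l \<Sigma>\<^sub>1 T\<^sub>1 x * I_l \<Sigma>\<^sub>2 T\<^sub>2 y)) \<and>
    ((\<Sum>(x, y) \<in> RK_classes \<Sigma>\<^sub>1 T\<^sub>1 \<times> RK_classes \<Sigma>\<^sub>2 T\<^sub>2. ecard x * ecard y) =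
           ecard {iso_type \<Sigma> M |M. prime_over_tuple \<Sigma> T M}) \<and>
    (\<forall>x \<in> RK_classes \<Sigma>\<^sub>1 T\<^sub>1. \<forall>y \<in> RK_classes \<Sigma>\<^sub>2 T\<^sub>2.
           dunion_type P\<^sub>1 P\<^sub>2 \<Sigma>\<^sub>1 \<Sigma>\<^sub>2 ` (x \<times> y) \<in> RK_classes \<Sigma> T \<and>
           I_l \<Sigma> T (dunion_type P\<^sub>1 P\<^sub>2 \<Sigma>\<^sub>1 \<Sigma>\<^sub>2 ` (x \<times> y)) =
             I_l \<Sigma>\<^sub>1 T\<^sub>1 x * ecard y + ecard x * I_l \<Sigma>\<^sub>2 T\<^sub>2 y + I_l \<Sigma>\<^sub>1 T\<^sub>1 x * I_l \<Sigma>\<^sub>2 T\<^sub>2 y) \<and>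
    (lattice (preorder_prod (RK_graph \<Sigma>\<^sub>1 T\<^sub>1) (RK_graph \<Sigma>\<^sub>2 T\<^sub>2)) \<longleftrightarrow>
           lattice (RK_graph \<Sigma>\<^sub>1 T\<^sub>1) \<and> lattice (RK_graph \<Sigma>\<^sub>2 T\<^sub>2)) \<and>
    (boolean_lattice (preorder_prod (RK_graph \<Sigma>\<^sub>1 T\<^sub>1) (RK_graph \<Sigma>\<^sub>2 T\<^sub>2)) \<longleftrightarrow>
           boolean_lattice (RK_graph \<Sigma>\<^sub>1 T\<^sub>1) \<and> boolean_lattice (RK_graph \<Sigma>\<^sub>2 T\<^sub>2))"
proof -
  have S\<^sub>1: "T\<^sub>1 \<subseteq> sentences \<Sigma>\<^sub>1" and S\<^sub>2: "T\<^sub>2 \<subseteq> sentences \<Sigma>\<^sub>2"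
    using assms(7,8) by (auto simp: complete_theory_def)
  interpret L: two_languages \<Sigma>\<^sub>1 \<Sigma>\<^sub>2 P\<^sub>1 P\<^sub>2
    by (rule two_languages.intro) (fact assms(3-6))+
  interpret D: two_theories \<Sigma>\<^sub>1 \<Sigma>\<^sub>2 P\<^sub>1 P\<^sub>2 T\<^sub>1 T\<^sub>2 T
  proof (unfold_locales)
    show "T \<subseteq> sentences (dunion_lang P\<^sub>1 P\<^sub>2 \<Sigma>\<^sub>1 \<Sigma>\<^sub>2)"
      unfolding assms(14) assms(13)[symmetric] by (auto simp: Th_def)
    show "model (dunion_lang P\<^sub>1 P\<^sub>2 \<Sigma>\<^sub>1 \<Sigma>\<^sub>2) T N \<longleftrightarrow> L.decomposed N \<and>
        model \<Sigma>\<^sub>1 T\<^sub>1 (restr P\<^sub>1 \<Sigma>\<^sub>1 N) \<and> model \<Sigma>\<^sub>2 T\<^sub>2 (restr P\<^sub>2 \<Sigma>\<^sub>2 N)" for N :: "'r cstruct"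
      unfolding assms(14) assms(13) by (rule L.model_Th_dunion[OF assms(1,2,7,8,11,12)])
  qed (fact S\<^sub>1, fact S\<^sub>2)
  have fin: "num_models \<Sigma>\<^sub>1 T\<^sub>1 < \<infinity>" "num_models \<Sigma>\<^sub>2 T\<^sub>2 < \<infinity>"
    using assms(9,10) by (auto simp: Ehrenfeucht_def)
  let ?C\<^sub>1 = "RK_classes \<Sigma>\<^sub>1 T\<^sub>1" and ?C\<^sub>2 = "RK_classes \<Sigma>\<^sub>2 T\<^sub>2"
  let ?t\<^sub>1 = "chain_types \<Sigma>\<^sub>1 T\<^sub>1" and ?t\<^sub>2 = "chain_types \<Sigma>\<^sub>2 T\<^sub>2"
  define l\<^sub>1 where "l\<^sub>1 x = card (?t\<^sub>1 x - RK \<Sigma>\<^sub>1 T\<^sub>1)" for x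
  define l\<^sub>2 where "l\<^sub>2 y = card (?t\<^sub>2 y - RK \<Sigma>\<^sub>2 T\<^sub>2)" for y
  note c\<^sub>1 = RK_classes_counting[OF assms(1) S\<^sub>1 fin(1), folded l\<^sub>1_def]
  note c\<^sub>2 = RK_classes_counting[OF assms(2) S\<^sub>2 fin(2), folded l\<^sub>2_def]
  have finM: "finite (model_types \<Sigma>\<^sub>1 T\<^sub>1)" "finite (model_types \<Sigma>\<^sub>2 T\<^sub>2)"
    using fin by (auto intro: finite_model_types)
  then have finR: "finite (RK \<Sigma>\<^sub>1 T\<^sub>1)" "finite (RK \<Sigma>\<^sub>2 T\<^sub>2)"
    using RK_subset_model_types by (auto intro: finite_subset)
  have ecard\<^sub>1: "ecard x = enat (card x)" if "x \<in> ?C\<^sub>1" for x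
    by (rule ecard_finite) (rule finite_subset[OF RK_class_subset[OF that] finR(1)])
  have ecard\<^sub>2: "ecard y = enat (card y)" if "y \<in> ?C\<^sub>2" for y
    by (rule ecard_finite) (rule finite_subset[OF RK_class_subset[OF that] finR(2)])

  have sum\<^sub>1: "(\<Sum>(x, y) \<in> ?C\<^sub>1 \<times> ?C\<^sub>2. ecard x * ecard y) = enat (\<Sum>(x, y) \<in> ?C\<^sub>1 \<times> ?C\<^sub>2. card x * card y)"
    unfolding sum_enat[symmetric] by (intro sum.cong refl) (auto simp: ecard\<^sub>1 ecard\<^sub>2)
  have sum\<^sub>2: "(\<Sum>(x, y) \<in> ?C\<^sub>1 \<times> ?C\<^sub>2.
        I_l \<Sigma>\<^sub>1 T\<^sub>1 x * ecard y + ecard x * I_l \<Sigma>\<^sub>2 T\<^sub>2 y + I_l \<Sigma>\<^sub>1 T\<^sub>1 x * I_l \<Sigma>\<^sub>2 T\<^sub>2 y) =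
      enat (\<Sum>(x, y) \<in> ?C\<^sub>1 \<times> ?C\<^sub>2. l\<^sub>1 x * card y + card x * l\<^sub>2 y + l\<^sub>1 x * l\<^sub>2 y)"
    unfolding sum_enat[symmetric]
    by (intro sum.cong refl) (auto simp: ecard\<^sub>1 ecard\<^sub>2 c\<^sub>1(5) c\<^sub>2(5))

  have injR: "inj_on D.\<Phi> (RK \<Sigma>\<^sub>1 T\<^sub>1 \<times> RK \<Sigma>\<^sub>2 T\<^sub>2)"
    by (rule inj_on_subset[OF D.inj_\<Phi>]) (intro Sigma_mono RK_subset_model_types)
  have "card (RK \<Sigma> T) = card (RK \<Sigma>\<^sub>1 T\<^sub>1) * card (RK \<Sigma>\<^sub>2 T\<^sub>2)"
    unfolding assms(13) D.\<Phi>_RK[symmetric] card_image[OF injR] by (rule card_cartesian_product)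
  also have "\<dots> = (\<Sum>(x, y) \<in> ?C\<^sub>1 \<times> ?C\<^sub>2. card x * card y)"
    unfolding c\<^sub>1(2) c\<^sub>2(2) by (simp add: sum_product sum.cartesian_product)
  finally have cardR: "card (RK \<Sigma> T) = (\<Sum>(x, y) \<in> ?C\<^sub>1 \<times> ?C\<^sub>2. card x * card y)" .
  have "finite (RK \<Sigma> T)" unfolding assms(13) D.\<Phi>_RK[symmetric] using finR by blast
  then have prime: "(\<Sum>(x, y) \<in> ?C\<^sub>1 \<times> ?C\<^sub>2. ecard x * ecard y) = ecard {iso_type \<Sigma> M |M. prime_over_tuple \<Sigma> T M}"
    unfolding sum\<^sub>1 RK_eq[symmetric] cardR[symmetric] by (rule ecard_finite[symmetric])

  have "finite (model_types \<Sigma> T)"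
    unfolding assms(13) D.\<Phi>_model_types[symmetric] using finM by blast
  then have "num_models \<Sigma> T = enat (card (model_types \<Sigma> T))" by (simp add: num_models_eq ecard_finite)
  also have "card (model_types \<Sigma> T) = card (model_types \<Sigma>\<^sub>1 T\<^sub>1) * card (model_types \<Sigma>\<^sub>2 T\<^sub>2)"
    unfolding assms(13) D.\<Phi>_model_types[symmetric] card_image[OF D.inj_\<Phi>] by (rule card_cartesian_product)
  also have "\<dots> = (\<Sum>(x, y) \<in> ?C\<^sub>1 \<times> ?C\<^sub>2. card (?t\<^sub>1 x) * card (?t\<^sub>2 y))"
    unfolding c\<^sub>1(3) c\<^sub>2(3) by (simp add: sum_product sum.cartesian_product)
  \<comment> \<open>The factors \<open>card x + l\<^sub>1 x\<close> and
    \<open>card y + l\<^sub>2 y\<close>, prime plus limit, are multiplied out.\<close>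
  also have "\<dots> = (\<Sum>(x, y) \<in> ?C\<^sub>1 \<times> ?C\<^sub>2. card x * card y +
      (l\<^sub>1 x * card y + card x * l\<^sub>2 y + l\<^sub>1 x * l\<^sub>2 y))"
    by (intro sum.cong refl) (auto simp: c\<^sub>1(4) c\<^sub>2(4) algebra_simps)
  also have "enat \<dots> = enat (\<Sum>(x, y) \<in> ?C\<^sub>1 \<times> ?C\<^sub>2. card x * card y) +
      enat (\<Sum>(x, y) \<in> ?C\<^sub>1 \<times> ?C\<^sub>2. l\<^sub>1 x * card y + card x * l\<^sub>2 y + l\<^sub>1 x * l\<^sub>2 y)"
    by (simp add: split_def sum.distrib)
  finally have num: "num_models \<Sigma> T = (\<Sum>(x, y) \<in> ?C\<^sub>1 \<times> ?C\<^sub>2. ecard x * ecard y) +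
      (\<Sum>(x, y) \<in> ?C\<^sub>1 \<times> ?C\<^sub>2.
        I_l \<Sigma>\<^sub>1 T\<^sub>1 x * ecard y + ecard x * I_l \<Sigma>\<^sub>2 T\<^sub>2 y + I_l \<Sigma>\<^sub>1 T\<^sub>1 x * I_l \<Sigma>\<^sub>2 T\<^sub>2 y)"
    unfolding sum\<^sub>1 sum\<^sub>2 .

  have limit: "I_l \<Sigma> T (D.\<Phi> ` (x \<times> y)) =
      I_l \<Sigma>\<^sub>1 T\<^sub>1 x * ecard y + ecard x * I_l \<Sigma>\<^sub>2 T\<^sub>2 y + I_l \<Sigma>\<^sub>1 T\<^sub>1 x * I_l \<Sigma>\<^sub>2 T\<^sub>2 y"
    if x: "x \<in> ?C\<^sub>1" and y: "y \<in> ?C\<^sub>2" for x y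
  proof -
    have sub: "?t\<^sub>1 x \<times> ?t\<^sub>2 y \<subseteq> model_types \<Sigma>\<^sub>1 T\<^sub>1 \<times> model_types \<Sigma>\<^sub>2 T\<^sub>2"
      "RK \<Sigma>\<^sub>1 T\<^sub>1 \<times> RK \<Sigma>\<^sub>2 T\<^sub>2 \<subseteq> model_types \<Sigma>\<^sub>1 T\<^sub>1 \<times> model_types \<Sigma>\<^sub>2 T\<^sub>2"
      by (intro Sigma_mono chain_types_model_types RK_subset_model_types)+
    have fint: "finite (?t\<^sub>1 x \<times> ?t\<^sub>2 y)" using sub(1) finM by (rule finite_subset[OF _ finite_cartesian_product])
    \<comment> \<open>Pairs of chain unions with at least one entry that is not prime over a tuple;
      exactly these glue to limit models.\<close>
    let ?d = "?t\<^sub>1 x \<times> ?t\<^sub>2 y - RK \<Sigma>\<^sub>1 T\<^sub>1 \<times> RK \<Sigma>\<^sub>2 T\<^sub>2"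
    have "chain_types \<Sigma> T (D.\<Phi> ` (x \<times> y)) - RK \<Sigma> T = D.\<Phi> ` ?d"
      unfolding assms(13) D.chain_types_\<Phi>[OF x y] D.\<Phi>_RK[symmetric]
      by (rule inj_on_image_set_diff[OF D.inj_\<Phi>, symmetric]) (use sub in blast)+
    moreover have "inj_on D.\<Phi> ?d" by (rule inj_on_subset[OF D.inj_\<Phi>]) (use sub in blast)
    ultimately have "I_l \<Sigma> T (D.\<Phi> ` (x \<times> y)) = enat (card ?d)"
      using I_l_eq[OF D.T, of "D.\<Phi> ` (x \<times> y)"] fint unfolding assms(13)
      by (simp add: ecard_finite card_image)
    moreover have "card ?d = l\<^sub>1 x * card y + card x * l\<^sub>2 y + l\<^sub>1 x * l\<^sub>2 y"
    proof -
      have "(?t\<^sub>1 x \<times> ?t\<^sub>2 y) \<inter> (RK \<Sigma>\<^sub>1 T\<^sub>1 \<times> RK \<Sigma>\<^sub>2 T\<^sub>2) = x \<times> y"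
        unfolding Times_Int_Times chain_types_Int_RK[OF S\<^sub>1 x] chain_types_Int_RK[OF S\<^sub>2 y] ..
      then have "card (?t\<^sub>1 x \<times> ?t\<^sub>2 y) = card (x \<times> y) + card ?d"
        using card_Int_Diff[OF fint, of "RK \<Sigma>\<^sub>1 T\<^sub>1 \<times> RK \<Sigma>\<^sub>2 T\<^sub>2"] by simp
      then show ?thesis
        unfolding card_cartesian_product c\<^sub>1(4)[OF x] c\<^sub>2(4)[OF y] by (simp add: algebra_simps)
    qed
    ultimately show ?thesis by (simp add: ecard\<^sub>1[OF x] ecard\<^sub>2[OF y] c\<^sub>1(5) c\<^sub>2(5))
  qed

  \<comment> \<open>The lattice equivalences need nonempty factors. Some prime model exists because
    any model is the union of a chain of prime ones.\<close>
  have ne: "RK \<Sigma>' T' \<noteq> {}"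
    if th: "countable (dom \<Sigma>')" "complete_theory \<Sigma>' T'" "num_models \<Sigma>' T' < \<infinity>" for \<Sigma>' :: "'r lang" and T'
  proof -
    obtain M :: "'r cstruct" where "model \<Sigma>' T' M" and "T' \<subseteq> sentences \<Sigma>'"
      using th(2) by (auto simp: complete_theory_def)
    then show ?thesis using ex_prime_over_tuple[OF th(1) _ th(3)] by (auto simp: RK_eq)
  qed
  interpret N: nonempty_product "RK_graph \<Sigma>\<^sub>1 T\<^sub>1" "RK_graph \<Sigma>\<^sub>2 T\<^sub>2"
    using ne[OF assms(1,7) fin(1)] ne[OF assms(2,8) fin(2)] by unfold_locales (simp_all add: RK_graph_def)

  have cls: "D.\<Phi> ` (x \<times> y) \<in> RK_classes \<Sigma> T" if "x \<in> ?C\<^sub>1" "y \<in> ?C\<^sub>2" for x y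
    unfolding assms(13) using that by (rule D.\<Phi>_class)
  have iso: "preorder_iso (preorder_prod (RK_graph \<Sigma>\<^sub>1 T\<^sub>1) (RK_graph \<Sigma>\<^sub>2 T\<^sub>2)) (RK_graph \<Sigma> T) D.\<Phi>"
    unfolding assms(13) by (rule D.RK_preorder_iso)
  show ?thesis
    using iso num prime cls limit N.lattice_AB N.boolean_lattice_AB by (intro conjI ballI)
qed

end
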